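(* Consider the federated composite problem $\min_{x\in\mathbb{R}^p}F(x)=f(x)+h(x)$, $f=\frac1N\sum_{i=1}^N f_i$, and the iterates of the FedCEF algorithm described in the context, under the smoothness, regularizer, stochastic-gradient and compressor assumptions listed there. Let $\alpha>0$ and $\eta_g>0$ be the local and server learning rates, let $K$ be the number of local steps, let $\eta\in(0,1]$ be the momentum parameter and $q\in[0,1)$ the compression factor, and let the effective global step size be $\beta:=\alpha\eta_gK$. Suppose $$\beta\le\frac{\min\{\eta^2,(1-q)^2\}}{25L}\qquad\text{and}\qquad \eta_g\ge\frac{\sqrt{16(1-q)^2+161\eta^2}}{5\eta(1-q)}.$$ Then for every integer $T\ge1$, $$\frac1T\sum_{t=0}^{T-1}\mathbb{E}\|G_\beta(z^t)\|^2\le\frac{\Psi^0}{\gamma\beta T}+\mathcal{C}_{\mathrm{stoc}}\frac{\sigma^2}{KB}+\mathcal{C}_{\mathrm{approx}}\frac{L^2\beta^2}{\eta_g^2}B_h^2,$$ where $\gamma=0.15$, $$\mathcal{C}_{\mathrm{stoc}}=6.7\left(\frac{17\eta}{N}+\frac{14\eta^2}{1-q}+\frac{140\eta^3}{(1-q)^2}\right),\qquad \mathcal{C}_{\mathrm{approx}}=\frac{18.4}{\gamma}\left(16+\frac{161\eta^2}{(1-q)^2}\right),$$ and, with $F^*:=\inf_{x}F(x)$, $v^t:=\frac1N\sum_{i=1}^Nv_i^t$ and the convention $z^{-1}:=z^0$, the Lyapunov function is $$\Psi^t=\mathbb{E}[F(z^t)-F^*]+\frac{8\beta}{\eta}\mathbb{E}\|v^t-\nabla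 f(z^{t-1})\|^2+\frac{7\beta}{1-q}\frac1N\sum_{i=1}^N\mathbb{E}\|v_i^t-c_i^t\|^2+\frac{70\eta\beta}{(1-q)^2}\frac1N\sum_{i=1}^N\mathbb{E}\|v_i^t-\nabla f_i(z^{t-1})\|^2 .$$ (If $\Psi^0=+\infty$ the bound is vacuous.)
   Context: Norms are Euclidean on $\mathbb{R}^p$. $N$ is the number of clients. Assumptions. (Smoothness) There is $L>0$ such that each $f_i:\mathbb{R}^p\to\mathbb{R}$ (not necessarily convex) is differentiable and for all $x,y$: $f_i(x)-f_i(y)-\langle\nabla f_i(y),x-y\rangle\le\frac L2\|x-y\|^2$ and $\|\nabla f_i(x)-\nabla f_i(y)\|\le L\|x-y\|$. (Regularizer) $h:\mathbb{R}^p\to\mathbb{R}\cup\{+\infty\}$ is proper, closed and convex, and there is $B_h>0$ with $\|h'(z)\|\le B_h$ for every subgradient $h'(z)\in\partial h(z)$ at any $z$. (Stochastic gradients) $g_i(x)=\frac1B\sum_{b=1}^B\nabla f_i(x;\xi_{i,b})$ with $\xi_{i,1},\dots,\xi_{i,B}$ i.i.d. from $\mathcal{D}_i$, where $f_i(x)=\mathbb{E}_{\xi\sim\mathcal{D}_i}f(x;\xi)$ and $\nabla f_i(x;\xi)$ denotes the gradient in $x$ of the sample loss $f(x;\xi)$ of client $i$; for all $x$ and some $\sigma>0$, $\mathbb{E}[g_i(x)]=\nabla f_i(x)$ and $\mathbb{E}\|g_i(x)-\nabla f_i(x)\|^2\le\sigma^2/B$. Fresh mini-batches, independent of the past and across clients,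 are drawn at every local step, so these hold conditionally on the past. (Contractive compressor) The (possibly randomized) map $\mathcal{C}:\mathbb{R}^p\to\mathbb{R}^p$ satisfies $\mathbb{E}\|\mathcal{C}(x)-x\|^2\le q^2\|x\|^2$ for all $x$, with $q\in[0,1)$; its randomness is fresh at each use, so this holds conditionally on the input. Proximal operator: $\mathbf{prox}_{\gamma h}(y)=\arg\min_u\{h(u)+\frac1{2\gamma}\|u-y\|^2\}$ for $\gamma>0$. Proximal gradient mapping: $G_\beta(z)=\frac1\beta\big(z-\mathbf{prox}_{\beta h}(z-\beta\nabla f(z))\big)$. FedCEF algorithm. Parameters $\alpha,\beta>0$, $\eta\in(0,1]$, integers $K,B\ge1$. Initialize at a given (deterministic) $z^0\in\mathbb{R}^p$, with $c_i^0=c^0=0$, $v_i^0=0$ for all $i$. For $t=0,1,2,\dots$, every client $i=1,\dots,N$ sets $\hat x_i^{t,0}=x_i^{t,0}=z^t$ and for $k=0,\dots,K-1$ computes $$\hat x_i^{t,k+1}=\hat x_i^{t,k}-\alpha\big(g_i(x_i^{t,k})+c^t-c_i^t\big),\qquad x_i^{t,k+1}=\mathbf{prox}_{(k+1)\alpha h}(\hat x_i^{t,k+1}).$$ Then $$v_i^{t+1}=(1-\eta)v_i^t+\eta\Big(\frac{\hat x_i^{t,0}-\hat x_i^{t,K}}{\alpha K}+c_i^t-c^t\Big),\quad \Delta_i^t=\mathcal{C}(v_i^{t+1}-c_i^t),\quad c_i^{t+1}=c_i^t+\Delta_i^t,$$ and the server/clients update $c^{t+1}=c^t+\frac1N\sum_{i=1}^N\Delta_i^t$,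 $\tilde z^{t+1}=z^t-\beta c^{t+1}$, $z^{t+1}=\mathbf{prox}_{\beta h}(\tilde z^{t+1})$. *)

theory Defs
  imports "HOL-Probability.Probability"
begin

text \<open>Only meaningful at points where the function is differentiable.\<close>

definition gradient :: "('a::real_inner \<Rightarrow> real) \<Rightarrow> 'a \<Rightarrow> 'a" where
  "gradient f x = (THE D. GDERIV f x :> D)"

text \<open>The library constant \<open>epigraph\<close> covers real-valued functions only; here the value
  \<open>\<infinity>\<close> is allowed, and the epigraph still consists of pairs with a real second component.\<close>

definition ereal_epigraph :: "('a \<Rightarrow> ereal) \<Rightarrow> ('a \<times> real) set" where
  "ereal_epigraph h = {(x, r). h x \<le> ereal r}"

definition proper_fun :: "('a \<Rightarrow> ereal) \<Rightarrow> bool" where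
  "proper_fun h \<longleftrightarrow> (\<forall>x. h x \<noteq> -\<infinity>) \<and> (\<exists>x. h x \<noteq> \<infinity>)"

definition closed_fun :: "('a::topological_space \<Rightarrow> ereal) \<Rightarrow> bool" where
  "closed_fun h \<longleftrightarrow> closed (ereal_epigraph h)"

definition convex_fun :: "('a::real_vector \<Rightarrow> ereal) \<Rightarrow> bool" where
  "convex_fun h \<longleftrightarrow> convex (ereal_epigraph h)"

definition subdifferential :: "('a::real_inner \<Rightarrow> ereal) \<Rightarrow> 'a \<Rightarrow> 'a set" where
  "subdifferential h z = {g. \<forall>y. h z + ereal (g \<bullet> (y - z)) \<le> h y}"

definition prox :: "real \<Rightarrow> ('a::real_normed_vector \<Rightarrow> ereal) \<Rightarrow> 'a \<Rightarrow> 'a" where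
  "prox \<gamma> h y = (ARG_MIN (\<lambda>u. h u + ereal (1 / (2 * \<gamma>) * (norm (u - y))\<^sup>2)) u. True)"

definition prox_grad_map ::
  "('a::real_inner \<Rightarrow> real) \<Rightarrow> ('a \<Rightarrow> ereal) \<Rightarrow> real \<Rightarrow> 'a \<Rightarrow> 'a" where
  "prox_grad_map f h \<beta> z = (1 / \<beta>) *\<^sub>R (z - prox \<beta> h (z - \<beta> *\<^sub>R gradient f z))"

definition avg_loss :: "nat \<Rightarrow> (nat \<Rightarrow> 'a \<Rightarrow> real) \<Rightarrow> 'a \<Rightarrow> real" where
  "avg_loss N f x = (1 / real N) * (\<Sum>i=1..N. f i x)"

definition objective :: "nat \<Rightarrow> (nat \<Rightarrow> 'a \<Rightarrow> real) \<Rightarrow> ('a \<Rightarrow> ereal) \<Rightarrow> 'a \<Rightarrow> ereal" where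
  "objective N f h x = ereal (avg_loss N f x) + h x"

definition minibatch_grad ::
  "('a::real_inner \<Rightarrow> 's \<Rightarrow> real) \<Rightarrow> nat \<Rightarrow> (nat \<Rightarrow> 's) \<Rightarrow> 'a \<Rightarrow> 'a" where
  "minibatch_grad l B s x = (1 / real B) *\<^sub>R (\<Sum>b=1..B. gradient (\<lambda>y. l y (s b)) x)"

text \<open>The recursion is deterministic once the realised gradient oracles and compressors are given:
  \<open>g t i k\<close> is the mini-batch gradient used by client \<open>i\<close> in round \<open>t\<close> at local step \<open>k\<close>, and
  \<open>Q t i\<close> is the realisation of the compressor used by client \<open>i\<close> in round \<open>t\<close>.\<close>

text \<open>The pair returned by \<open>local_steps\<close> is \<open>(xh, x)\<close> after \<open>k\<close> local steps, where \<open>xh\<close> is the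
  iterate before the proximal step; \<open>d\<close> is the correction, global minus local control variate.\<close>

primrec local_steps ::
  "('a::real_normed_vector \<Rightarrow> ereal) \<Rightarrow> real \<Rightarrow> (nat \<Rightarrow> 'a \<Rightarrow> 'a) \<Rightarrow> 'a \<Rightarrow> 'a \<Rightarrow> nat \<Rightarrow> 'a \<times> 'a" where
  "local_steps h \<alpha> g d z 0 = (z, z)"
| "local_steps h \<alpha> g d z (Suc k) =
     (let (xh, x) = local_steps h \<alpha> g d z k;
          xh' = xh - \<alpha> *\<^sub>R (g k x + d)
      in (xh', prox (real (k + 1) * \<alpha>) h xh'))"

record 'a fed_state =
  srv_z :: 'a
  srv_c :: 'a
  cl_c :: "nat \<Rightarrow> 'a"
  cl_v :: "nat \<Rightarrow> 'a"

primrec fedcef ::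
  "nat \<Rightarrow> nat \<Rightarrow> real \<Rightarrow> real \<Rightarrow> real \<Rightarrow> ('a::real_normed_vector \<Rightarrow> ereal) \<Rightarrow> 'a \<Rightarrow>
   (nat \<Rightarrow> nat \<Rightarrow> nat \<Rightarrow> 'a \<Rightarrow> 'a) \<Rightarrow> (nat \<Rightarrow> nat \<Rightarrow> 'a \<Rightarrow> 'a) \<Rightarrow> nat \<Rightarrow> 'a fed_state" where
  "fedcef N K \<alpha> \<beta> \<eta> h z0 g Q 0 =
     \<lparr>srv_z = z0, srv_c = 0, cl_c = (\<lambda>i. 0), cl_v = (\<lambda>i. 0)\<rparr>"
| "fedcef N K \<alpha> \<beta> \<eta> h z0 g Q (Suc t) =
     (let S = fedcef N K \<alpha> \<beta> \<eta> h z0 g Q t;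
          z = srv_z S; c = srv_c S; ci = cl_c S; v = cl_v S;
          xhK = (\<lambda>i. fst (local_steps h \<alpha> (g t i) (c - ci i) z K));
          v' = (\<lambda>i. (1 - \<eta>) *\<^sub>R v i
                    + \<eta> *\<^sub>R ((1 / (\<alpha> * real K)) *\<^sub>R (z - xhK i) + ci i - c));
          \<Delta> = (\<lambda>i. Q t i (v' i - ci i));
          c' = c + (1 / real N) *\<^sub>R (\<Sum>i=1..N. \<Delta> i)
      in \<lparr>srv_z = prox \<beta> h (z - \<beta> *\<^sub>R c'), srv_c = c', cl_c = (\<lambda>i. ci i + \<Delta> i), cl_v = v'\<rparr>)"

text \<open>Indices of the elementary random draws: \<open>Sample t i k b\<close> is the \<open>b\<close>-th sample of the
  mini-batch of client \<open>i\<close> at local step \<open>k\<close> of round \<open>t\<close>; \<open>Compression t i\<close> is the internal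
  randomness of the compressor call of client \<open>i\<close> in round \<open>t\<close>.\<close>

datatype draw = Sample nat nat nat nat | Compression nat nat

definition draws :: "nat \<Rightarrow> nat \<Rightarrow> nat \<Rightarrow> draw set" where
  "draws N K B = {Sample t i k b | t i k b. i \<in> {1..N} \<and> k < K \<and> b \<in> {1..B}}
               \<union> {Compression t i | t i. i \<in> {1..N}}"

text \<open>The event system generated by one draw. Samples and compressor randomness live in different
  value spaces, so independence is expressed through \<open>indep_sets\<close> of these systems instead of
  \<open>indep_vars\<close>.\<close>

fun draw_events ::
  "'w measure \<Rightarrow> (nat \<Rightarrow> 's measure) \<Rightarrow> 'r measure \<Rightarrow>
   (nat \<Rightarrow> nat \<Rightarrow> nat \<Rightarrow> nat \<Rightarrow> 'w \<Rightarrow> 's) \<Rightarrow> (nat \<Rightarrow> nat \<Rightarrow> 'w \<Rightarrow> 'r) \<Rightarrow> draw \<Rightarrow> 'w set set" where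
  "draw_events M D R \<xi> \<zeta> (Sample t i k b) = sets (vimage_algebra (space M) (\<xi> t i k b) (D i))"
| "draw_events M D R \<xi> \<zeta> (Compression t i) = sets (vimage_algebra (space M) (\<zeta> t i) R)"

text \<open>Expectations of nonnegative quantities are nonnegative Lebesgue integrals, so the value
  \<open>\<infinity>\<close> is kept. In the first summand \<open>objective N f h x\<close> minus its infimum is a nonnegative
  extended real for proper \<open>h\<close> (namely \<open>\<infinity>\<close> if the infimum is \<open>-\<infinity>\<close>). Truncated subtraction
  in \<open>t - 1\<close> implements the convention that the iterate of index \<open>-1\<close> is the initial one.\<close>

definition lyapunov ::
  "'w measure \<Rightarrow> nat \<Rightarrow> (nat \<Rightarrow> 'a::real_inner \<Rightarrow> real) \<Rightarrow> ('a \<Rightarrow> ereal) \<Rightarrow>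
   real \<Rightarrow> real \<Rightarrow> real \<Rightarrow> (nat \<Rightarrow> 'w \<Rightarrow> 'a fed_state) \<Rightarrow> nat \<Rightarrow> ennreal" where
  "lyapunov M N f h \<beta> \<eta> q S t =
     (\<integral>\<^sup>+\<omega>. e2ennreal (objective N f h (srv_z (S t \<omega>)) - (INF x. objective N f h x)) \<partial>M)
   + ennreal (8 * \<beta> / \<eta>) *
       (\<integral>\<^sup>+\<omega>. ennreal ((norm ((1 / real N) *\<^sub>R (\<Sum>i=1..N. cl_v (S t \<omega>) i)
                - gradient (avg_loss N f) (srv_z (S (t - 1) \<omega>))))\<^sup>2) \<partial>M)
   + ennreal (7 * \<beta> / (1 - q) * (1 / real N)) *
       (\<Sum>i=1..N. \<integral>\<^sup>+\<omega>. ennreal ((norm (cl_v (S t \<omega>) i - cl_c (S t \<omega>) i))\<^sup>2) \<partial>M)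
   + ennreal (70 * \<eta> * \<beta> / (1 - q)\<^sup>2 * (1 / real N)) *
       (\<Sum>i=1..N. \<integral>\<^sup>+\<omega>. ennreal ((norm (cl_v (S t \<omega>) i
                - gradient (f i) (srv_z (S (t - 1) \<omega>))))\<^sup>2) \<partial>M)"

end

theory Submission
  imports Defs
begin

text \<open>Every fresh mini-batch is independent of the history, so gradient noise is
  orthogonal to the state at the start of a round and between different clients and local steps; the
  momentum, compression and tracking errors therefore satisfy linear recursions in which the noise
  only enters through its averaged second moment, up to its correlation with the client drift, which
  Young's inequality absorbs. Since \<open>h\<close> has subgradients of norm at most \<open>B\<^sub>h\<close>, a proximal step of
  length \<open>k \<alpha>\<close> moves a point by at most \<open>k \<alpha> B\<^sub>h\<close> and \<open>\<nabla>f\<close> is within \<open>B\<^sub>h\<close> of the proximal gradient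
  mapping; this bounds the drift. The proximal descent inequality, with error
  \<open>c\<^sup>t\<^sup>+\<^sup>1 - \<nabla>f(z\<^sup>t)\<close>, is telescoped for each outcome before taking expectations, so that no measurability
  of \<open>h\<close> is needed, and its terms \<open>\<parallel>z\<^sup>t\<^sup>+\<^sup>1 - z\<^sup>t\<parallel>\<^sup>2\<close> pay for the gradient changes in the recursions.
  If the initial objective gap is infinite, so is the right-hand side.\<close>

text \<open>The drift of a round depends on mini-batches drawn earlier in that round, so it is
  correlated with the averaged noise; Young's inequality is confined to this one pair. The drift
  bound is implicit: the mean deviation of the local iterates stands on both sides, next to the
  tracking and compression errors and \<open>G\<close>. It closes because the two step-size
  conditions give D = L^2 (\<alpha> K)^2 w <= \<eta>^2/25, where w = 16 + 161 \<eta>^2/(1-q)^2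
  dominates, up to the factor 1.41, the total weight with which the recursions charge the drift. The
  constants form one budget. Descent yields \<beta>/2 times the squared norm of \<open>G\<close>; a
  share 7/20 is reserved for the drift and the rest is \<gamma> = 3/20. Descent also yields (1 -
  \<beta> L)/(2 \<beta>) >= 12/(25 \<beta>) times the squared server step, which pays for gradient
  changes of weight 18/\<eta>^2 + 161/(1-q)^2. Its error costs \<beta> times the momentum and
  compression errors, so at the new time their weights are carried as 8/\<eta> + 1 and 7/(1-q) +
  1.\<close>

section \<open>The proximal operator\<close>

text \<open>The extreme value theorem for lower semicontinuous functions, with values in a linear
  order so as to admit infinity. Without a minimiser the complements of the sublevel sets at values
  taken on K cover K; in a finite subcover the point of smallest value is left uncovered.\<close>

lemma compact_attains_min_closed_sublevels:
  fixes \<phi> :: "'a::topological_space \<Rightarrow> 'b::linorder"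
  assumes "compact K" "K \<noteq> {}" and closed: "\<And>a. closed {x. \<phi> x \<le> a}"
  shows "\<exists>x\<in>K. \<forall>y\<in>K. \<phi> x \<le> \<phi> y"
proof (rule ccontr)
  assume "\<not> ?thesis"
  then have *: "\<And>x. x \<in> K \<Longrightarrow> \<exists>y\<in>K. \<phi> y < \<phi> x" by (meson not_le)
  define U where "U y = - {x. \<phi> x \<le> \<phi> y}" for y
  have "\<And>y. y \<in> K \<Longrightarrow> open (U y)" unfolding U_def using closed by auto
  moreover have "K \<subseteq> (\<Union>y\<in>K. U y)" unfolding U_def using * by fastforce
  ultimately obtain Y where Y: "Y \<subseteq> K" "finite Y" "K \<subseteq> (\<Union>y\<in>Y. U y)"
    using \<open>compact K\<close> by (metis compactE_image)
  then have "Y \<noteq> {}" using \<open>K \<noteq> {}\<close> by auto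
  then obtain y where y: "y \<in> Y" "\<And>y'. y' \<in> Y \<Longrightarrow> \<phi> y \<le> \<phi> y'"
    using Y(2) by (metis (no_types, lifting) arg_min_least arg_min_if_finite(1))
  then show False using Y unfolding U_def by fastforce
qed


text \<open>At a real level r the sublevel set is the preimage of the closed epigraph under x -> (x,
  r - c x). Infinite levels are included because the minimisation is over extended reals; the level
  minus infinity is empty by properness.\<close>

lemma closed_fun_add_continuous_sublevel:
  fixes h :: "'a::t2_space \<Rightarrow> ereal"
  assumes cl: "closed_fun h" and pr: "proper_fun h" and c: "continuous_on UNIV (c :: 'a \<Rightarrow> real)"
  shows "closed {x. h x + ereal (c x) \<le> a}"
proof (cases a)
  case (real r)
  have eq: "{x. h x + ereal (c x) \<le> a} = (\<lambda>x. (x, r - c x)) -` ereal_epigraph h"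
  proof -
    have "h x + ereal (c x) \<le> ereal r \<longleftrightarrow> h x \<le> ereal (r - c x)" for x
      by (cases "h x") auto
    then show ?thesis by (auto simp: ereal_epigraph_def real)
  qed
  have "continuous_on UNIV (\<lambda>x. (x, r - c x))" by (intro continuous_intros c)
  then show ?thesis unfolding eq using cl unfolding closed_fun_def
    by (simp add: continuous_on_closed_vimage)
next
  case PInf then show ?thesis by simp
next
  case MInf
  then have "{x. h x + ereal (c x) \<le> a} = {}" using pr unfolding proper_fun_def
    by auto
  then show ?thesis by simp
qed

lemma convex_fun_combination:
  assumes "convex_fun h" "h x \<le> ereal a" "h y \<le> ereal b" "0 \<le> t" "t \<le> 1"
  shows "h ((1 - t) *\<^sub>R x + t *\<^sub>R y) \<le> ereal ((1 - t) * a + t * b)"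
proof -
  have "(x, a) \<in> ereal_epigraph h" "(y, b) \<in> ereal_epigraph h"
    using assms by (auto simp: ereal_epigraph_def)
  then have "(1 - t) *\<^sub>R (x, a) + t *\<^sub>R (y, b) \<in> ereal_epigraph h"
    using assms unfolding convex_fun_def convex_alt by blast
  then show ?thesis by (simp add: ereal_epigraph_def)
qed

text \<open>This replaces the usual affine minorant in the coercivity of the proximal objective.\<close>

lemma convex_fun_lower_growth:
  fixes h :: "'a::euclidean_space \<Rightarrow> ereal"
  assumes pr: "proper_fun h" and cl: "closed_fun h" and cv: "convex_fun h" and h0: "h u0 = ereal a0"
  obtains c where "c \<ge> 0" "\<And>u. ereal (a0 - c * (1 + norm (u - u0))) \<le> h u"
proof -
  have "closed {x. h x + ereal 0 \<le> a}" for a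
    by (rule closed_fun_add_continuous_sublevel[OF cl pr]) simp
  then have "\<exists>x\<in>cball u0 1. \<forall>y\<in>cball u0 1. h x \<le> h y"
    by (intro compact_attains_min_closed_sublevels) (auto simp: zero_ereal_def[symmetric])
  then obtain m where m: "m \<in> cball u0 1" "\<And>y. y \<in> cball u0 1 \<Longrightarrow> h m \<le> h y" by blast
  have "h m \<le> ereal a0" using m(2)[of u0] h0 by simp
  moreover have "h m \<noteq> -\<infinity>" using pr by (simp add: proper_fun_def)
  ultimately obtain b where b: "h m = ereal b" by (cases "h m") auto
  have ba: "b \<le> a0" using \<open>h m \<le> ereal a0\<close> b by simp
  show ?thesis
  proof (rule that[of "a0 - b"])
    show "0 \<le> a0 - b" using ba by simp
    fix u
    show "ereal (a0 - (a0 - b) * (1 + norm (u - u0))) \<le> h u"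
    proof (cases "h u")
      case (real r)
      show ?thesis
      proof (cases "norm (u - u0) \<le> 1")
        case True
        then have "b \<le> r" using m(2)[of u] b real by (simp add: dist_norm norm_minus_commute)
        moreover have "(a0 - b) * 1 \<le> (a0 - b) * (1 + norm (u - u0))" 
          using ba by (intro mult_left_mono) auto
        ultimately show ?thesis using real by simp
      next
        case False
        define d where "d = norm (u - u0)"
        have d: "d > 1" using False by (simp add: d_def)
        \<comment> \<open>At this point the segment from u0 to u leaves the unit ball around u0. The
          minimum b over the ball bounds h there, and convexity carries the bound on to u with
          growth linear in d.\<close>
        have "h ((1 - 1/d) *\<^sub>R u0 + (1/d) *\<^sub>R u) \<le> ereal ((1 - 1/d) * a0 + 1/d * r)"
          using d h0 real by (intro convex_fun_combination[OF cv]) auto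
        moreover have "(1 - 1/d) *\<^sub>R u0 + (1/d) *\<^sub>R u \<in> cball u0 1"
        proof -
          have "(1 - 1/d) *\<^sub>R u0 + (1/d) *\<^sub>R u = u0 + (1/d) *\<^sub>R (u - u0)"
            by (simp add: algebra_simps)
          then show ?thesis using d by (simp add: dist_norm d_def)
        qed
        ultimately have "b \<le> (1 - 1/d) * a0 + 1/d * r"
          using m(2) b by (metis ereal_less_eq(3) order_trans)
        then have "d * b \<le> d * ((1 - 1/d) * a0 + 1/d * r)" using d by (intro mult_left_mono) auto
        also have "\<dots> = (d - 1) * a0 + r" using d by (simp add: field_simps)
        finally have "a0 - (a0 - b) * d \<le> r" by (simp add: algebra_simps)
        then have "a0 - (a0 - b) * (1 + d) \<le> r" using ba by (simp add: algebra_simps)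
        then show ?thesis using real by (simp add: d_def)
      qed
    next
      case MInf then show ?thesis using pr by (simp add: proper_fun_def)
    qed simp
  qed
qed

text \<open>\<open>prox\<close> is a choice term, so its defining property rests on the existence of
  a minimiser. The quadratic outgrows the linear lower bound on h, which confines the search to a
  compact ball.\<close>

lemma prox_is_arg_min:
  fixes h :: "'a::euclidean_space \<Rightarrow> ereal"
  assumes pr: "proper_fun h" and cl: "closed_fun h" and cv: "convex_fun h" and "0 < \<gamma>"
  shows "h (prox \<gamma> h y) + ereal (1 / (2 * \<gamma>) * (norm (prox \<gamma> h y - y))^2)
       \<le> h u + ereal (1 / (2 * \<gamma>) * (norm (u - y))^2)"
proof -
  define \<phi> where "\<phi> u = h u + ereal (1 / (2 * \<gamma>) * (norm (u - y))^2)" for u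
  obtain u0 where "h u0 \<noteq> \<infinity>" using pr by (auto simp: proper_fun_def)
  moreover have "h u0 \<noteq> -\<infinity>" using pr by (auto simp: proper_fun_def)
  ultimately obtain a0 where a0: "h u0 = ereal a0" by (cases "h u0") auto
  obtain c where c: "c \<ge> 0" "\<And>u. ereal (a0 - c * (1 + norm (u - u0))) \<le> h u"
    using convex_fun_lower_growth[OF pr cl cv a0] by blast
  define d where "d = norm (u0 - y)"
  \<comment> \<open>For e > r the quadratic e^2/(2 \<gamma>) exceeds e times the bracket, hence c e
    + d^2/(2 \<gamma>) + c (1 + d), and no such point beats u0. The summand d + 1 puts u0 into the
    ball and makes r >= 1.\<close>
  define r where "r = 2 * \<gamma> * (c + d + d^2 / (2 * \<gamma>) + c * (1 + d)) + d + 1"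
  have cl\<phi>: "closed {x. \<phi> x \<le> a}" for a
    unfolding \<phi>_def by (rule closed_fun_add_continuous_sublevel[OF cl pr]) (intro continuous_intros)
  have d0: "d \<ge> 0" by (simp add: d_def)
  have r: "r \<ge> 1" "r \<ge> d" unfolding r_def using \<open>0 < \<gamma>\<close> c(1) d0 by auto
  have "\<exists>x\<in>cball y r. \<forall>z\<in>cball y r. \<phi> x \<le> \<phi> z"
    using r by (intro compact_attains_min_closed_sublevels cl\<phi>) auto
  then obtain x where x: "x \<in> cball y r" "\<And>z. z \<in> cball y r \<Longrightarrow> \<phi> x \<le> \<phi> z" by blast
  have u0: "u0 \<in> cball y r" using r by (simp add: d_def dist_norm norm_minus_commute)
  have "\<phi> u0 \<le> \<phi> z" if "z \<notin> cball y r" for z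
  proof -
    define e where "e = norm (z - y)"
    have e: "e > r" using that by (simp add: e_def dist_norm norm_minus_commute)
    have "norm (z - u0) \<le> e + d"
      unfolding e_def d_def by (metis norm_triangle_ineq4 diff_diff_eq2 diff_add_cancel)
    then have 1: "a0 - c * (1 + (e + d)) \<le> a0 - c * (1 + norm (z - u0))"
      using c(1) by (simp add: mult_left_mono)
    have "2 * \<gamma> * (c + d + d^2 / (2 * \<gamma>) + c * (1 + d)) \<le> e" using e d0 unfolding r_def by linarith
    then have "c + d + d^2 / (2 * \<gamma>) + c * (1 + d) \<le> e / (2 * \<gamma>)"
      using \<open>0 < \<gamma>\<close> by (simp add: field_simps)
    then have "(c + d + d^2 / (2 * \<gamma>) + c * (1 + d)) * e \<le> e / (2 * \<gamma>) * e"
      using e r by (intro mult_right_mono) auto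
    moreover have "c * e + d^2 / (2 * \<gamma>) + c * (1 + d) \<le> (c + d + d^2 / (2 * \<gamma>) + c * (1 + d)) * e"
    proof -
      have "(d^2 / (2 * \<gamma>) + c * (1 + d)) * 1 \<le> (d^2 / (2 * \<gamma>) + c * (1 + d)) * e"
        using e r c d0 \<open>0 < \<gamma>\<close> by (intro mult_left_mono) auto
      moreover have "0 \<le> d * e" using e r d0 by auto
      ultimately show ?thesis by (simp add: algebra_simps)
    qed
    ultimately have 2: "a0 + d^2 / (2 * \<gamma>) \<le> a0 - c * (1 + (e + d)) + 1 / (2 * \<gamma>) * e^2"
      by (simp add: algebra_simps power2_eq_square)
    have "\<phi> u0 = ereal (a0 + d^2 / (2 * \<gamma>))" by (simp add: \<phi>_def a0 d_def)
    also have "\<dots> \<le> ereal (a0 - c * (1 + norm (z - u0))) + ereal (1 / (2 * \<gamma>) * e^2)"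
      using 1 2 by simp
    also have "\<dots> \<le> \<phi> z" unfolding \<phi>_def e_def by (intro add_right_mono c(2))
    finally show ?thesis .
  qed
  then have "is_arg_min \<phi> (\<lambda>_. True) x"
    unfolding is_arg_min_linorder using x u0 by (metis order_trans)
  then have "is_arg_min \<phi> (\<lambda>_. True) (arg_min \<phi> (\<lambda>_. True))"
    unfolding arg_min_def by (rule someI)
  moreover have "arg_min \<phi> (\<lambda>_. True) = prox \<gamma> h y" by (simp add: prox_def \<phi>_def[abs_def])
  ultimately show ?thesis unfolding is_arg_min_linorder by (simp add: \<phi>_def)
qed

lemma prox_finite:
  fixes h :: "'a::euclidean_space \<Rightarrow> ereal"
  assumes pr: "proper_fun h" and "closed_fun h" "convex_fun h" "0 < \<gamma>"
  shows "\<bar>h (prox \<gamma> h y)\<bar> \<noteq> \<infinity>"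
proof -
  obtain u0 where "h u0 \<noteq> \<infinity>" using pr by (auto simp: proper_fun_def)
  moreover have "\<And>x. h x \<noteq> -\<infinity>" using pr by (auto simp: proper_fun_def)
  ultimately show ?thesis
    using prox_is_arg_min[OF assms, of y u0] by (cases "h u0"; cases "h (prox \<gamma> h y)") auto
qed

text \<open>Optimality is tested along the segment from the proximal point to u. Divided by the
  segment parameter t it is the subgradient inequality up to the remainder t N of the
  quadratic.\<close>

lemma prox_subgradient:
  fixes h :: "'a::euclidean_space \<Rightarrow> ereal"
  assumes pr: "proper_fun h" and "closed_fun h" "convex_fun h" "0 < \<gamma>"
  shows "(1 / \<gamma>) *\<^sub>R (y - prox \<gamma> h y) \<in> subdifferential h (prox \<gamma> h y)"
proof -
  define p where "p = prox \<gamma> h y"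
  obtain a where a: "h p = ereal a" using prox_finite[OF assms, of y] p_def by (cases "h p") auto
  have "h p + ereal (((1 / \<gamma>) *\<^sub>R (y - p)) \<bullet> (u - p)) \<le> h u" for u
  proof (cases "h u")
    case (real b)
    have "a + ((y - p) \<bullet> (u - p)) / \<gamma> \<le> b"
    proof (rule field_le_epsilon)
      fix e :: real assume "e > 0"
      define N where "N = (norm (u - p))^2 / (2 * \<gamma>)"
      have "N \<ge> 0" using \<open>0 < \<gamma>\<close> by (simp add: N_def)
      \<comment> \<open>The 1 in the denominator covers N = 0; the minimum with 1 keeps t a convex
        weight.\<close>
      define t where "t = min 1 (e / (1 + N))"
      have t: "0 < t" "t \<le> 1" "t * N \<le> e"
      proof -
        show "0 < t" "t \<le> 1" using \<open>e > 0\<close> \<open>N \<ge> 0\<close> by (auto simp: t_def)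
        have "t * N \<le> e / (1 + N) * (1 + N)" using \<open>e > 0\<close> \<open>N \<ge> 0\<close> \<open>0 < t\<close>
          by (intro mult_mono) (auto simp: t_def)
        then show "t * N \<le> e" using \<open>N \<ge> 0\<close> by simp
      qed
      define w where "w = (1 - t) *\<^sub>R p + t *\<^sub>R u"
      have "h w \<le> ereal ((1 - t) * a + t * b)"
        unfolding w_def using t a real by (intro convex_fun_combination[OF assms(3)]) auto
      moreover have "ereal a + ereal (1 / (2 * \<gamma>) * (norm (p - y))^2)
            \<le> h w + ereal (1 / (2 * \<gamma>) * (norm (w - y))^2)"
        using prox_is_arg_min[OF assms, of y w] a p_def by simp
      ultimately have "a + 1 / (2 * \<gamma>) * (norm (p - y))^2
            \<le> ((1 - t) * a + t * b) + 1 / (2 * \<gamma>) * (norm (w - y))^2"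
        by (cases "h w") auto
      moreover have "(norm (w - y))^2 = (norm (p - y))^2 - 2 * t * ((y - p) \<bullet> (u - p)) + t^2 * (norm (u - p))^2"
      proof -
        have *: "(norm (c + t *\<^sub>R d))^2 = (norm c)^2 + 2 * t * (c \<bullet> d) + t^2 * (norm d)^2" for c d :: 'a
          unfolding power2_norm_eq_inner
          by (simp add: inner_add inner_commute power2_eq_square algebra_simps)
        have "w - y = (p - y) + t *\<^sub>R (u - p)" by (simp add: w_def algebra_simps)
        then have "(norm (w - y))^2 = (norm ((p - y) + t *\<^sub>R (u - p)))^2" by (simp only:)
        moreover have "(p - y) \<bullet> (u - p) = - ((y - p) \<bullet> (u - p))" by (simp add: inner_diff)
        ultimately show ?thesis unfolding * by simp
      qed
      ultimately have "t * (a + ((y - p) \<bullet> (u - p)) / \<gamma>) \<le> t * (b + t * N)"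
      proof -
        assume 1: "a + 1 / (2 * \<gamma>) * (norm (p - y))^2
            \<le> ((1 - t) * a + t * b) + 1 / (2 * \<gamma>) * (norm (w - y))^2"
          and 2: "(norm (w - y))^2 = (norm (p - y))^2 - 2 * t * ((y - p) \<bullet> (u - p)) + t^2 * (norm (u - p))^2"
        define c where "c = 1 / (2 * \<gamma>)"
        define v where "v = (y - p) \<bullet> (u - p)"
        have "v / \<gamma> = 2 * c * v" "N = c * (norm (u - p))^2"
          using \<open>0 < \<gamma>\<close> by (simp_all add: c_def N_def)
        then show ?thesis using 1 unfolding 2 c_def[symmetric] v_def[symmetric]
          by (simp add: algebra_simps power2_eq_square)
      qed
      then have "a + ((y - p) \<bullet> (u - p)) / \<gamma> \<le> b + t * N" using t by simp
      then show "a + ((y - p) \<bullet> (u - p)) / \<gamma> \<le> b + e" using t by simp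
    qed
    then show ?thesis using a real by simp
  next
    case MInf then show ?thesis using pr by (simp add: proper_fun_def)
  qed simp
  then show ?thesis by (simp add: subdifferential_def p_def)
qed

lemma prox_three_point:
  fixes h :: "'a::euclidean_space \<Rightarrow> ereal"
  assumes "proper_fun h" "closed_fun h" "convex_fun h" "0 < \<gamma>" "\<bar>h u\<bar> \<noteq> \<infinity>"
  shows "real_of_ereal (h (prox \<gamma> h y)) + (1 / \<gamma>) * ((y - prox \<gamma> h y) \<bullet> (u - prox \<gamma> h y))
       \<le> real_of_ereal (h u)"
proof -
  have "h (prox \<gamma> h y) + ereal (((1 / \<gamma>) *\<^sub>R (y - prox \<gamma> h y)) \<bullet> (u - prox \<gamma> h y)) \<le> h u"
    using prox_subgradient[OF assms(1-4), of y] by (simp add: subdifferential_def)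
  then show ?thesis using assms(5) prox_finite[OF assms(1-4), of y]
    by (cases "h u"; cases "h (prox \<gamma> h y)") auto
qed

text \<open>Each proximal point is tested at the other one; the sum is monotonicity of the
  subdifferential, which gives firm nonexpansiveness, and Cauchy-Schwarz finishes. The resulting
  continuity is the source of the Borel measurability of \<open>prox\<close>.\<close>

lemma prox_nonexpansive:
  fixes h :: "'a::euclidean_space \<Rightarrow> ereal"
  assumes "proper_fun h" "closed_fun h" "convex_fun h" "0 < \<gamma>"
  shows "norm (prox \<gamma> h x - prox \<gamma> h y) \<le> norm (x - y)"
proof -
  define p p' where "p = prox \<gamma> h x" and "p' = prox \<gamma> h y"
  have "(1 / \<gamma>) * ((x - p) \<bullet> (p' - p) + (y - p') \<bullet> (p - p')) \<le> 0"
    using prox_three_point[OF assms prox_finite[OF assms], of x y]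
      prox_three_point[OF assms prox_finite[OF assms], of y x]
    by (simp add: p_def p'_def algebra_simps)
  then have "(x - p) \<bullet> (p' - p) + (y - p') \<bullet> (p - p') \<le> 0"
    using assms(4) by (simp add: divide_le_0_iff)
  then have "(p - p') \<bullet> (p - p') \<le> (x - y) \<bullet> (p - p')"
    by (simp add: inner_diff algebra_simps inner_commute)
  also have "\<dots> \<le> norm (x - y) * norm (p - p')" by (rule norm_cauchy_schwarz)
  finally have "norm (p - p') * norm (p - p') \<le> norm (x - y) * norm (p - p')"
    by (simp add: power2_norm_eq_inner[symmetric] power2_eq_square)
  then show ?thesis unfolding p_def[symmetric] p'_def[symmetric]
    by (metis mult_le_cancel_right norm_ge_zero not_less_iff_gr_or_eq zero_less_norm_iff norm_zero)
qed

lemma norm_prox_diff_le: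
  fixes h :: "'a::euclidean_space \<Rightarrow> ereal"
  assumes "proper_fun h" "closed_fun h" "convex_fun h" "0 < \<gamma>"
    and bd: "\<And>z g. g \<in> subdifferential h z \<Longrightarrow> norm g \<le> b"
  shows "norm (prox \<gamma> h y - y) \<le> \<gamma> * b"
proof -
  have "norm ((1 / \<gamma>) *\<^sub>R (y - prox \<gamma> h y)) \<le> b" by (rule bd[OF prox_subgradient[OF assms(1-4)]])
  then have "norm (y - prox \<gamma> h y) / \<gamma> \<le> b" using assms(4) by simp
  then show ?thesis using assms(4) by (simp add: pos_divide_le_eq norm_minus_commute mult.commute)
qed

lemma prox_measurable:
  fixes h :: "'a::euclidean_space \<Rightarrow> ereal"
  assumes "proper_fun h" "closed_fun h" "convex_fun h" "0 < \<gamma>"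
  shows "prox \<gamma> h \<in> borel_measurable borel"
proof (rule borel_measurable_continuous_onI)
  have "1-lipschitz_on UNIV (prox \<gamma> h)"
    by (rule lipschitz_onI) (use prox_nonexpansive[OF assms] in \<open>auto simp: dist_norm\<close>)
  then show "continuous_on UNIV (prox \<gamma> h)" by (rule lipschitz_on_continuous_on)
qed

section \<open>Gradients and their joint measurability\<close>

lemma gradient_eqI: "GDERIV f x :> D \<Longrightarrow> gradient f x = D"
  unfolding gradient_def
proof (rule the_equality)
  fix D' assume "GDERIV f x :> D'" "GDERIV f x :> D"
  then have "(\<lambda>h. h \<bullet> D') = (\<lambda>h. h \<bullet> D)"
    unfolding gderiv_def by (rule has_derivative_unique)
  then show "D' = D" by (metis vector_eq_ldot)
qed

lemma GDERIV_gradient: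
  fixes f :: "'a::euclidean_space \<Rightarrow> real"
  assumes "f differentiable (at x)"
  shows "GDERIV f x :> gradient f x"
proof -
  obtain f' where f': "(f has_derivative f') (at x)" using assms by (auto simp: differentiable_def)
  then interpret bounded_linear f' by (rule has_derivative_bounded_linear)
  have "f' = (\<lambda>h. h \<bullet> (\<Sum>b\<in>Basis. f' b *\<^sub>R b))"
  proof
    fix h
    have "f' h = f' (\<Sum>b\<in>Basis. (h \<bullet> b) *\<^sub>R b)" by (simp add: euclidean_representation)
    also have "\<dots> = (\<Sum>b\<in>Basis. (h \<bullet> b) * f' b)" by (simp add: sum scaleR)
    also have "\<dots> = h \<bullet> (\<Sum>b\<in>Basis. f' b *\<^sub>R b)" by (simp add: inner_sum_right mult.commute)
    finally show "f' h = h \<bullet> (\<Sum>b\<in>Basis. f' b *\<^sub>R b)" .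
  qed
  then have "GDERIV f x :> (\<Sum>b\<in>Basis. f' b *\<^sub>R b)" using f' unfolding gderiv_def by simp
  then show ?thesis using gradient_eqI by metis
qed

lemma gradient_avg_loss:
  fixes f :: "nat \<Rightarrow> 'a::euclidean_space \<Rightarrow> real"
  assumes "\<And>i. i \<in> {1..N} \<Longrightarrow> f i differentiable (at x)"
  shows "gradient (avg_loss N f) x = (1 / real N) *\<^sub>R (\<Sum>i=1..N. gradient (f i) x)"
proof (rule gradient_eqI)
  have "(avg_loss N f has_derivative (\<lambda>h. (1 / real N) * (\<Sum>i=1..N. h \<bullet> gradient (f i) x))) (at x)"
    unfolding avg_loss_def[abs_def]
    by (intro has_derivative_mult_right has_derivative_sum)
       (use GDERIV_gradient[OF assms] in \<open>auto simp: gderiv_def\<close>)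
  then show "GDERIV (avg_loss N f) x :> (1 / real N) *\<^sub>R (\<Sum>i=1..N. gradient (f i) x)"
    by (simp add: gderiv_def inner_sum_right)
qed

text \<open>A limit along one fixed sequence of step lengths, so that measurability passes from a
  loss to the components of its gradient.\<close>

lemma gradient_directional_limit:
  fixes f :: "'a::euclidean_space \<Rightarrow> real"
  assumes "f differentiable (at x)"
  shows "(\<lambda>n. (f (x + (1 / real (Suc n)) *\<^sub>R b) - f x) * real (Suc n)) \<longlonglongrightarrow> gradient f x \<bullet> b"
proof -
  have 1: "(f has_derivative (\<lambda>h. h \<bullet> gradient f x)) (at (x + 0 *\<^sub>R b))"
    using GDERIV_gradient[OF assms] by (simp add: gderiv_def)
  have 2: "((\<lambda>t. x + t *\<^sub>R b) has_derivative (\<lambda>t. t *\<^sub>R b)) (at (0::real))"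
    by (auto intro!: derivative_eq_intros)
  have "((\<lambda>t. f (x + t *\<^sub>R b)) has_derivative (\<lambda>t. (t *\<^sub>R b) \<bullet> gradient f x)) (at 0)"
    using has_derivative_compose[OF 2 1] by simp
  then have "((\<lambda>t. f (x + t *\<^sub>R b)) has_field_derivative (gradient f x \<bullet> b)) (at 0)"
    by (simp add: has_field_derivative_def inner_commute mult_commute_abs)
  then have "((\<lambda>t. (f (x + t *\<^sub>R b) - f x) / t) \<longlongrightarrow> gradient f x \<bullet> b) (at 0)"
    by (simp add: has_field_derivative_iff)
  moreover have "filterlim (\<lambda>n. 1 / real (Suc n)) (at 0) sequentially"
    using LIMSEQ_inverse_real_of_nat by (intro filterlim_atI) (simp_all add: inverse_eq_divide)
  ultimately have "((\<lambda>t. (f (x + t *\<^sub>R b) - f x) / t) \<circ> (\<lambda>n. 1 / real (Suc n))) \<longlonglongrightarrow> gradient f x \<bullet> b"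
    unfolding comp_def by (rule filterlim_compose)
  then show ?thesis by (simp add: comp_def)
qed

text \<open>Replacing x by the first point of a dense sequence within distance 1/(n+1) leaves
  countably many sections, each measurable; continuity in x makes these approximations
  converge.\<close>

lemma Caratheodory_measurable:
  fixes l :: "'a::{metric_space, second_countable_topology} \<Rightarrow> 's \<Rightarrow> 'b::metric_space"
  assumes meas: "\<And>x. l x \<in> borel_measurable D"
    and cont: "\<And>s. s \<in> space D \<Longrightarrow> continuous_on UNIV (\<lambda>x. l x s)"
  shows "(\<lambda>p. l (snd p) (fst p)) \<in> borel_measurable (D \<Otimes>\<^sub>M borel)"
proof -
  obtain D0 :: "'a set" where D0: "countable D0" "\<And>U. open U \<Longrightarrow> U \<noteq> {} \<Longrightarrow> \<exists>d\<in>D0. d \<in> U"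
    using countable_dense_setE by blast
  then have "D0 \<noteq> {}" by (metis empty_iff open_UNIV UNIV_not_empty)
  define e where "e = from_nat_into D0"
  have e: "\<exists>m. dist x (e m) < r" if "r > 0" for x r
  proof -
    obtain d where "d \<in> D0" "d \<in> ball x r"
      using D0(2)[of "ball x r"] \<open>r > 0\<close> by (metis centre_in_ball empty_iff open_ball)
    then show ?thesis
      using from_nat_into_surj[OF D0(1)] by (metis e_def mem_ball)
  qed
  define m where "m n p = (LEAST m. dist (snd p) (e m) < 1 / real (Suc n))" for n and p :: "'s \<times> 'a"
  have m: "dist (snd p) (e (m n p)) < 1 / real (Suc n)" for n p
    unfolding m_def by (rule LeastI_ex[OF e]) simp
  have mm: "m n \<in> measurable (D \<Otimes>\<^sub>M borel) (count_space UNIV)" for n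
    unfolding m_def[abs_def] by measurable
  show ?thesis
  proof (rule borel_measurable_LIMSEQ_metric)
    show "(\<lambda>p. l (e (m n p)) (fst p)) \<in> borel_measurable (D \<Otimes>\<^sub>M borel)" for n
      by (rule measurable_compose_countable[OF _ mm]) (intro measurable_compose[OF measurable_fst meas])
    fix p assume "p \<in> space (D \<Otimes>\<^sub>M (borel :: 'a measure))"
    then have s: "fst p \<in> space D" by (auto simp: space_pair_measure)
    have "(\<lambda>n. e (m n p)) \<longlonglongrightarrow> snd p"
    proof (rule metric_LIMSEQ_I)
      fix r :: real assume "r > 0"
      then obtain N where N: "inverse (real (Suc N)) < r" using reals_Archimedean by blast
      have "dist (e (m n p)) (snd p) < r" if "n \<ge> N" for n
      proof -
        have "1 / real (Suc n) \<le> 1 / real (Suc N)" using that by (simp add: field_simps)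
        then show ?thesis using m[of p n] N by (simp add: dist_commute inverse_eq_divide)
      qed
      then show "\<exists>N. \<forall>n\<ge>N. dist (e (m n p)) (snd p) < r" by blast
    qed
    moreover have "isCont (\<lambda>x. l x (fst p)) (snd p)"
      using cont[OF s] by (simp add: continuous_on_eq_continuous_at)
    ultimately show "(\<lambda>n. l (e (m n p)) (fst p)) \<longlonglongrightarrow> l (snd p) (fst p)"
      using isCont_tendsto_compose by blast
  qed
qed

text \<open>The loss is measurable in the sample and differentiable, hence continuous, in x, so it
  is jointly measurable, and difference quotients hand this on to the gradient. Joint measurability
  is what permits evaluation at a random iterate.\<close>

lemma gradient_jointly_measurable:
  fixes l :: "'a::euclidean_space \<Rightarrow> 's \<Rightarrow> real"
  assumes meas: "\<And>x. l x \<in> borel_measurable D"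
    and diff: "\<And>x s. s \<in> space D \<Longrightarrow> (\<lambda>y. l y s) differentiable (at x)"
  shows "(\<lambda>p. gradient (\<lambda>y. l y (fst p)) (snd p)) \<in> borel_measurable (D \<Otimes>\<^sub>M borel)"
proof -
  have cont: "continuous_on UNIV (\<lambda>x. l x s)" if "s \<in> space D" for s
    using diff[OF that] differentiable_imp_continuous_within
    by (metis continuous_on_eq_continuous_at open_UNIV UNIV_I)
  note l[measurable] = Caratheodory_measurable[OF meas cont]
  have "(\<lambda>p. gradient (\<lambda>y. l y (fst p)) (snd p) \<bullet> b) \<in> borel_measurable (D \<Otimes>\<^sub>M borel)" for b :: 'a
  proof (rule borel_measurable_LIMSEQ_real)
    fix n
    have "(\<lambda>p. l (snd p + (1 / real (Suc n)) *\<^sub>R b) (fst p)) \<in> borel_measurable (D \<Otimes>\<^sub>M borel)"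
    proof -
      have "(\<lambda>p. (fst p, snd p + (1 / real (Suc n)) *\<^sub>R b)) \<in> (D \<Otimes>\<^sub>M borel) \<rightarrow>\<^sub>M (D \<Otimes>\<^sub>M borel)"
        by measurable
      from measurable_compose[OF this l] show ?thesis by simp
    qed
    then show "(\<lambda>p. (l (snd p + (1 / real (Suc n)) *\<^sub>R b) (fst p) - l (snd p) (fst p)) * real (Suc n))
        \<in> borel_measurable (D \<Otimes>\<^sub>M borel)"
      using l by (intro borel_measurable_times borel_measurable_diff) auto
  next
    fix p assume "p \<in> space (D \<Otimes>\<^sub>M (borel :: 'a measure))"
    then have "fst p \<in> space D" by (auto simp: space_pair_measure)
    from gradient_directional_limit[OF diff[OF this]]
    show "(\<lambda>n. (l (snd p + (1 / real (Suc n)) *\<^sub>R b) (fst p) - l (snd p) (fst p)) * real (Suc n))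
      \<longlonglongrightarrow> gradient (\<lambda>y. l y (fst p)) (snd p) \<bullet> b" .
  qed
  then show ?thesis by (rule borel_measurable_euclidean_space[THEN iffD2, rule_format])
qed

lemma minibatch_grad_jointly_measurable:
  fixes l :: "'a::euclidean_space \<Rightarrow> 's \<Rightarrow> real"
  assumes "\<And>x. l x \<in> borel_measurable D"
    and "\<And>x s. s \<in> space D \<Longrightarrow> (\<lambda>y. l y s) differentiable (at x)"
  shows "(\<lambda>p. minibatch_grad l B (fst p) (snd p)) \<in> borel_measurable (Pi\<^sub>M {1..B} (\<lambda>b. D) \<Otimes>\<^sub>M borel)"
proof -
  have "(\<lambda>p. gradient (\<lambda>y. l y (fst p b)) (snd p)) \<in> borel_measurable (Pi\<^sub>M {1..B} (\<lambda>b. D) \<Otimes>\<^sub>M borel)"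
    if "b \<in> {1..B}" for b
  proof -
    have "(\<lambda>p. (fst p b, snd p)) \<in> (Pi\<^sub>M {1..B} (\<lambda>b. D) \<Otimes>\<^sub>M (borel :: 'a measure)) \<rightarrow>\<^sub>M (D \<Otimes>\<^sub>M borel)"
      using that by measurable
    from measurable_compose[OF this gradient_jointly_measurable[OF assms]] show ?thesis by simp
  qed
  then show ?thesis unfolding minibatch_grad_def by measurable
qed

text \<open>Points of the product space over \<open>{1..B}\<close> are extensional functions, so a
  batch enters the product law through its restriction.\<close>

lemma minibatch_grad_restrict:
  "minibatch_grad l B (restrict s {1..B}) x = minibatch_grad l B s x"
  by (simp add: minibatch_grad_def)

section \<open>Second moments and independence\<close>

definition sq_integrable :: "'w measure \<Rightarrow> ('w \<Rightarrow> 'a::euclidean_space) \<Rightarrow> bool" where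
  "sq_integrable M X \<longleftrightarrow> X \<in> borel_measurable M \<and> integrable M (\<lambda>\<omega>. (norm (X \<omega>))^2)"

lemma sq_integrable_measurable: "sq_integrable M X \<Longrightarrow> X \<in> borel_measurable M"
  by (simp add: sq_integrable_def)

lemma sq_integrableD: "sq_integrable M X \<Longrightarrow> integrable M (\<lambda>\<omega>. (norm (X \<omega>))^2)"
  by (simp add: sq_integrable_def)

lemma norm_add_power2_le:
  fixes x y :: "'a::real_inner"
  shows "(norm (x + y))^2 \<le> 2 * (norm x)^2 + 2 * (norm y)^2"
proof -
  have "0 \<le> (norm (x - y))^2" by simp
  then show ?thesis unfolding power2_norm_eq_inner by (simp add: inner_add inner_diff inner_commute)
qed

lemma sq_integrable_dominated:
  assumes "X \<in> borel_measurable M" "sq_integrable M Y" "\<And>\<omega>. \<omega> \<in> space M \<Longrightarrow> norm (X \<omega>) \<le> a * norm (Y \<omega>)"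
  shows "sq_integrable M X"
proof -
  have "integrable M (\<lambda>\<omega>. (norm (X \<omega>))^2)"
  proof (rule Bochner_Integration.integrable_bound)
    show "integrable M (\<lambda>\<omega>. a^2 * (norm (Y \<omega>))^2)" using assms(2) by (simp add: sq_integrable_def)
    show "(\<lambda>\<omega>. (norm (X \<omega>))^2) \<in> borel_measurable M" using assms(1) by measurable
    show "AE \<omega> in M. norm ((norm (X \<omega>))^2) \<le> norm (a^2 * (norm (Y \<omega>))^2)"
    proof (rule AE_I2)
      fix \<omega> assume "\<omega> \<in> space M"
      then have "(norm (X \<omega>))^2 \<le> (a * norm (Y \<omega>))^2" by (intro power_mono assms) auto
      then show "norm ((norm (X \<omega>))^2) \<le> norm (a^2 * (norm (Y \<omega>))^2)"
        by (simp add: power_mult_distrib)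
    qed
  qed
  then show ?thesis using assms by (simp add: sq_integrable_def)
qed

lemma sq_integrable_add:
  assumes "sq_integrable M X" "sq_integrable M Y"
  shows "sq_integrable M (\<lambda>\<omega>. X \<omega> + Y \<omega>)"
proof -
  note [measurable] = assms[THEN sq_integrable_measurable]
  have "integrable M (\<lambda>\<omega>. (norm (X \<omega> + Y \<omega>))^2)"
  proof (rule Bochner_Integration.integrable_bound)
    show "integrable M (\<lambda>\<omega>. 2 * (norm (X \<omega>))^2 + 2 * (norm (Y \<omega>))^2)"
      using assms by (simp add: sq_integrable_def)
  qed (auto intro!: norm_add_power2_le)
  then show ?thesis by (simp add: sq_integrable_def)
qed

lemma sq_integrable_scaleR: 
  assumes "sq_integrable M X" shows "sq_integrable M (\<lambda>\<omega>. a *\<^sub>R X \<omega>)"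
proof (rule sq_integrable_dominated[OF _ assms, of _ "\<bar>a\<bar>"])
  show "(\<lambda>\<omega>. a *\<^sub>R X \<omega>) \<in> borel_measurable M"
    using sq_integrable_measurable[OF assms] by measurable
qed simp

lemma sq_integrable_diff:
  assumes "sq_integrable M X" "sq_integrable M Y"
  shows "sq_integrable M (\<lambda>\<omega>. X \<omega> - Y \<omega>)"
  using sq_integrable_add[OF assms(1) sq_integrable_scaleR[OF assms(2), of "-1"]] by simp

lemma sq_integrable_zero: "sq_integrable M (\<lambda>\<omega>. 0)"
  by (simp add: sq_integrable_def)

lemma sq_integrable_sum:
  assumes "\<And>i. i \<in> I \<Longrightarrow> sq_integrable M (X i)"
  shows "sq_integrable M (\<lambda>\<omega>. \<Sum>i\<in>I. X i \<omega>)"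
  using assms
  by (induction I rule: infinite_finite_induct) (auto intro: sq_integrable_add sq_integrable_zero)

lemma (in finite_measure) sq_integrable_const: "sq_integrable M (\<lambda>\<omega>. a)"
  by (simp add: sq_integrable_def)

lemmas sq_integrable_intros = sq_integrable_add sq_integrable_diff sq_integrable_scaleR sq_integrable_sum

lemma sq_integrable_inner:
  assumes "sq_integrable M X" "sq_integrable M Y"
  shows "integrable M (\<lambda>\<omega>. X \<omega> \<bullet> Y \<omega>)"
proof -
  have *: "(\<lambda>\<omega>. X \<omega> \<bullet> Y \<omega>)
    = (\<lambda>\<omega>. (1/2) * ((norm (X \<omega> + Y \<omega>))^2 - (norm (X \<omega>))^2 - (norm (Y \<omega>))^2))"
    by (simp add: power2_norm_eq_inner inner_add inner_commute fun_eq_iff)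
  show ?thesis unfolding *
    by (intro integrable_mult_right Bochner_Integration.integrable_diff
        sq_integrableD sq_integrable_add assms)
qed

text \<open>Serves both \<open>prox\<close> and the gradients: a Lipschitz map grows at most
  linearly around its value at 0, and constants are square integrable on a probability
  space.\<close>

lemma (in prob_space) sq_integrable_nonexpansive_shift:
  fixes F :: "'b::euclidean_space \<Rightarrow> 'c::euclidean_space"
  assumes X: "sq_integrable M X" and F: "F \<in> borel_measurable borel"
    and le: "\<And>x. norm (F x - F 0) \<le> a * norm x"
  shows "sq_integrable M (\<lambda>\<omega>. F (X \<omega>))"
proof -
  have "sq_integrable M (\<lambda>\<omega>. F (X \<omega>) - F 0)"
  proof (rule sq_integrable_dominated[OF _ X])
    show "(\<lambda>\<omega>. F (X \<omega>) - F 0) \<in> borel_measurable M"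
      using measurable_compose[OF sq_integrable_measurable[OF X] F] by measurable
  qed (rule le)
  from sq_integrable_add[OF this sq_integrable_const[of "F 0"]] show ?thesis by simp
qed

text \<open>Converts the extended-valued moment bounds of the assumptions into square integrability
  and a bound on the ordinary expectation at once.\<close>

lemma sq_integrable_nn_integral_le:
  assumes X: "X \<in> borel_measurable M" and le: "(\<integral>\<^sup>+\<omega>. ennreal ((norm (X \<omega>))^2) \<partial>M) \<le> ennreal c"
    and "0 \<le> c"
  shows "sq_integrable M X" "(\<integral>\<omega>. (norm (X \<omega>))^2 \<partial>M) \<le> c"
proof -
  note [measurable] = X
  have "integrable M (\<lambda>\<omega>. (norm (X \<omega>))^2)"
  proof (rule integrableI_bounded)
    show "(\<integral>\<^sup>+\<omega>. ennreal (norm ((norm (X \<omega>))^2)) \<partial>M) < \<infinity>"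
      using le le_less_trans[OF _ ennreal_less_top] by simp
  qed measurable
  then show "sq_integrable M X" by (simp add: sq_integrable_def)
  from \<open>integrable M (\<lambda>\<omega>. (norm (X \<omega>))^2)\<close> show "(\<integral>\<omega>. (norm (X \<omega>))^2 \<partial>M) \<le> c"
    using le \<open>0 \<le> c\<close> by (simp add: nn_integral_eq_integral)
qed

lemma orthogonal_second_moment_add:
  assumes "sq_integrable M X" "sq_integrable M Y" "(\<integral>\<omega>. X \<omega> \<bullet> Y \<omega> \<partial>M) = 0"
  shows "(\<integral>\<omega>. (norm (X \<omega> + Y \<omega>))^2 \<partial>M)
       = (\<integral>\<omega>. (norm (X \<omega>))^2 \<partial>M) + (\<integral>\<omega>. (norm (Y \<omega>))^2 \<partial>M)"
proof -
  have "(norm (X \<omega> + Y \<omega>))^2 = (norm (X \<omega>))^2 + (norm (Y \<omega>))^2 + 2 * (X \<omega> \<bullet> Y \<omega>)" for \<omega>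
    by (simp add: power2_norm_eq_inner inner_add inner_commute)
  then show ?thesis
    using assms sq_integrable_inner[OF assms(1,2)] by (simp add: sq_integrableD)
qed

lemma orthogonal_sum_second_moment_le:
  assumes "finite I" and sq: "\<And>i. i \<in> I \<Longrightarrow> sq_integrable M (X i)"
    and orth: "\<And>i j. i \<in> I \<Longrightarrow> j \<in> I \<Longrightarrow> i \<noteq> j \<Longrightarrow> (\<integral>\<omega>. X i \<omega> \<bullet> X j \<omega> \<partial>M) = 0"
    and le: "\<And>i. i \<in> I \<Longrightarrow> (\<integral>\<omega>. (norm (X i \<omega>))^2 \<partial>M) \<le> c"
  shows "(\<integral>\<omega>. (norm (\<Sum>i\<in>I. X i \<omega>))^2 \<partial>M) \<le> real (card I) * c"
  using \<open>finite I\<close> sq orth le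
proof (induction I rule: finite_induct)
  case (insert i I)
  have "(\<integral>\<omega>. X i \<omega> \<bullet> (\<Sum>j\<in>I. X j \<omega>) \<partial>M) = (\<Sum>j\<in>I. \<integral>\<omega>. X i \<omega> \<bullet> X j \<omega> \<partial>M)"
    unfolding inner_sum_right
    by (intro Bochner_Integration.integral_sum sq_integrable_inner insert.prems(1)) auto
  also have "\<dots> = 0" using insert by (intro sum.neutral) auto
  finally have "(\<integral>\<omega>. (norm (X i \<omega> + (\<Sum>j\<in>I. X j \<omega>)))^2 \<partial>M)
      = (\<integral>\<omega>. (norm (X i \<omega>))^2 \<partial>M) + (\<integral>\<omega>. (norm (\<Sum>j\<in>I. X j \<omega>))^2 \<partial>M)"
    using insert by (intro orthogonal_second_moment_add sq_integrable_sum) auto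
  also have "\<dots> \<le> c + real (card I) * c"
    using insert by (intro add_mono insert.IH insert.prems(3)) auto
  finally show ?case using insert by (simp add: algebra_simps)
qed simp

text \<open>Since the noise \<open>n\<close> is only assumed orthogonal to \<open>X\<close>, the cross term with \<open>d\<close> is
  absorbed by Young's inequality with weights \<open>3/2\<close> and \<open>2/3\<close>.\<close>

lemma second_moment_drift_noise:
  assumes X: "sq_integrable M X" and d: "sq_integrable M d" and n: "sq_integrable M n"
    and orth: "(\<integral>\<omega>. X \<omega> \<bullet> n \<omega> \<partial>M) = 0"
  shows "(\<integral>\<omega>. (norm (X \<omega> + \<eta> *\<^sub>R (d \<omega> + n \<omega>)))^2 \<partial>M)
     \<le> (\<integral>\<omega>. (norm (X \<omega> + \<eta> *\<^sub>R d \<omega>))^2 \<partial>M)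
       + \<eta>^2 * (3 / 2 * (\<integral>\<omega>. (norm (d \<omega>))^2 \<partial>M) + 5 / 3 * (\<integral>\<omega>. (norm (n \<omega>))^2 \<partial>M))"
proof -
  have le: "(norm (X \<omega> + \<eta> *\<^sub>R (d \<omega> + n \<omega>)))^2 \<le> (norm (X \<omega> + \<eta> *\<^sub>R d \<omega>))^2 + 2 * \<eta> * (X \<omega> \<bullet> n \<omega>)
      + \<eta>^2 * (3 / 2 * (norm (d \<omega>))^2 + 5 / 3 * (norm (n \<omega>))^2)" for \<omega>
  proof -
    have young: "2 * (d \<omega> \<bullet> n \<omega>) \<le> 3 / 2 * (norm (d \<omega>))^2 + 2 / 3 * (norm (n \<omega>))^2"
    proof -
      have "0 \<le> (norm (3 *\<^sub>R d \<omega> - 2 *\<^sub>R n \<omega>))^2" by simp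
      then show ?thesis unfolding power2_norm_eq_inner by (simp add: inner_diff inner_commute)
    qed
    have "(norm (X \<omega> + \<eta> *\<^sub>R (d \<omega> + n \<omega>)))^2
       = (norm (X \<omega> + \<eta> *\<^sub>R d \<omega>))^2 + 2 * \<eta> * (X \<omega> \<bullet> n \<omega>) + \<eta>^2 * (2 * (d \<omega> \<bullet> n \<omega>) + (norm (n \<omega>))^2)"
      unfolding power2_norm_eq_inner
      by (simp add: inner_add inner_commute power2_eq_square algebra_simps)
    also have "\<dots> \<le> (norm (X \<omega> + \<eta> *\<^sub>R d \<omega>))^2 + 2 * \<eta> * (X \<omega> \<bullet> n \<omega>)
        + \<eta>^2 * (3 / 2 * (norm (d \<omega>))^2 + 5 / 3 * (norm (n \<omega>))^2)"
      using young by (intro add_left_mono mult_left_mono) auto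
    finally show ?thesis .
  qed
  note [simp] = sq_integrableD[OF sq_integrable_add[OF X sq_integrable_scaleR[OF d]]]
    sq_integrable_inner[OF X n] sq_integrableD[OF d] sq_integrableD[OF n]
  have "(\<integral>\<omega>. (norm (X \<omega> + \<eta> *\<^sub>R (d \<omega> + n \<omega>)))^2 \<partial>M)
     \<le> (\<integral>\<omega>. (norm (X \<omega> + \<eta> *\<^sub>R d \<omega>))^2 + 2 * \<eta> * (X \<omega> \<bullet> n \<omega>)
      + \<eta>^2 * (3 / 2 * (norm (d \<omega>))^2 + 5 / 3 * (norm (n \<omega>))^2) \<partial>M)"
    by (intro integral_mono le sq_integrableD sq_integrable_intros assms) auto
  also have "\<dots> = (\<integral>\<omega>. (norm (X \<omega> + \<eta> *\<^sub>R d \<omega>))^2 \<partial>M)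
       + \<eta>^2 * (3 / 2 * (\<integral>\<omega>. (norm (d \<omega>))^2 \<partial>M) + 5 / 3 * (\<integral>\<omega>. (norm (n \<omega>))^2 \<partial>M))"
    using orth by simp
  finally show ?thesis .
qed

section \<open>Independence of disjoint groups of draws, and Fubini in place of conditioning\<close>

context prob_space
begin

lemma sets_sigma_UN_subset:
  assumes "indep_sets F I" "J \<subseteq> I"
  shows "sets (sigma (space M) (\<Union>d\<in>J. F d)) \<subseteq> events"
proof -
  have "(\<Union>d\<in>J. F d) \<subseteq> events" using assms by (auto simp: indep_sets_def)
  moreover from this have "(\<Union>d\<in>J. F d) \<subseteq> Pow (space M)" using sets.space_closed by blast
  ultimately show ?thesis by (simp add: sets.sigma_sets_subset)
qed

lemma measurable_sigma_UN_imp_measurable: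
  assumes "indep_sets F I" "J \<subseteq> I" "X \<in> sigma (space M) (\<Union>d\<in>J. F d) \<rightarrow>\<^sub>M S"
  shows "X \<in> M \<rightarrow>\<^sub>M S"
proof -
  have "space (sigma (space M) (\<Union>d\<in>J. F d)) = space M" by (simp add: space_measure_of_conv)
  then show ?thesis
    using sets_sigma_UN_subset[OF assms(1,2)] assms(3) unfolding measurable_def by auto
qed

text \<open>\<open>indep_var\<close> forces both variables into one value type, hence the formulation by product
  distributions.\<close>

lemma distr_pair_disjoint_draws:
  assumes ind: "indep_sets F I" and stable: "\<And>d. d \<in> I \<Longrightarrow> Int_stable (F d)"
    and J: "J \<subseteq> I" "J' \<subseteq> I" "J \<inter> J' = {}"
    and X: "X \<in> sigma (space M) (\<Union>d\<in>J. F d) \<rightarrow>\<^sub>M S"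
    and Y: "Y \<in> sigma (space M) (\<Union>d\<in>J'. F d) \<rightarrow>\<^sub>M T"
  shows "distr M (S \<Otimes>\<^sub>M T) (\<lambda>\<omega>. (X \<omega>, Y \<omega>)) = distr M S X \<Otimes>\<^sub>M distr M T Y"
proof -
  have sp: "(\<Union>d\<in>J. F d) \<subseteq> Pow (space M)" if "J \<subseteq> I" for J
  proof -
    have "(\<Union>d\<in>J. F d) \<subseteq> events" using ind that by (auto simp: indep_sets_def)
    then show ?thesis using sets.space_closed by blast
  qed
  \<comment> \<open>\<open>case_bool\<close> names the two groups of draws; disjoint groups from an
    independent family of intersection-stable systems generate independent sigma-algebras.\<close>
  have "indep_sets (\<lambda>j. sigma_sets (space M) (\<Union>d\<in>case_bool J J' j. F d)) UNIV"
  proof (rule indep_sets_collect_sigma)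
    show "indep_sets F (\<Union>j\<in>UNIV. case_bool J J' j)"
      using J by (intro indep_sets_mono_index[OF _ ind]) (auto split: bool.splits)
    show "disjoint_family_on (case_bool J J') UNIV"
      using J by (auto simp: disjoint_family_on_def split: bool.splits)
    show "Int_stable (F d)" if "d \<in> case_bool J J' j" for d j
      using that J by (intro stable) (auto split: bool.splits)
  qed
  moreover have "(\<lambda>j. sigma_sets (space M) (\<Union>d\<in>case_bool J J' j. F d))
      = case_bool (sigma_sets (space M) (\<Union>d\<in>J. F d)) (sigma_sets (space M) (\<Union>d\<in>J'. F d))"
    by (auto simp: fun_eq_iff split: bool.splits)
  ultimately have indep: "indep_set (sigma_sets (space M) (\<Union>d\<in>J. F d)) (sigma_sets (space M) (\<Union>d\<in>J'. F d))"
    unfolding indep_set_def by simp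
  note rv[measurable] = measurable_sigma_UN_imp_measurable[OF ind J(1) X]
    measurable_sigma_UN_imp_measurable[OF ind J(2) Y]
  interpret X: prob_space "distr M S X" by (rule prob_space_distr) fact
  interpret Y: prob_space "distr M T Y" by (rule prob_space_distr) fact
  have "distr M S X \<Otimes>\<^sub>M distr M T Y = distr M (S \<Otimes>\<^sub>M T) (\<lambda>\<omega>. (X \<omega>, Y \<omega>))"
  proof (rule pair_measure_eqI)
    show "sigma_finite_measure (distr M S X)" "sigma_finite_measure (distr M T Y)"
      by unfold_locales
    show "sets (distr M S X \<Otimes>\<^sub>M distr M T Y) = sets (distr M (S \<Otimes>\<^sub>M T) (\<lambda>\<omega>. (X \<omega>, Y \<omega>)))"
      by (simp cong: sets_pair_measure_cong)
    fix A B assume "A \<in> sets (distr M S X)" "B \<in> sets (distr M T Y)"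
    then have A[measurable]: "A \<in> sets S" and B[measurable]: "B \<in> sets T" by auto
    have "X -` A \<inter> space M \<in> sigma_sets (space M) (\<Union>d\<in>J. F d)"
      using measurable_sets[OF X A] sp[OF J(1)] by (simp add: space_measure_of_conv)
    moreover have "Y -` B \<inter> space M \<in> sigma_sets (space M) (\<Union>d\<in>J'. F d)"
      using measurable_sets[OF Y B] sp[OF J(2)] by (simp add: space_measure_of_conv)
    ultimately have *: "prob ((X -` A \<inter> space M) \<inter> (Y -` B \<inter> space M))
        = prob (X -` A \<inter> space M) * prob (Y -` B \<inter> space M)"
      by (rule indep_setD[OF indep])
    have "(\<lambda>\<omega>. (X \<omega>, Y \<omega>)) -` (A \<times> B) \<inter> space M = (X -` A \<inter> space M) \<inter> (Y -` B \<inter> space M)"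
      by auto
    then show "emeasure (distr M S X) A * emeasure (distr M T Y) B
        = emeasure (distr M (S \<Otimes>\<^sub>M T) (\<lambda>\<omega>. (X \<omega>, Y \<omega>))) (A \<times> B)"
      by (simp add: emeasure_distr emeasure_eq_measure * ennreal_mult'')
  qed
  then show ?thesis by simp
qed

text \<open>Takes the place of conditioning on X: the fresh variable Y is integrated first, with X
  frozen. As an identity between nonnegative integrals it applies before any integrability is
  known.\<close>

lemma nn_integral_pair_distr:
  assumes rv[measurable]: "X \<in> M \<rightarrow>\<^sub>M S" "Y \<in> M \<rightarrow>\<^sub>M T"
    and eq: "distr M (S \<Otimes>\<^sub>M T) (\<lambda>\<omega>. (X \<omega>, Y \<omega>)) = distr M S X \<Otimes>\<^sub>M distr M T Y"
    and f[measurable]: "f \<in> borel_measurable (S \<Otimes>\<^sub>M T)"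
  shows "(\<integral>\<^sup>+\<omega>. f (X \<omega>, Y \<omega>) \<partial>M) = (\<integral>\<^sup>+\<omega>. (\<integral>\<^sup>+y. f (X \<omega>, y) \<partial>distr M T Y) \<partial>M)"
proof -
  interpret Y: prob_space "distr M T Y" by (rule prob_space_distr) fact
  have f': "f \<in> borel_measurable (S \<Otimes>\<^sub>M distr M T Y)"
    using f by (simp cong: measurable_cong_sets)
  have f'': "f \<in> borel_measurable (distr M S X \<Otimes>\<^sub>M distr M T Y)"
    using f by (simp cong: measurable_cong_sets)
  have "(\<integral>\<^sup>+\<omega>. f (X \<omega>, Y \<omega>) \<partial>M) = (\<integral>\<^sup>+p. f p \<partial>distr M (S \<Otimes>\<^sub>M T) (\<lambda>\<omega>. (X \<omega>, Y \<omega>)))"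
    by (subst nn_integral_distr) auto
  also have "\<dots> = (\<integral>\<^sup>+p. f p \<partial>(distr M S X \<Otimes>\<^sub>M distr M T Y))"
    by (simp only: eq)
  also have "\<dots> = (\<integral>\<^sup>+x. (\<integral>\<^sup>+y. f (x, y) \<partial>distr M T Y) \<partial>distr M S X)"
    by (rule Y.nn_integral_fst[OF f'', symmetric])
  also have "\<dots> = (\<integral>\<^sup>+\<omega>. (\<integral>\<^sup>+y. f (X \<omega>, y) \<partial>distr M T Y) \<partial>M)"
    by (rule nn_integral_distr) (auto intro!: Y.borel_measurable_nn_integral_fst f')
  finally show ?thesis .
qed

text \<open>The signed counterpart, for cross terms: a mean that vanishes for every frozen x
  vanishes after averaging. Fubini here uses integrability on the product, transported from
  M.\<close>

lemma integral_pair_distr_zero: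
  fixes f :: "'b \<times> 'c \<Rightarrow> real"
  assumes rv[measurable]: "X \<in> M \<rightarrow>\<^sub>M S" "Y \<in> M \<rightarrow>\<^sub>M T"
    and eq: "distr M (S \<Otimes>\<^sub>M T) (\<lambda>\<omega>. (X \<omega>, Y \<omega>)) = distr M S X \<Otimes>\<^sub>M distr M T Y"
    and f[measurable]: "f \<in> borel_measurable (S \<Otimes>\<^sub>M T)"
    and int: "integrable M (\<lambda>\<omega>. f (X \<omega>, Y \<omega>))"
    and zero: "\<And>x. (\<integral>y. f (x, y) \<partial>distr M T Y) = 0"
  shows "(\<integral>\<omega>. f (X \<omega>, Y \<omega>) \<partial>M) = 0"
proof -
  interpret X: prob_space "distr M S X" by (rule prob_space_distr) fact
  interpret Y: prob_space "distr M T Y" by (rule prob_space_distr) fact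
  interpret XY: pair_prob_space "distr M S X" "distr M T Y" ..
  have "integrable (distr M S X \<Otimes>\<^sub>M distr M T Y) f"
    unfolding eq[symmetric] using int by (subst integrable_distr_eq) auto
  then have "(\<integral>p. f p \<partial>(distr M S X \<Otimes>\<^sub>M distr M T Y)) = (\<integral>x. (\<integral>y. f (x, y) \<partial>distr M T Y) \<partial>distr M S X)"
    by (rule XY.integral_fst'[symmetric])
  also have "\<dots> = 0" by (simp add: zero)
  finally show ?thesis unfolding eq[symmetric] by (subst (asm) integral_distr) auto
qed

end

section \<open>The FedCEF process\<close>

primrec draw_round :: "draw \<Rightarrow> nat" where
  "draw_round (Sample t i k b) = t"
| "draw_round (Compression t i) = t"

text \<open>The process and the standing assumptions. Here \<beta> is an independent positive
  parameter; the step-size conditions are hypotheses of the few lemmas that use them, and the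
  relation of \<beta> to the server rate enters only in the theorem.\<close>

locale fedcef_setting = prob_space M for M :: "'w measure" +
  fixes N K B :: nat
    and \<alpha> \<beta> \<eta> q L \<sigma> b\<^sub>h :: real
    and z0 :: "'a::euclidean_space"
    and f :: "nat \<Rightarrow> 'a \<Rightarrow> real"
    and h :: "'a \<Rightarrow> ereal"
    and D :: "nat \<Rightarrow> 's measure"
    and loss :: "nat \<Rightarrow> 'a \<Rightarrow> 's \<Rightarrow> real"
    and R :: "'r measure"
    and C :: "'r \<Rightarrow> 'a \<Rightarrow> 'a"
    and \<xi> :: "nat \<Rightarrow> nat \<Rightarrow> nat \<Rightarrow> nat \<Rightarrow> 'w \<Rightarrow> 's"
    and \<zeta> :: "nat \<Rightarrow> nat \<Rightarrow> 'w \<Rightarrow> 'r"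
  assumes N1: "N \<ge> 1" and K1: "K \<ge> 1" and B1: "B \<ge> 1"
    and \<alpha>_pos: "\<alpha> > 0" and \<beta>_pos: "\<beta> > 0" and \<eta>_pos: "0 < \<eta>" and \<eta>_le: "\<eta> \<le> 1"
    and q_nonneg: "0 \<le> q" and q_less: "q < 1" and L_pos: "L > 0" and b\<^sub>h_pos: "b\<^sub>h > 0"
    and f_diff: "\<And>i x. i \<in> {1..N} \<Longrightarrow> f i differentiable (at x)"
    and f_quad: "\<And>i x y. i \<in> {1..N} \<Longrightarrow>
           f i x - f i y - gradient (f i) y \<bullet> (x - y) \<le> L / 2 * (norm (x - y))^2"
    and f_lip: "\<And>i x y. i \<in> {1..N} \<Longrightarrow>
           norm (gradient (f i) x - gradient (f i) y) \<le> L * norm (x - y)"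
    and h_proper: "proper_fun h" and h_closed: "closed_fun h" and h_convex: "convex_fun h"
    and h_subgrad: "\<And>z g. g \<in> subdifferential h z \<Longrightarrow> norm g \<le> b\<^sub>h"
    and D_prob: "\<And>i. i \<in> {1..N} \<Longrightarrow> prob_space (D i)"
    and loss_diff: "\<And>i x s. i \<in> {1..N} \<Longrightarrow> s \<in> space (D i) \<Longrightarrow> (\<lambda>y. loss i y s) differentiable (at x)"
    and loss_int: "\<And>i x. i \<in> {1..N} \<Longrightarrow> has_bochner_integral (D i) (loss i x) (f i x)"
    and mb_mean: "\<And>i x. i \<in> {1..N} \<Longrightarrow>
           has_bochner_integral (Pi\<^sub>M {1..B} (\<lambda>b. D i))
             (\<lambda>s. minibatch_grad (loss i) B s x) (gradient (f i) x)"
    and mb_var: "\<And>i x. i \<in> {1..N} \<Longrightarrow>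
           (\<integral>\<^sup>+s. ennreal ((norm (minibatch_grad (loss i) B s x - gradient (f i) x))^2)
              \<partial>Pi\<^sub>M {1..B} (\<lambda>b. D i)) \<le> ennreal (\<sigma>^2 / real B)"
    and R_prob: "prob_space R"
    and C_meas: "(\<lambda>(r, x). C r x) \<in> borel_measurable (R \<Otimes>\<^sub>M borel)"
    and C_contr: "\<And>x. (\<integral>\<^sup>+r. ennreal ((norm (C r x - x))^2) \<partial>R) \<le> ennreal (q^2 * (norm x)^2)"
    and \<xi>_distr: "\<And>t i k b. i \<in> {1..N} \<Longrightarrow> k < K \<Longrightarrow> b \<in> {1..B} \<Longrightarrow>
           \<xi> t i k b \<in> measurable M (D i) \<and> distr M (D i) (\<xi> t i k b) = D i"
    and \<zeta>_distr: "\<And>t i. i \<in> {1..N} \<Longrightarrow> \<zeta> t i \<in> measurable M R \<and> distr M R (\<zeta> t i) = R"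
    and indep: "indep_sets (draw_events M D R \<xi> \<zeta>) (draws N K B)"
begin

abbreviation "evs \<equiv> draw_events M D R \<xi> \<zeta>"
abbreviation "msq X \<equiv> expectation (\<lambda>\<omega>. (norm (X \<omega> :: 'a))^2)"
abbreviation "grad i \<equiv> gradient (f i)"
abbreviation "grad_avg \<equiv> gradient (avg_loss N f)"

section \<open>Pathwise form of the recursion\<close>

definition "grad_est t i k \<omega> x = minibatch_grad (loss i) B (\<lambda>b. \<xi> t i k b \<omega>) x"

definition "state t \<omega> = fedcef N K \<alpha> \<beta> \<eta> h z0
   (\<lambda>t i k. minibatch_grad (loss i) B (\<lambda>b. \<xi> t i k b \<omega>)) (\<lambda>t i. C (\<zeta> t i \<omega>)) t"

definition "z_srv t \<omega> = srv_z (state t \<omega>)"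
definition "c_srv t \<omega> = srv_c (state t \<omega>)"
definition "c_cl t i \<omega> = cl_c (state t \<omega>) i"
definition "v_cl t i \<omega> = cl_v (state t \<omega>) i"
definition "loc t i k \<omega> = local_steps h \<alpha> (\<lambda>k. grad_est t i k \<omega>) (c_srv t \<omega> - c_cl t i \<omega>) (z_srv t \<omega>) k"
definition "x_loc t i k \<omega> = snd (loc t i k \<omega>)"
definition "noise t i k \<omega> = grad_est t i k \<omega> (x_loc t i k \<omega>) - grad i (x_loc t i k \<omega>)"

lemma state_0: "z_srv 0 \<omega> = z0" "c_srv 0 \<omega> = 0" "c_cl 0 i \<omega> = 0" "v_cl 0 i \<omega> = 0"
  by (simp_all add: z_srv_def c_srv_def c_cl_def v_cl_def state_def)

lemma loc_0: "loc t i 0 \<omega> = (z_srv t \<omega>, z_srv t \<omega>)"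
  by (simp add: loc_def)

lemma fst_loc_Suc:
  "fst (loc t i (Suc k) \<omega>) = fst (loc t i k \<omega>) - \<alpha> *\<^sub>R (grad_est t i k \<omega> (x_loc t i k \<omega>) + (c_srv t \<omega> - c_cl t i \<omega>))"
  by (simp add: loc_def x_loc_def Let_def split: prod.splits)

lemma x_0: "x_loc t i 0 \<omega> = z_srv t \<omega>"
  by (simp add: x_loc_def loc_0)

lemma x_Suc: "x_loc t i (Suc k) \<omega> = prox (real (Suc k) * \<alpha>) h (fst (loc t i (Suc k) \<omega>))"
  by (simp add: loc_def x_loc_def Let_def add.commute split: prod.splits)

text \<open>The update acts on the point before the proximal step, and proximal points enter only as
  arguments of gradients. Hence proximal displacements do not accumulate over local steps.\<close>

lemma fst_loc:
  "fst (loc t i k \<omega>) = z_srv t \<omega> - \<alpha> *\<^sub>R (\<Sum>j<k. grad_est t i j \<omega> (x_loc t i j \<omega>)) - (\<alpha> * real k) *\<^sub>R (c_srv t \<omega> - c_cl t i \<omega>)"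
  by (induction k) (simp_all add: loc_0 fst_loc_Suc algebra_simps)

text \<open>The correction c - c_i added in every local step is removed exactly when the message is
  formed. So v_i is a momentum average of plain local gradients, and the control variates influence
  it only through the points of evaluation.\<close>

lemma v_Suc:
  "v_cl (Suc t) i \<omega> = (1 - \<eta>) *\<^sub>R v_cl t i \<omega> + \<eta> *\<^sub>R ((1 / real K) *\<^sub>R (\<Sum>k<K. grad_est t i k \<omega> (x_loc t i k \<omega>)))"
proof -
  have "v_cl (Suc t) i \<omega> = (1 - \<eta>) *\<^sub>R v_cl t i \<omega>
     + \<eta> *\<^sub>R ((1 / (\<alpha> * real K)) *\<^sub>R (z_srv t \<omega> - fst (loc t i K \<omega>)) + c_cl t i \<omega> - c_srv t \<omega>)"
    by (simp add: v_cl_def state_def z_srv_def c_srv_def c_cl_def loc_def grad_est_def[abs_def] Let_def)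
  also have "(1 / (\<alpha> * real K)) *\<^sub>R (z_srv t \<omega> - fst (loc t i K \<omega>)) + c_cl t i \<omega> - c_srv t \<omega>
      = (1 / real K) *\<^sub>R (\<Sum>k<K. grad_est t i k \<omega> (x_loc t i k \<omega>))"
    using \<alpha>_pos K1 by (simp add: fst_loc algebra_simps)
  finally show ?thesis .
qed

lemma cl_Suc: "c_cl (Suc t) i \<omega> = c_cl t i \<omega> + C (\<zeta> t i \<omega>) (v_cl (Suc t) i \<omega> - c_cl t i \<omega>)"
  by (simp add: c_cl_def v_cl_def state_def Let_def)

text \<open>Both sides start at 0 and receive the mean of the same increments. This splits the
  server error into the averaged momentum error and the mean compression error.\<close>

lemma c_eq: "c_srv t \<omega> = (1 / real N) *\<^sub>R (\<Sum>i=1..N. c_cl t i \<omega>)"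
proof (induction t)
  case (Suc t)
  have "c_srv (Suc t) \<omega> = c_srv t \<omega> + (1 / real N) *\<^sub>R (\<Sum>i=1..N. C (\<zeta> t i \<omega>) (v_cl (Suc t) i \<omega> - c_cl t i \<omega>))"
    by (simp add: c_cl_def c_srv_def v_cl_def state_def Let_def)
  then show ?case by (simp add: Suc cl_Suc sum.distrib algebra_simps)
qed (simp add: state_0)

lemma z_Suc: "z_srv (Suc t) \<omega> = prox \<beta> h (z_srv t \<omega> - \<beta> *\<^sub>R c_srv (Suc t) \<omega>)"
  by (simp add: z_srv_def c_srv_def state_def Let_def)

text \<open>Indexed by a set of draws instead of a time, since orthogonality between clients calls
  for histories that omit one mini-batch but contain others of the same local step.\<close>

definition "Fil J = sigma (space M) (\<Union>d\<in>J. evs d)"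

lemma draw_events_Pow: "evs d \<subseteq> Pow (space M)"
  by (cases d) (use sets.sets_into_space in force)+

lemma space_Fil [simp]: "space (Fil J) = space M"
  by (simp add: Fil_def space_measure_of_conv)

lemma sets_Fil: "sets (Fil J) = sigma_sets (space M) (\<Union>d\<in>J. evs d)"
  unfolding Fil_def using draw_events_Pow by (intro sets_measure_of) blast

lemma Int_stable_draw_events: "Int_stable (evs d)"
  by (cases d) (auto intro!: Int_stableI)

lemma Fil_imp_measurable:
  assumes "J \<subseteq> draws N K B" "X \<in> Fil J \<rightarrow>\<^sub>M S" shows "X \<in> M \<rightarrow>\<^sub>M S"
  using measurable_sigma_UN_imp_measurable[OF indep assms(1)] assms(2) by (simp add: Fil_def)

lemma draw_events_measurable:
  assumes d: "d \<in> J" and ev: "evs d = sets (vimage_algebra (space M) X S)"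
    and X: "X \<in> M \<rightarrow>\<^sub>M S"
  shows "X \<in> Fil J \<rightarrow>\<^sub>M S"
proof (rule measurableI)
  show "X \<omega> \<in> space S" if "\<omega> \<in> space (Fil J)" for \<omega> using that X by (auto dest: measurable_space)
  fix A assume "A \<in> sets S"
  then have "X -` A \<inter> space M \<in> evs d" unfolding ev by (rule in_vimage_algebra)
  then show "X -` A \<inter> space (Fil J) \<in> sets (Fil J)" using d by (auto simp: sets_Fil)
qed

definition "block t i k = {Sample t i k b | b. b \<in> {1..B}}"

definition "batch t i k \<omega> = (\<lambda>b\<in>{1..B}. \<xi> t i k b \<omega>)"

lemma grad_est_batch: "grad_est t i k \<omega> x = minibatch_grad (loss i) B (batch t i k \<omega>) x"
  unfolding grad_est_def batch_def minibatch_grad_restrict ..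

lemma batch_measurable:
  assumes "i \<in> {1..N}" "k < K" "block t i k \<subseteq> J"
  shows "batch t i k \<in> Fil J \<rightarrow>\<^sub>M Pi\<^sub>M {1..B} (\<lambda>b. D i)"
  unfolding batch_def[abs_def]
proof (rule measurable_restrict)
  fix b assume b: "b \<in> {1..B}"
  show "\<xi> t i k b \<in> Fil J \<rightarrow>\<^sub>M D i"
    by (rule draw_events_measurable[of "Sample t i k b"])
      (use b assms \<xi>_distr in \<open>auto simp: block_def\<close>)
qed

lemma \<zeta>_measurable: "i \<in> {1..N} \<Longrightarrow> Compression t i \<in> J \<Longrightarrow> \<zeta> t i \<in> Fil J \<rightarrow>\<^sub>M R"
  by (rule draw_events_measurable[of "Compression t i"]) (use \<zeta>_distr in auto)

lemma block_draws: "i \<in> {1..N} \<Longrightarrow> k < K \<Longrightarrow> block t i k \<subseteq> draws N K B"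
  by (auto simp: block_def draws_def)

text \<open>Mutual independence of all draws is specialised to the B samples of one batch; the
  resulting product law is the one for which mean and variance are assumed.\<close>

lemma batch_distr:
  assumes i: "i \<in> {1..N}" and k: "k < K"
  shows "distr M (Pi\<^sub>M {1..B} (\<lambda>b. D i)) (batch t i k) = Pi\<^sub>M {1..B} (\<lambda>b. D i)"
proof -
  have "indep_sets (\<lambda>b. sigma_sets (space M) (\<Union>d\<in>{Sample t i k b}. evs d)) {1..B}"
  proof (rule indep_sets_collect_sigma)
    show "indep_sets (evs) (\<Union>b\<in>{1..B}. {Sample t i k b})"
      by (rule indep_sets_mono_index[OF _ indep]) (use i k in \<open>auto simp: draws_def\<close>)
    show "Int_stable (evs d)" for d by (rule Int_stable_draw_events)
  qed (auto simp: disjoint_family_on_def)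
  then have "indep_sets (\<lambda>b. {\<xi> t i k b -` A \<inter> space M |A. A \<in> sets (D i)}) {1..B}"
    by (rule indep_sets_mono_sets) (auto intro!: sigma_sets.Basic in_vimage_algebra)
  then have "indep_vars (\<lambda>b. D i) (\<xi> t i k) {1..B}"
    unfolding indep_vars_def2 using \<xi>_distr[OF i k] by blast
  then have "distr M (Pi\<^sub>M {1..B} (\<lambda>b. D i)) (batch t i k)
      = Pi\<^sub>M {1..B} (\<lambda>b. distr M (D i) (\<xi> t i k b))"
    unfolding batch_def[abs_def]
    by (subst (asm) indep_vars_iff_distr_eq_PiM') (use B1 \<xi>_distr[OF i k] in auto)
  also have "\<dots> = Pi\<^sub>M {1..B} (\<lambda>b. D i)"
    using \<xi>_distr[OF i k] by (intro PiM_cong) auto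
  finally show ?thesis .
qed

section \<open>Measurability of the iterates with respect to the draws used so far\<close>

lemma minibatch_measurable:
  assumes i: "i \<in> {1..N}"
  shows "(\<lambda>p. minibatch_grad (loss i) B (fst p) (snd p)) \<in> borel_measurable (Pi\<^sub>M {1..B} (\<lambda>b. D i) \<Otimes>\<^sub>M borel)"
  by (rule minibatch_grad_jointly_measurable)
    (use loss_int[OF i] loss_diff[OF i] in \<open>auto intro: borel_measurable_has_bochner_integral\<close>)

lemma grad_est_measurable:
  assumes i: "i \<in> {1..N}" and k: "k < K" and J: "block t i k \<subseteq> J" and X: "X \<in> borel_measurable (Fil J)"
  shows "(\<lambda>\<omega>. grad_est t i k \<omega> (X \<omega>)) \<in> borel_measurable (Fil J)"
  using measurable_compose[OF measurable_Pair[OF batch_measurable[OF i k J] X] minibatch_measurable[OF i]]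
  by (simp add: grad_est_batch)

lemma grad_lipschitz_measurable: "i \<in> {1..N} \<Longrightarrow> grad i \<in> borel_measurable borel"
proof (rule borel_measurable_continuous_onI)
  assume i: "i \<in> {1..N}"
  have "L-lipschitz_on UNIV (grad i)"
    by (rule lipschitz_onI) (use f_lip[OF i] L_pos in \<open>auto simp: dist_norm\<close>)
  then show "continuous_on UNIV (grad i)" by (rule lipschitz_on_continuous_on)
qed

lemma prox_h_measurable: "0 < \<gamma> \<Longrightarrow> prox \<gamma> h \<in> borel_measurable borel"
  by (rule prox_measurable[OF h_proper h_closed h_convex])

definition "past t = {d \<in> draws N K B. draw_round d < t}"

text \<open>The history contains the draws of the other clients at the same local step, so that it also
  yields the orthogonality of the noise of two clients.\<close>

definition "history t i k = past t
   \<union> {Sample t j l b | j l b. j \<in> {1..N} \<and> l < K \<and> b \<in> {1..B} \<and> (l < k \<or> l = k \<and> j \<noteq> i)}"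

lemma past_subsets:
  "past t \<subseteq> draws N K B" "past t \<subseteq> past (Suc t)" "past t \<subseteq> history t i k" "history t i k \<subseteq> draws N K B"
  "i \<in> {1..N} \<Longrightarrow> k < K \<Longrightarrow> block t i k \<subseteq> past (Suc t)" "i \<in> {1..N} \<Longrightarrow> Compression t i \<in> past (Suc t)"
  "block t i k \<inter> history t i k = {}"
  by (auto simp: past_def history_def block_def draws_def)

lemma block_history:
  "j \<in> {1..N} \<Longrightarrow> l < K \<Longrightarrow> l < k \<or> l = k \<and> j \<noteq> i \<Longrightarrow> block t j l \<subseteq> history t i k"
  by (auto simp: history_def block_def)

text \<open>J is arbitrary as long as it contains the draws consumed, so the same induction serves
  the end of a round and the history before a single local step.\<close>

lemma loc_measurable:
  assumes i: "i \<in> {1..N}"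
    and st: "z_srv t \<in> borel_measurable (Fil J)" "\<And>j. j \<in> {1..N} \<Longrightarrow> c_cl t j \<in> borel_measurable (Fil J)"
    and "k \<le> K" "\<And>l. l < k \<Longrightarrow> block t i l \<subseteq> J"
  shows "(\<lambda>\<omega>. fst (loc t i k \<omega>)) \<in> borel_measurable (Fil J) \<and> x_loc t i k \<in> borel_measurable (Fil J)"
  using assms(4,5)
proof (induction k)
  case 0
  show ?case using st(1) by (simp add: loc_0 x_loc_def[abs_def])
next
  case (Suc k)
  have c: "c_srv t \<in> borel_measurable (Fil J)"
    using st(2) by (subst c_eq[abs_def]) (intro borel_measurable_scaleR borel_measurable_sum borel_measurable_const)
  have IH: "(\<lambda>\<omega>. fst (loc t i k \<omega>)) \<in> borel_measurable (Fil J)" "x_loc t i k \<in> borel_measurable (Fil J)"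
    using Suc by auto
  have g: "(\<lambda>\<omega>. grad_est t i k \<omega> (x_loc t i k \<omega>)) \<in> borel_measurable (Fil J)"
    by (rule grad_est_measurable[OF i]) (use Suc IH in auto)
  have 1: "(\<lambda>\<omega>. fst (loc t i (Suc k) \<omega>)) \<in> borel_measurable (Fil J)"
    unfolding fst_loc_Suc using IH(1) g c st(2)[OF i] by measurable
  have "0 < real (Suc k) * \<alpha>" using \<alpha>_pos by simp
  from measurable_compose[OF 1 prox_h_measurable[OF this]]
  have "x_loc t i (Suc k) \<in> borel_measurable (Fil J)" unfolding x_Suc[abs_def] .
  with 1 show ?case by blast
qed

lemma v_Suc_measurable:
  assumes i: "i \<in> {1..N}"
    and st: "z_srv t \<in> borel_measurable (Fil J)" "\<And>j. j \<in> {1..N} \<Longrightarrow> c_cl t j \<in> borel_measurable (Fil J)"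
      "v_cl t i \<in> borel_measurable (Fil J)"
    and blk: "\<And>l. l < K \<Longrightarrow> block t i l \<subseteq> J"
  shows "v_cl (Suc t) i \<in> borel_measurable (Fil J)"
proof -
  have "(\<lambda>\<omega>. grad_est t i k \<omega> (x_loc t i k \<omega>)) \<in> borel_measurable (Fil J)" if "k < K" for k
    by (rule grad_est_measurable[OF i that blk[OF that]])
       (use loc_measurable[OF i st(1,2)] blk that in auto)
  then show ?thesis unfolding v_Suc[abs_def] using st(3)
    by (intro borel_measurable_add borel_measurable_scaleR borel_measurable_sum borel_measurable_const) auto
qed

lemma cl_Suc_measurable:
  assumes i: "i \<in> {1..N}" and "c_cl t i \<in> borel_measurable (Fil J)" "v_cl (Suc t) i \<in> borel_measurable (Fil J)"
    "Compression t i \<in> J"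
  shows "c_cl (Suc t) i \<in> borel_measurable (Fil J)"
proof -
  have 1: "(\<lambda>\<omega>. v_cl (Suc t) i \<omega> - c_cl t i \<omega>) \<in> borel_measurable (Fil J)" using assms by measurable
  from measurable_compose[OF measurable_Pair[OF \<zeta>_measurable[OF i assms(4)] 1] C_meas]
  have "(\<lambda>\<omega>. C (\<zeta> t i \<omega>) (v_cl (Suc t) i \<omega> - c_cl t i \<omega>)) \<in> borel_measurable (Fil J)" by simp
  then show ?thesis unfolding cl_Suc[abs_def] using assms by measurable
qed

lemma c_measurable:
  assumes "\<And>j. j \<in> {1..N} \<Longrightarrow> c_cl t j \<in> borel_measurable (Fil J)"
  shows "c_srv t \<in> borel_measurable (Fil J)"
  using assms unfolding c_eq[abs_def]
  by (intro borel_measurable_scaleR borel_measurable_sum borel_measurable_const)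

lemma state_measurable:
  assumes "past t \<subseteq> J"
  shows "z_srv t \<in> borel_measurable (Fil J) \<and>
    (\<forall>i\<in>{1..N}. c_cl t i \<in> borel_measurable (Fil J) \<and> v_cl t i \<in> borel_measurable (Fil J))"
  using assms
proof (induction t)
  case 0
  then show ?case by (simp add: state_0[abs_def])
next
  case (Suc t)
  have J: "past t \<subseteq> J"
    and J': "\<And>i k. i \<in> {1..N} \<Longrightarrow> k < K \<Longrightarrow> block t i k \<subseteq> J"
      "\<And>i. i \<in> {1..N} \<Longrightarrow> Compression t i \<in> J"
    using subset_trans[OF past_subsets(2) Suc.prems] subset_trans[OF past_subsets(5) Suc.prems]
      subsetD[OF Suc.prems past_subsets(6)] by blast+
  note IH = Suc.IH[OF J]
  have v: "v_cl (Suc t) i \<in> borel_measurable (Fil J)" if i: "i \<in> {1..N}" for i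
    by (rule v_Suc_measurable[OF i]) (use IH J' i in auto)
  have cl: "c_cl (Suc t) i \<in> borel_measurable (Fil J)" if i: "i \<in> {1..N}" for i
    by (rule cl_Suc_measurable[OF i]) (use IH J' i v in auto)
  have c: "c_srv (Suc t) \<in> borel_measurable (Fil J)" by (rule c_measurable[OF cl])
  have "(\<lambda>\<omega>. z_srv t \<omega> - \<beta> *\<^sub>R c_srv (Suc t) \<omega>) \<in> borel_measurable (Fil J)"
    using IH c by (intro borel_measurable_diff borel_measurable_scaleR borel_measurable_const) auto
  from measurable_compose[OF this prox_h_measurable[OF \<beta>_pos]]
  have "z_srv (Suc t) \<in> borel_measurable (Fil J)" unfolding z_Suc[abs_def] .
  with v cl show ?case by blast
qed

lemma state_measurable':
  assumes "past t \<subseteq> J"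
  shows "z_srv t \<in> borel_measurable (Fil J)" "i \<in> {1..N} \<Longrightarrow> c_cl t i \<in> borel_measurable (Fil J)"
    "i \<in> {1..N} \<Longrightarrow> v_cl t i \<in> borel_measurable (Fil J)"
  using state_measurable[OF assms] by auto

lemma x_measurable:
  assumes "past t \<subseteq> J" "i \<in> {1..N}" "k \<le> K" "\<And>l. l < k \<Longrightarrow> block t i l \<subseteq> J"
  shows "x_loc t i k \<in> borel_measurable (Fil J)"
  using loc_measurable[OF assms(2) state_measurable'(1,2)[OF assms(1)] assms(3,4)] by auto

lemma noise_measurable:
  assumes "past t \<subseteq> J" "i \<in> {1..N}" "k < K" "\<And>l. l \<le> k \<Longrightarrow> block t i l \<subseteq> J"
  shows "noise t i k \<in> borel_measurable (Fil J)"
proof -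
  have x: "x_loc t i k \<in> borel_measurable (Fil J)" using assms by (intro x_measurable) auto
  show ?thesis unfolding noise_def[abs_def]
    by (intro borel_measurable_diff grad_est_measurable assms x
        measurable_compose[OF x grad_lipschitz_measurable]) auto
qed

text \<open>X depends on draws outside the batch only, so it can be frozen and the variance
  assumption applied pointwise. The bound is uniform in X, so the noise is square integrable before
  anything is known about moments of the iterates.\<close>

lemma noise_second_moment_at:
  assumes i: "i \<in> {1..N}" and k: "k < K" and J: "J \<subseteq> draws N K B" "block t i k \<inter> J = {}"
    and X: "X \<in> borel_measurable (Fil J)"
  shows "(\<integral>\<^sup>+\<omega>. ennreal ((norm (grad_est t i k \<omega> (X \<omega>) - grad i (X \<omega>)))^2) \<partial>M) \<le> ennreal (\<sigma>^2 / real B)"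
proof -
  let ?P = "Pi\<^sub>M {1..B} (\<lambda>b. D i)"
  define F where "F p = ennreal ((norm (minibatch_grad (loss i) B (snd p) (fst p) - grad i (fst p)))^2)" for p
  have "(\<lambda>p. minibatch_grad (loss i) B (snd p) (fst p)) \<in> borel_measurable (borel \<Otimes>\<^sub>M ?P)"
    using measurable_compose[OF measurable_Pair[OF measurable_snd measurable_fst] minibatch_measurable[OF i]]
    by simp
  note [measurable] = this measurable_compose[OF measurable_fst grad_lipschitz_measurable[OF i]]
  have F: "F \<in> borel_measurable (borel \<Otimes>\<^sub>M ?P)" unfolding F_def[abs_def] by measurable
  have blk: "batch t i k \<in> Fil (block t i k) \<rightarrow>\<^sub>M ?P" by (rule batch_measurable[OF i k]) simp
  have eq: "distr M (borel \<Otimes>\<^sub>M ?P) (\<lambda>\<omega>. (X \<omega>, batch t i k \<omega>)) = distr M borel X \<Otimes>\<^sub>M distr M ?P (batch t i k)"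
    by (rule distr_pair_disjoint_draws[OF indep Int_stable_draw_events J(1) block_draws[OF i k]])
       (use X blk J in \<open>auto simp: Fil_def\<close>)
  have "(\<integral>\<^sup>+\<omega>. F (X \<omega>, batch t i k \<omega>) \<partial>M) = (\<integral>\<^sup>+\<omega>. (\<integral>\<^sup>+s. F (X \<omega>, s) \<partial>distr M ?P (batch t i k)) \<partial>M)"
    by (rule nn_integral_pair_distr[OF _ _ eq F])
       (rule Fil_imp_measurable[OF J(1) X] Fil_imp_measurable[OF block_draws[OF i k] blk])+
  also have "\<dots> \<le> (\<integral>\<^sup>+\<omega>. ennreal (\<sigma>^2 / real B) \<partial>M)"
    unfolding batch_distr[OF i k] F_def fst_conv snd_conv by (intro nn_integral_mono mb_var[OF i])
  finally show ?thesis by (simp add: F_def grad_est_batch emeasure_space_1)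
qed

text \<open>X and Y are frozen together, so Y may be any vector determined by the draws in J; the
  remaining mean is zero by unbiasedness.\<close>

lemma noise_orthogonal_at:
  assumes i: "i \<in> {1..N}" and k: "k < K" and J: "J \<subseteq> draws N K B" "block t i k \<inter> J = {}"
    and X: "X \<in> borel_measurable (Fil J)" and Y: "Y \<in> borel_measurable (Fil J)"
    and int: "integrable M (\<lambda>\<omega>. Y \<omega> \<bullet> (grad_est t i k \<omega> (X \<omega>) - grad i (X \<omega>)))"
  shows "(\<integral>\<omega>. Y \<omega> \<bullet> (grad_est t i k \<omega> (X \<omega>) - grad i (X \<omega>)) \<partial>M) = 0"
proof -
  let ?P = "Pi\<^sub>M {1..B} (\<lambda>b. D i)"
  interpret P: prob_space ?P by (rule prob_space_PiM) (rule D_prob[OF i])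
  define F where "F p = snd (fst p) \<bullet> (minibatch_grad (loss i) B (snd p) (fst (fst p)) - grad i (fst (fst p)))" for p
  have "(\<lambda>p. minibatch_grad (loss i) B (snd p) (fst (fst p))) \<in> borel_measurable ((borel \<Otimes>\<^sub>M borel) \<Otimes>\<^sub>M ?P)"
    using measurable_compose[OF measurable_Pair[OF measurable_snd measurable_compose[OF measurable_fst measurable_fst]] minibatch_measurable[OF i]]
    by simp
  note [measurable] = this measurable_compose[OF measurable_compose[OF measurable_fst measurable_fst] grad_lipschitz_measurable[OF i]]
  have F: "F \<in> borel_measurable ((borel \<Otimes>\<^sub>M borel) \<Otimes>\<^sub>M ?P)" unfolding F_def[abs_def] by measurable
  have blk: "batch t i k \<in> Fil (block t i k) \<rightarrow>\<^sub>M ?P" by (rule batch_measurable[OF i k]) simp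
  have XY: "(\<lambda>\<omega>. (X \<omega>, Y \<omega>)) \<in> Fil J \<rightarrow>\<^sub>M borel \<Otimes>\<^sub>M borel" using X Y by measurable
  have eq: "distr M ((borel \<Otimes>\<^sub>M borel) \<Otimes>\<^sub>M ?P) (\<lambda>\<omega>. ((X \<omega>, Y \<omega>), batch t i k \<omega>))
      = distr M (borel \<Otimes>\<^sub>M borel) (\<lambda>\<omega>. (X \<omega>, Y \<omega>)) \<Otimes>\<^sub>M distr M ?P (batch t i k)"
    by (rule distr_pair_disjoint_draws[OF indep Int_stable_draw_events J(1) block_draws[OF i k]])
       (use XY blk J in \<open>auto simp: Fil_def\<close>)
  have zero: "(\<integral>s. F (xy, s) \<partial>distr M ?P (batch t i k)) = 0" for xy
  proof -
    have mb: "integrable ?P (\<lambda>s. minibatch_grad (loss i) B s (fst xy))"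
      "(\<integral>s. minibatch_grad (loss i) B s (fst xy) \<partial>?P) = grad i (fst xy)"
      using mb_mean[OF i, of "fst xy"] by (auto simp: has_bochner_integral_iff)
    have "(\<integral>s. F (xy, s) \<partial>?P) = snd xy \<bullet> (\<integral>s. minibatch_grad (loss i) B s (fst xy) - grad i (fst xy) \<partial>?P)"
      unfolding F_def fst_conv snd_conv
      by (rule integral_inner_right) (intro Bochner_Integration.integrable_diff mb P.integrable_const)
    also have "\<dots> = 0" using mb by (simp add: P.prob_space del: One_nat_def)
    finally show ?thesis unfolding batch_distr[OF i k] .
  qed
  have "(\<integral>\<omega>. F ((X \<omega>, Y \<omega>), batch t i k \<omega>) \<partial>M) = 0"
    by (rule integral_pair_distr_zero[OF _ _ eq F _ zero])
       (rule Fil_imp_measurable[OF J(1) XY] Fil_imp_measurable[OF block_draws[OF i k] blk]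
         | use int in \<open>simp add: F_def grad_est_batch\<close>)+
  then show ?thesis by (simp add: F_def grad_est_batch)
qed

text \<open>The contraction is assumed for deterministic inputs; freezing an input that does not
  involve this call's randomness extends it to random ones.\<close>

lemma compression_second_moment_at:
  assumes i: "i \<in> {1..N}" and J: "J \<subseteq> draws N K B" "Compression t i \<notin> J"
    and Y: "Y \<in> borel_measurable (Fil J)"
  shows "(\<integral>\<^sup>+\<omega>. ennreal ((norm (C (\<zeta> t i \<omega>) (Y \<omega>) - Y \<omega>))^2) \<partial>M) \<le> (\<integral>\<^sup>+\<omega>. ennreal (q^2 * (norm (Y \<omega>))^2) \<partial>M)"
proof -
  define F where "F p = ennreal ((norm (C (snd p) (fst p) - fst p))^2)" for p
  have "(\<lambda>p. C (snd p) (fst p)) \<in> borel_measurable (borel \<Otimes>\<^sub>M R)"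
    using measurable_compose[OF measurable_Pair[OF measurable_snd measurable_fst] C_meas] by simp
  note [measurable] = this
  have F: "F \<in> borel_measurable (borel \<Otimes>\<^sub>M R)" unfolding F_def[abs_def] by measurable
  have J': "{Compression t i} \<subseteq> draws N K B" using i by (auto simp: draws_def)
  have \<zeta>: "\<zeta> t i \<in> Fil {Compression t i} \<rightarrow>\<^sub>M R" by (rule \<zeta>_measurable[OF i]) simp
  have eq: "distr M (borel \<Otimes>\<^sub>M R) (\<lambda>\<omega>. (Y \<omega>, \<zeta> t i \<omega>)) = distr M borel Y \<Otimes>\<^sub>M distr M R (\<zeta> t i)"
    by (rule distr_pair_disjoint_draws[OF indep Int_stable_draw_events J(1) J'])
       (use Y \<zeta> J in \<open>auto simp: Fil_def\<close>)
  have "(\<integral>\<^sup>+\<omega>. F (Y \<omega>, \<zeta> t i \<omega>) \<partial>M) = (\<integral>\<^sup>+\<omega>. (\<integral>\<^sup>+r. F (Y \<omega>, r) \<partial>distr M R (\<zeta> t i)) \<partial>M)"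
    by (rule nn_integral_pair_distr[OF _ _ eq F])
       (rule Fil_imp_measurable[OF J(1) Y] Fil_imp_measurable[OF J' \<zeta>])+
  also have "\<dots> \<le> (\<integral>\<^sup>+\<omega>. ennreal (q^2 * (norm (Y \<omega>))^2) \<partial>M)"
    by (intro nn_integral_mono) (use \<zeta>_distr[OF i] in \<open>simp add: F_def C_contr\<close>)
  finally show ?thesis by (simp add: F_def)
qed

end

section \<open>The Lyapunov inequality for real sequences\<close>

text \<open>These are the weights of the Lyapunov function divided by \<beta>; the extra 1 on Ev and
  V is the price of the descent error. The weights are graded so that decay beats feedback: U feeds
  V with 21 \<eta>^2 p^2 but decays by 35 \<eta>^2 p^2, so a surplus 14 \<eta>^2 p^2 remains for the
  drift.\<close>

lemma lyapunov_weights_step: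
  fixes \<eta> q Dl X Ev U V Ev' U' V' s N :: real
  assumes \<eta>: "0 < \<eta>" "\<eta> \<le> 1" and q: "0 \<le> q" "q < 1" and "N > 0"
    and nn: "0 \<le> Dl" "0 \<le> X" "0 \<le> Ev" "0 \<le> U" "0 \<le> V" "0 \<le> s"
    and Ev: "Ev' \<le> (1 - \<eta> / 2) * Ev + 2 / \<eta> * Dl + (\<eta> + 3 / 2 * \<eta>^2) * X + 5 / 3 * \<eta>^2 * (s / N)"
    and U: "U' \<le> (1 - \<eta> / 2) * U + 2 / \<eta> * Dl + (\<eta> + 3 / 2 * \<eta>^2) * X + 5 / 3 * \<eta>^2 * s"
    and V: "V' \<le> q * V + q^2 / (1 - q) * \<eta>^2 * (3 * (U + Dl + X)) + q^2 * \<eta>^2 * (3 / 2 * X + 5 / 3 * s)"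
  defines "p \<equiv> 1 / (1 - q)"
  shows "(8 / \<eta> + 1) * Ev' + (7 * p + 1) * V' + 70 * \<eta> * p^2 * U'
    \<le> (8 / \<eta>) * Ev + (7 * p - 6) * V + (70 * \<eta> * p^2 - 14 * \<eta>^2 * p^2) * U
       + (18 / \<eta>^2 + 161 * p^2) * Dl + (45 / 2 + 413 / 2 * (\<eta>^2 * p^2)) * X
       + (15 * \<eta> / N + 35 / 3 * (\<eta>^2 * p) + 350 / 3 * (\<eta> ^ 3 * p^2)) * s"
proof -
  have qp: "q^2 / (1 - q) = q^2 * p" by (simp add: p_def)
  have p: "p \<ge> 1" "p * q = p - 1" "p > 0" using q by (auto simp: p_def field_simps)
  have \<eta>2: "\<eta>^2 \<le> \<eta>" "\<eta>^2 \<le> 1" "0 \<le> \<eta>^2" using \<eta> by (auto simp: power2_eq_square mult_le_one)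
  have p2: "p \<le> p^2" using p by (simp add: power2_eq_square)
  have "(8 / \<eta> + 1) * Ev' \<le> (8 / \<eta> + 1) *
     ((1 - \<eta> / 2) * Ev + 2 / \<eta> * Dl + (\<eta> + 3 / 2 * \<eta>^2) * X + 5 / 3 * \<eta>^2 * (s / N))"
    using \<eta> by (intro mult_left_mono Ev) auto
  also have "\<dots> = (8 / \<eta> - 3 - \<eta> / 2) * Ev + (16 / \<eta>^2 + 2 / \<eta>) * Dl
      + (8 + 13 * \<eta> + 3 / 2 * \<eta>^2) * X + (40 / 3 * \<eta> + 5 / 3 * \<eta>^2) * (s / N)"
    using \<eta> by (simp add: field_simps power2_eq_square)
  \<comment> \<open>The decay (8/\<eta>)(\<eta>/2) = 4 outweighs the extra weight 1 on Ev; powers of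
    \<eta> are rounded up by \<eta> <= 1.\<close>
  also have "\<dots> \<le> (8 / \<eta>) * Ev + 18 / \<eta>^2 * Dl + 45 / 2 * X + 15 * \<eta> * (s / N)"
  proof (intro add_mono mult_right_mono)
    show "16 / \<eta>^2 + 2 / \<eta> \<le> 18 / \<eta>^2" using \<eta> by (simp add: field_simps power2_eq_square)
  qed (use \<eta> \<eta>2 nn \<open>N > 0\<close> in auto)
  finally have 1: "(8 / \<eta> + 1) * Ev' \<le> (8 / \<eta>) * Ev + 18 / \<eta>^2 * Dl + 45 / 2 * X + 15 * \<eta> * (s / N)" .
  \<comment> \<open>Since p q = p - 1, the left side is 7 p - 7 + q. The gain of 6 V is kept to pay
    for the drift.\<close>
  have pq: "(7 * p + 1) * q \<le> 7 * p - 6"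
  proof -
    have "(7 * p + 1) * q = 7 * (p * q) + q" by (simp add: algebra_simps)
    then show ?thesis using p(2) q by simp
  qed
  have pq2: "(7 * p + 1) * q^2 \<le> 7 * p"
  proof -
    have "(7 * p + 1) * q^2 = ((7 * p + 1) * q) * q" by (simp add: power2_eq_square)
    also have "\<dots> \<le> ((7 * p + 1) * q) * 1" using p q by (intro mult_left_mono) auto
    finally show ?thesis using pq by simp
  qed
  have "(7 * p + 1) * V' \<le> (7 * p + 1) * (q * V + q^2 / (1 - q) * \<eta>^2 * (3 * (U + Dl + X)) + q^2 * \<eta>^2 * (3 / 2 * X + 5 / 3 * s))"
    using p by (intro mult_left_mono V) auto
  also have "\<dots> = ((7 * p + 1) * q) * V + ((7 * p + 1) * q^2) * (p * \<eta>^2 * (3 * (U + Dl + X)) + \<eta>^2 * (3 / 2 * X + 5 / 3 * s))"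
    unfolding qp by (simp add: algebra_simps add_divide_distrib)
  also have "\<dots> \<le> (7 * p - 6) * V + (7 * p) * (p * \<eta>^2 * (3 * (U + Dl + X)) + \<eta>^2 * (3 / 2 * X + 5 / 3 * s))"
    using nn p \<eta> by (intro add_mono mult_right_mono pq pq2) auto
  also have "\<dots> = (7 * p - 6) * V + 21 * (\<eta>^2 * p^2) * U + 21 * (\<eta>^2 * p^2) * Dl + (21 * (\<eta>^2 * p^2) + 21 / 2 * (\<eta>^2 * p)) * X
      + 35 / 3 * (\<eta>^2 * p) * s"
    by (simp add: algebra_simps power2_eq_square)
  also have "\<dots> \<le> (7 * p - 6) * V + 21 * (\<eta>^2 * p^2) * U + 21 * p^2 * Dl + 63 / 2 * (\<eta>^2 * p^2) * X
      + 35 / 3 * (\<eta>^2 * p) * s"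
  proof (intro add_mono mult_right_mono order_refl nn)
    show "21 * (\<eta>^2 * p^2) \<le> 21 * p^2" using \<eta>2 by (simp add: mult_left_le_one_le)
    have "\<eta>^2 * p \<le> \<eta>^2 * p^2" using p2 by (intro mult_left_mono) auto
    then show "21 * (\<eta>^2 * p^2) + 21 / 2 * (\<eta>^2 * p) \<le> 63 / 2 * (\<eta>^2 * p^2)" by linarith
  qed (use p in auto)
  finally have 2: "(7 * p + 1) * V' \<le> (7 * p - 6) * V + 21 * (\<eta>^2 * p^2) * U + 21 * p^2 * Dl
      + 63 / 2 * (\<eta>^2 * p^2) * X + 35 / 3 * (\<eta>^2 * p) * s" .
  \<comment> \<open>Of the 161 p^2 charged to gradient changes, 140 p^2 arise here and 21 p^2 in the
    estimate of V'; the drift weight 413/2 is 175 + 63/2.\<close>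
  have "70 * \<eta> * p^2 * U' \<le> 70 * \<eta> * p^2 *
     ((1 - \<eta> / 2) * U + 2 / \<eta> * Dl + (\<eta> + 3 / 2 * \<eta>^2) * X + 5 / 3 * \<eta>^2 * s)"
    using \<eta> by (intro mult_left_mono U) auto
  also have "\<dots> = (70 * \<eta> * p^2 - 35 * (\<eta>^2 * p^2)) * U + 140 * p^2 * Dl + (70 * (\<eta>^2 * p^2) + 105 * (\<eta> * \<eta>^2) * p^2) * X + 350 / 3 * (\<eta> ^ 3 * p^2) * s"
    using \<eta> by (simp add: algebra_simps power2_eq_square power3_eq_cube)
  also have "\<dots> \<le> (70 * \<eta> * p^2 - 35 * (\<eta>^2 * p^2)) * U + 140 * p^2 * Dl + 175 * (\<eta>^2 * p^2) * X + 350 / 3 * (\<eta> ^ 3 * p^2) * s"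
  proof (intro add_mono mult_right_mono order_refl nn)
    have "\<eta> * \<eta>^2 * p^2 \<le> 1 * \<eta>^2 * p^2" using \<eta> by (intro mult_right_mono) auto
    then show "70 * (\<eta>^2 * p^2) + 105 * (\<eta> * \<eta>^2) * p^2 \<le> 175 * (\<eta>^2 * p^2)" by simp
  qed (use \<eta> in auto)
  finally have 3: "70 * \<eta> * p^2 * U' \<le> (70 * \<eta> * p^2 - 35 * (\<eta>^2 * p^2)) * U + 140 * p^2 * Dl
      + 175 * (\<eta>^2 * p^2) * X + 350 / 3 * (\<eta> ^ 3 * p^2) * s" .
  from 1 2 3 show ?thesis by (simp add: algebra_simps)
qed

text \<open>Here \<open>a = \<alpha> K\<close> is the local step length and \<open>w\<close> collects the total weight of the client drift;
  the lower bound on \<open>\<eta>\<^sub>g = \<beta> / a\<close> enters as \<open>a\<^sup>2 w \<le> 25 \<eta>\<^sup>2 \<beta>\<^sup>2\<close>.\<close>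

lemma lyapunov_step:
  fixes \<eta> q Dl X Ev U V Ev' U' V' s N L \<beta> a b G :: real
  assumes \<eta>: "0 < \<eta>" "\<eta> \<le> 1" and q: "0 \<le> q" "q < 1" and "N > 0" and L: "L > 0" and \<beta>: "\<beta> > 0"
    and nn: "0 \<le> Dl" "0 \<le> X" "0 \<le> Ev" "0 \<le> U" "0 \<le> V" "0 \<le> s" "0 \<le> G"
    and Ev: "Ev' \<le> (1 - \<eta> / 2) * Ev + 2 / \<eta> * (L^2 * Dl) + (\<eta> + 3 / 2 * \<eta>^2) * (L^2 * X) + 5 / 3 * \<eta>^2 * (s / N)"
    and U: "U' \<le> (1 - \<eta> / 2) * U + 2 / \<eta> * (L^2 * Dl) + (\<eta> + 3 / 2 * \<eta>^2) * (L^2 * X) + 5 / 3 * \<eta>^2 * s"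
    and V: "V' \<le> q * V + q^2 / (1 - q) * \<eta>^2 * (3 * (U + L^2 * Dl + L^2 * X)) + q^2 * \<eta>^2 * (3 / 2 * (L^2 * X) + 5 / 3 * s)"
    and X: "X \<le> 2 * a^2 * (3 * b^2 + s + 3 * (L^2 * Dl + U + V) + 2 * G + L^2 * X)"
    and \<beta>L: "\<beta> * L \<le> \<eta>^2 / 25" "\<beta> * L \<le> (1 - q)^2 / 25"
  defines "p \<equiv> 1 / (1 - q)"
  defines "w \<equiv> 16 + 161 * (\<eta>^2 * p^2)"
  assumes w: "a^2 * w \<le> 25 * \<eta>^2 * \<beta>^2"
  shows "(8 / \<eta> + 1) * Ev' + (7 * p + 1) * V' + 70 * \<eta> * p^2 * U'
    \<le> 8 / \<eta> * Ev + 7 * p * V + 70 * \<eta> * p^2 * U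
       + 12 / 25 / \<beta>^2 * Dl + 7 / 20 * G
       + (17 * \<eta> / N + 14 * \<eta>^2 * p + 140 * \<eta> ^ 3 * p^2) * s + 92 / 5 * w * (L^2 * a^2) * b^2"
proof -
  have p: "p \<ge> 1" "p > 0" using q by (auto simp: p_def field_simps)
  have p2: "p^2 \<ge> 1" using p by simp
  have \<eta>2: "\<eta>^2 \<le> 1" "0 < \<eta>^2" using \<eta> by (auto simp: power2_eq_square mult_le_one)
  \<comment> \<open>The strength of the drift feedback: squared local step length times the weight
    of the drift. All absorption below rests on D <= \<eta>^2/25, for which both step-size
    conditions are combined.\<close>
  define D where "D = L^2 * a^2 * w"
  have w16: "w \<ge> 16" by (simp add: w_def)
  have D0: "D \<ge> 0" using w16 by (simp add: D_def)
  have bl1: "(\<beta> * L)^2 \<le> \<eta>^2 / 625" "(\<beta> * L)^2 * p^2 \<le> 1 / 625"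
  proof -
    have "(\<beta> * L)^2 \<le> (\<eta>^2 / 25)^2" using \<beta>L \<beta> L by (intro power_mono) auto
    also have "\<dots> = \<eta>^2 * \<eta>^2 / 625" by (simp add: power2_eq_square)
    also have "\<dots> \<le> \<eta>^2 * 1 / 625" using \<eta>2 by (intro divide_right_mono mult_left_mono) auto
    finally show "(\<beta> * L)^2 \<le> \<eta>^2 / 625" by simp
    have "(\<beta> * L) * p \<le> (1 - q)^2 / 25 * p" using \<beta>L p by (intro mult_right_mono) auto
    also have "\<dots> = (1 - q) / 25 * ((1 - q) * p)" by (simp add: power2_eq_square)
    also have "(1 - q) * p = 1" using q by (simp add: p_def)
    also have "(1 - q) / 25 * 1 = (1 - q) / 25" by simp
    also have "\<dots> \<le> 1 / 25" using q by simp
    finally have "((\<beta> * L) * p)^2 \<le> (1 / 25)^2" using p \<beta> L by (intro power_mono) auto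
    then show "(\<beta> * L)^2 * p^2 \<le> 1 / 625" by (simp add: power_mult_distrib power_divide)
  qed
  have D: "D \<le> 1 / 25 * \<eta>^2"
  proof -
    have "D = L^2 * (a^2 * w)" by (simp add: D_def)
    also have "\<dots> \<le> L^2 * (25 * \<eta>^2 * \<beta>^2)" by (intro mult_left_mono w) auto
    also have "\<dots> = 25 * \<eta>^2 * (\<beta> * L)^2" by (simp add: power_mult_distrib)
    also have "\<dots> \<le> 25 * \<eta>^2 * (1 / 625)" using bl1(1) \<eta>2 by (intro mult_left_mono) auto
    finally show ?thesis by simp
  qed
  have La: "L^2 * a^2 \<le> 1 / 400"
  proof -
    have "L^2 * a^2 * 16 \<le> D" unfolding D_def using w16 by (intro mult_left_mono) auto
    then show ?thesis using D \<eta>2 by simp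
  qed
  define Y where "Y = 3 * b^2 + s + 3 * (L^2 * Dl + U + V) + 2 * G"
  have Y0: "Y \<ge> 0" using nn by (simp add: Y_def)
  have "L^2 * X \<le> L^2 * (2 * a^2 * (Y + L^2 * X))" using X by (intro mult_left_mono) (auto simp: Y_def)
  then have "L^2 * X \<le> 2 * ((L^2 * a^2) * Y) + 2 * ((L^2 * a^2) * (L^2 * X))" by (simp add: algebra_simps)
  moreover have "(L^2 * a^2) * (L^2 * X) \<le> 1 / 400 * (L^2 * X)" using La nn by (intro mult_right_mono) auto
  moreover have "0 \<le> (L^2 * a^2) * Y" using Y0 by simp
  \<comment> \<open>L^2 a^2 <= 1/400 moves the drift from the right side to the left; 101/50 rounds
    up 2/(1 - 2/400).\<close>
  ultimately have X': "L^2 * X \<le> 101 / 50 * ((L^2 * a^2) * Y)" by linarith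
  \<comment> \<open>1.41 * 16 >= 45/2 and 1.41 * 161 >= 413/2 let w replace the drift weight, and
    14241/5000 = 1.41 * 2.02.\<close>
  have "(45 / 2 + 413 / 2 * (\<eta>^2 * p^2)) * (L^2 * X) \<le> (141 / 100 * w) * (L^2 * X)"
    using nn by (intro mult_right_mono) (auto simp: w_def)
  also have "\<dots> \<le> (141 / 100 * w) * (101 / 50 * ((L^2 * a^2) * Y))" using w16 by (intro mult_left_mono X') auto
  also have "\<dots> = 14241 / 5000 * (D * Y)" by (simp add: D_def)
  finally have XD: "(45 / 2 + 413 / 2 * (\<eta>^2 * p^2)) * (L^2 * X) \<le> 14241 / 5000 * (D * Y)" .
  have DY: "D * Y = 3 * D * b^2 + D * s + 3 * D * (L^2 * Dl) + 3 * D * U + 3 * D * V + 2 * D * G"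
    by (simp add: Y_def algebra_simps)
  have \<eta>p: "\<eta>^2 \<le> \<eta>^2 * p^2" "\<eta>^2 \<le> \<eta>^2 * p" using p p2 \<eta>2 by (simp_all)
  \<comment> \<open>Even after multiplication by 14241/5000 these terms stay below the surpluses 14
    \<eta>^2 p^2 U and 6 V.\<close>
  have DU: "3 * D * U \<le> \<eta>^2 * p^2 * U" 
  proof (rule mult_right_mono)
    show "3 * D \<le> \<eta>^2 * p^2" using D D0 \<eta>p(1) by linarith
  qed (use nn in auto)
  have DV: "3 * D * V \<le> 1 * V" using D nn \<eta>2 by (intro mult_right_mono) auto
  \<comment> \<open>14241/5000 * 2/25 lies below 7/20, the share of G reserved for the
    drift.\<close>
  have DG: "2 * D * G \<le> 2 / 25 * G" using D nn \<eta>2 by (intro mult_right_mono) auto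
  have Ds: "D * s \<le> 1 / 25 * (\<eta>^2 * p) * s" using D nn \<eta>p by (intro mult_right_mono) auto
  have Db: "3 * D * b^2 \<le> 3 * (w * (L^2 * a^2) * b^2)" by (simp add: D_def)
  \<comment> \<open>In units of 1/\<beta>^2 the cost is (18 + 161 + 9/25)/625, below the 12/25 that
    descent supplies; 9 rounds up 3 * 14241/5000.\<close>
  have Dl: "(18 / \<eta>^2 + 161 * p^2 + 9 * D) * (L^2 * Dl) \<le> 12 / 25 / \<beta>^2 * Dl"
  proof -
    have "(18 / \<eta>^2 + 161 * p^2 + 9 * D) * (L^2 * Dl) = (18 / \<eta>^2 * (\<beta> * L)^2 + 161 * ((\<beta> * L)^2 * p^2) + 9 * D * (\<beta> * L)^2) / \<beta>^2 * Dl"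
      using \<beta> by (simp add: field_simps)
    also have "\<dots> \<le> (18 * (1 / 625) + 161 * (1 / 625) + 9 * (1 / 25) * (1 / 625)) / \<beta>^2 * Dl"
    proof (intro mult_right_mono divide_right_mono add_mono)
      show "18 / \<eta>^2 * (\<beta> * L)^2 \<le> 18 * (1 / 625)" using bl1(1) \<eta> by (simp add: field_simps)
      show "161 * ((\<beta> * L)^2 * p^2) \<le> 161 * (1 / 625)" using bl1(2) by linarith
      show "9 * D * (\<beta> * L)^2 \<le> 9 * (1 / 25) * (1 / 625)" using D D0 \<eta>2 bl1(1) by (intro mult_mono) auto
    qed (use nn in auto)
    also have "\<dots> \<le> 12 / 25 / \<beta>^2 * Dl"
      using nn by (intro mult_right_mono divide_right_mono) auto
    finally show ?thesis .
  qed
  have s: "15 * \<eta> / N * s \<le> 17 * \<eta> / N * s" "35 / 3 * (\<eta>^2 * p) * s + 14241 / 5000 * (1 / 25 * (\<eta>^2 * p) * s) \<le> 14 * \<eta>^2 * p * s"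
    "350 / 3 * (\<eta> ^ 3 * p^2) * s \<le> 140 * \<eta> ^ 3 * p^2 * s"
  proof -
    show "15 * \<eta> / N * s \<le> 17 * \<eta> / N * s"
      using nn \<eta> \<open>N > 0\<close> by (intro mult_right_mono divide_right_mono) auto
    have "0 \<le> \<eta>^2 * p * s" using nn p by simp
    then show "35 / 3 * (\<eta>^2 * p) * s + 14241 / 5000 * (1 / 25 * (\<eta>^2 * p) * s) \<le> 14 * \<eta>^2 * p * s" by (simp add: mult_ac)
    have "0 \<le> \<eta> ^ 3 * p^2 * s" using nn p \<eta> by simp
    then show "350 / 3 * (\<eta> ^ 3 * p^2) * s \<le> 140 * \<eta> ^ 3 * p^2 * s" by (simp add: mult_ac)
  qed
  have "(8 / \<eta> + 1) * Ev' + (7 * p + 1) * V' + 70 * \<eta> * p^2 * U'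
    \<le> (8 / \<eta>) * Ev + (7 * p - 6) * V + (70 * \<eta> * p^2 - 14 * \<eta>^2 * p^2) * U
       + (18 / \<eta>^2 + 161 * p^2) * (L^2 * Dl) + (45 / 2 + 413 / 2 * (\<eta>^2 * p^2)) * (L^2 * X)
       + (15 * \<eta> / N + 35 / 3 * (\<eta>^2 * p) + 350 / 3 * (\<eta> ^ 3 * p^2)) * s"
    unfolding p_def by (rule lyapunov_weights_step[OF \<eta> q \<open>N > 0\<close> _ _ nn(3-6) Ev U V]) (use nn in auto)
  moreover have "(18 / \<eta>^2 + 161 * p^2) * (L^2 * Dl) + 3 * (14241 / 5000) * D * (L^2 * Dl) \<le> 12 / 25 / \<beta>^2 * Dl"
  proof -
    have "0 \<le> D * (L^2 * Dl)" using D0 nn by simp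
    then show ?thesis using Dl by (simp add: algebra_simps)
  qed
  moreover have "0 \<le> \<eta>^2 * p^2 * U" "0 \<le> w * (L^2 * a^2) * b^2" using nn w16 by auto
  moreover have "(15 * \<eta> / N + 35 / 3 * (\<eta>^2 * p) + 350 / 3 * (\<eta> ^ 3 * p^2)) * s
      = 15 * \<eta> / N * s + 35 / 3 * (\<eta>^2 * p) * s + 350 / 3 * (\<eta> ^ 3 * p^2) * s"
    "(17 * \<eta> / N + 14 * \<eta>^2 * p + 140 * \<eta> ^ 3 * p^2) * s
      = 17 * \<eta> / N * s + 14 * \<eta>^2 * p * s + 140 * \<eta> ^ 3 * p^2 * s"
    by (simp_all only: distrib_right)
  moreover have "(7 * p - 6) * V = 7 * p * V - 6 * V"
    "(70 * \<eta> * p^2 - 14 * \<eta>^2 * p^2) * U = 70 * \<eta> * p^2 * U - 14 * (\<eta>^2 * p^2 * U)"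
    "3 * (14241 / 5000) * D * (L^2 * Dl) = 14241 / 5000 * (3 * D * (L^2 * Dl))"
    "92 / 5 * w * (L^2 * a^2) * b^2 = 92 / 5 * (w * (L^2 * a^2) * b^2)"
    by (simp_all add: left_diff_distrib)
  ultimately show ?thesis using XD DY DU DV DG Ds Db s nn by linarith
qed

text \<open>The summed one-round inequality bounds the error sum that descent charges. After an
  index shift, possible because Dl 0 = 0, the step terms on both sides are 12/25/\<beta> times the
  same sum and cancel, while G keeps 1/2 - 7/20 = 3/20.\<close>

lemma lyapunov_telescope:
  fixes G Dl Ev U V :: "nat \<Rightarrow> real"
  assumes \<beta>: "\<beta> > 0" and k: "0 \<le> k\<^sub>1" "0 \<le> k\<^sub>2" "0 \<le> k\<^sub>3"
    and nn: "\<And>t. 0 \<le> Dl t" "\<And>t. 0 \<le> Ev t" "\<And>t. 0 \<le> U t" "\<And>t. 0 \<le> V t" and Dl0: "Dl 0 = 0"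
    and step: "\<And>t. (k\<^sub>1 + 1) * Ev (Suc t) + (k\<^sub>2 + 1) * V (Suc t) + k\<^sub>3 * U (Suc t)
       \<le> k\<^sub>1 * Ev t + k\<^sub>2 * V t + k\<^sub>3 * U t + 12 / 25 / \<beta>^2 * Dl t + 7 / 20 * G t + r"
    and descent: "(\<Sum>t<T. \<beta> / 2 * G t + 12 / 25 / \<beta> * Dl (Suc t)) \<le> F0 + \<beta> * (\<Sum>t<T. Ev (Suc t) + V (Suc t))"
  shows "3 / 20 * \<beta> * (\<Sum>t<T. G t) \<le> F0 + \<beta> * (k\<^sub>1 * Ev 0 + k\<^sub>2 * V 0 + k\<^sub>3 * U 0) + real T * (\<beta> * r)"
proof -
  define \<Psi> where "\<Psi> t = k\<^sub>1 * Ev t + k\<^sub>2 * V t + k\<^sub>3 * U t" for t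
  have "Ev (Suc t) + V (Suc t) \<le> (\<Psi> t - \<Psi> (Suc t)) + 12 / 25 / \<beta>^2 * Dl t + 7 / 20 * G t + r" for t
    using step[of t] by (simp add: \<Psi>_def algebra_simps)
  then have "(\<Sum>t<T. Ev (Suc t) + V (Suc t)) \<le> (\<Sum>t<T. (\<Psi> t - \<Psi> (Suc t)) + 12 / 25 / \<beta>^2 * Dl t + 7 / 20 * G t + r)"
    by (rule sum_mono)
  also have "\<dots> = (\<Psi> 0 - \<Psi> T) + 12 / 25 / \<beta>^2 * (\<Sum>t<T. Dl t) + 7 / 20 * (\<Sum>t<T. G t) + real T * r"
    by (simp add: sum.distrib sum_lessThan_telescope' sum_distrib_left)
  also have "\<dots> \<le> \<Psi> 0 + 12 / 25 / \<beta>^2 * (\<Sum>t<T. Dl (Suc t)) + 7 / 20 * (\<Sum>t<T. G t) + real T * r"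
  proof -
    have "0 \<le> \<Psi> T" using nn k by (simp add: \<Psi>_def)
    moreover have "(\<Sum>t<T. Dl t) \<le> (\<Sum>t<Suc T. Dl t)" using nn by simp
    then have "(\<Sum>t<T. Dl t) \<le> (\<Sum>t<T. Dl (Suc t))" unfolding sum.lessThan_Suc_shift using Dl0 by simp
    then have "12 / 25 / \<beta>^2 * (\<Sum>t<T. Dl t) \<le> 12 / 25 / \<beta>^2 * (\<Sum>t<T. Dl (Suc t))" by (intro mult_left_mono) auto
    ultimately show ?thesis by linarith
  qed
  finally have "\<beta> * (\<Sum>t<T. Ev (Suc t) + V (Suc t))
      \<le> \<beta> * (\<Psi> 0 + 12 / 25 / \<beta>^2 * (\<Sum>t<T. Dl (Suc t)) + 7 / 20 * (\<Sum>t<T. G t) + real T * r)"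
    using \<beta> by (intro mult_left_mono) auto
  also have "\<dots> = \<beta> * \<Psi> 0 + 12 / 25 / \<beta> * (\<Sum>t<T. Dl (Suc t)) + 7 / 20 * \<beta> * (\<Sum>t<T. G t) + real T * (\<beta> * r)"
    using \<beta> by (simp add: field_simps power2_eq_square)
  finally have "\<beta> * (\<Sum>t<T. Ev (Suc t) + V (Suc t))
      \<le> \<beta> * \<Psi> 0 + 12 / 25 / \<beta> * (\<Sum>t<T. Dl (Suc t)) + 7 / 20 * \<beta> * (\<Sum>t<T. G t) + real T * (\<beta> * r)" .
  moreover have "(\<Sum>t<T. \<beta> / 2 * G t + 12 / 25 / \<beta> * Dl (Suc t))
      = 1 / 2 * \<beta> * (\<Sum>t<T. G t) + 12 / 25 / \<beta> * (\<Sum>t<T. Dl (Suc t))"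
    by (simp add: sum.distrib sum_distrib_left)
  moreover have "1 / 2 * \<beta> * (\<Sum>t<T. G t) = 3 / 20 * \<beta> * (\<Sum>t<T. G t) + 7 / 20 * \<beta> * (\<Sum>t<T. G t)"
    by (simp add: algebra_simps)
  ultimately show ?thesis using descent unfolding \<Psi>_def by linarith
qed

section \<open>Recursions in expectation\<close>

lemma sum_real_lessThan_le: "(\<Sum>k<n. real k) \<le> (real n)^2 / 2"
  by (induction n) (auto simp: power2_eq_square algebra_simps)

lemma (in prob_space) expectation_affine:
  fixes F\<^sub>1 F\<^sub>2 F\<^sub>3 :: "'a \<Rightarrow> real"
  assumes "integrable M F\<^sub>1" "integrable M F\<^sub>2" "integrable M F\<^sub>3"
  shows "expectation (\<lambda>\<omega>. a + F\<^sub>1 \<omega> + b * F\<^sub>2 \<omega> + d * F\<^sub>3 \<omega>)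
    = a + expectation F\<^sub>1 + b * expectation F\<^sub>2 + d * expectation F\<^sub>3"
  using assms by (simp add: prob_space)

lemma (in prob_space) expectation_const_add:
  fixes F :: "'a \<Rightarrow> real"
  shows "integrable M F \<Longrightarrow> expectation (\<lambda>\<omega>. a + F \<omega>) = a + expectation F"
  by (simp add: prob_space)

text \<open>Squared and divided by (1 - q)^2, the hypothesis on \<open>\<eta>\<^sub>g\<close> says
  that the drift weight w is at most 25 \<eta>^2 times the square of the server rate.\<close>

lemma local_step_weight_le:
  fixes a \<eta> \<eta>\<^sub>g q :: real
  assumes "0 < \<eta>" "q < 1" and \<eta>g: "sqrt (16 * (1 - q)^2 + 161 * \<eta>^2) / (5 * \<eta> * (1 - q)) \<le> \<eta>\<^sub>g"
  shows "a^2 * (16 + 161 * (\<eta>^2 * (1 / (1 - q))^2)) \<le> 25 * \<eta>^2 * (a * \<eta>\<^sub>g)^2"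
proof -
  define r where "r = 1 - q"
  have r: "r > 0" using assms by (simp add: r_def)
  have "sqrt (16 * r^2 + 161 * \<eta>^2) \<le> \<eta>\<^sub>g * (5 * \<eta> * r)"
    using \<eta>g r \<open>0 < \<eta>\<close> unfolding r_def[symmetric] by (simp add: pos_divide_le_eq)
  then have "(sqrt (16 * r^2 + 161 * \<eta>^2))^2 \<le> (\<eta>\<^sub>g * (5 * \<eta> * r))^2" by (intro power_mono) auto
  then have "16 * r^2 + 161 * \<eta>^2 \<le> 25 * \<eta>^2 * \<eta>\<^sub>g^2 * r^2" by (simp add: power_mult_distrib mult_ac)
  then have "(16 * r^2 + 161 * \<eta>^2) / r^2 \<le> 25 * \<eta>^2 * \<eta>\<^sub>g^2" using r by (simp add: pos_divide_le_eq)
  also have "(16 * r^2 + 161 * \<eta>^2) / r^2 = 16 + 161 * (\<eta>^2 * (1 / r)^2)"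
    using r by (simp add: add_divide_distrib power_divide)
  finally have "a^2 * (16 + 161 * (\<eta>^2 * (1 / r)^2)) \<le> a^2 * (25 * \<eta>^2 * \<eta>\<^sub>g^2)"
    by (rule mult_left_mono) simp
  then show ?thesis by (simp add: r_def power_mult_distrib mult_ac)
qed

lemma norm_mean_power2_le:
  fixes a :: "'i \<Rightarrow> 'a::real_normed_vector"
  assumes "finite I" "I \<noteq> {}"
  shows "(norm ((1 / real (card I)) *\<^sub>R (\<Sum>i\<in>I. a i)))^2 \<le> (1 / real (card I)) * (\<Sum>i\<in>I. (norm (a i))^2)"
proof -
  define n where "n = real (card I)"
  have n: "n > 0" using assms by (simp add: n_def card_gt_0_iff)
  have "(norm (\<Sum>i\<in>I. a i))^2 \<le> (\<Sum>i\<in>I. norm (a i))^2" by (intro power_mono norm_sum) auto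
  also have "\<dots> \<le> (\<Sum>i\<in>I. (norm (a i))^2) * n"
    unfolding n_def by (rule sum_squared_le_sum_of_squares)
  finally have "(norm (\<Sum>i\<in>I. a i))^2 / n^2 \<le> (\<Sum>i\<in>I. (norm (a i))^2) * n / n^2"
    by (intro divide_right_mono) auto
  then show ?thesis using n unfolding n_def[symmetric]
    by (simp add: power_mult_distrib power_divide power2_eq_square)
qed

lemma norm_add3_power2_le:
  fixes x y z :: "'a::real_inner"
  shows "(norm (x + y + z))^2 \<le> 3 * ((norm x)^2 + (norm y)^2 + (norm z)^2)"
proof -
  have "0 \<le> (norm (x - y))^2 + (norm (y - z))^2 + (norm (x - z))^2" by simp
  then show ?thesis unfolding power2_norm_eq_inner by (simp add: inner_add inner_diff inner_commute)
qed

lemma norm_add4_power2_le: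
  fixes x y z w :: "'a::real_inner"
  shows "(norm (x + y + z + w))^2 \<le> 4 * ((norm x)^2 + (norm y)^2 + (norm z)^2 + (norm w)^2)"
  using norm_add_power2_le[of "x + y" "z + w"] norm_add_power2_le[of x y] norm_add_power2_le[of z w]
  by (simp add: add.assoc)

text \<open>Convexity peels off d with weight \<eta> and leaves a factor 1 - \<eta> that compensates
  Young's inequality with parameter \<eta>/2: (1 - \<eta>)(1 + \<eta>/2) <= 1 - \<eta>/2 and (1 -
  \<eta>)(1 + 2/\<eta>) <= 2/\<eta>.\<close>

lemma momentum_power2_le:
  fixes A w d :: "'a::real_inner"
  assumes \<eta>: "0 < \<eta>" "\<eta> \<le> (1::real)"
  shows "(norm ((1 - \<eta>) *\<^sub>R (A + w) + \<eta> *\<^sub>R d))^2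
     \<le> (1 - \<eta> / 2) * (norm A)^2 + 2 / \<eta> * (norm w)^2 + \<eta> * (norm d)^2"
proof -
  have cvx: "(norm ((1 - \<eta>) *\<^sub>R u + \<eta> *\<^sub>R d))^2 \<le> (1 - \<eta>) * (norm u)^2 + \<eta> * (norm d)^2" for u :: 'a
  proof -
    have "(1 - \<eta>) * (norm u)^2 + \<eta> * (norm d)^2 - (norm ((1 - \<eta>) *\<^sub>R u + \<eta> *\<^sub>R d))^2
        = \<eta> * (1 - \<eta>) * (norm (u - d))^2"
      unfolding power2_norm_eq_inner
      by (simp add: inner_add inner_diff inner_commute power2_eq_square algebra_simps)
    moreover have "0 \<le> \<eta> * (1 - \<eta>) * (norm (u - d))^2" using \<eta> by simp
    ultimately show ?thesis by linarith
  qed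
  have young: "(norm (A + w))^2 \<le> (1 + \<eta> / 2) * (norm A)^2 + (1 + 2 / \<eta>) * (norm w)^2"
  proof -
    have "(1 + \<eta> / 2) * (norm A)^2 + (1 + 2 / \<eta>) * (norm w)^2 - (norm (A + w))^2
        = (1 / (2 * \<eta>)) * (norm (\<eta> *\<^sub>R A - 2 *\<^sub>R w))^2"
      unfolding power2_norm_eq_inner using \<eta>
      by (simp add: inner_add inner_diff inner_commute field_simps)
    moreover have "0 \<le> (1 / (2 * \<eta>)) * (norm (\<eta> *\<^sub>R A - 2 *\<^sub>R w))^2" using \<eta> by simp
    ultimately show ?thesis by linarith
  qed
  have "(1 - \<eta>) * (norm (A + w))^2 \<le> (1 - \<eta>) * ((1 + \<eta> / 2) * (norm A)^2 + (1 + 2 / \<eta>) * (norm w)^2)"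
    using \<eta> young by (intro mult_left_mono) auto
  also have "\<dots> = (1 - \<eta> / 2 - \<eta>^2 / 2) * (norm A)^2 + (2 / \<eta> - 1 - \<eta>) * (norm w)^2"
    using \<eta> by (simp add: field_simps power2_eq_square)
  also have "\<dots> \<le> (1 - \<eta> / 2) * (norm A)^2 + 2 / \<eta> * (norm w)^2"
    using \<eta> by (intro add_mono mult_right_mono) auto
  finally show ?thesis using cvx[of "A + w"] by linarith
qed

text \<open>Young's inequality with parameter (1 - q)/q, proved as an exact square so that q = 0 is
  included. It trades the compression factor q^2 for the decay rate q.\<close>

lemma contraction_power2_le:
  fixes a b :: "'a::real_inner"
  assumes q: "0 \<le> q" "q < (1::real)"
  shows "q^2 * (norm (a + b))^2 \<le> q * (norm a)^2 + q^2 / (1 - q) * (norm b)^2"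
proof -
  define p where "p = 1 - q"
  have p: "p > 0" "q = 1 - p" using q by (auto simp: p_def)
  have "q * (norm a)^2 + q^2 / p * (norm b)^2 - q^2 * (norm (a + b))^2
      = (q / p) * (norm (p *\<^sub>R a - q *\<^sub>R b))^2"
    unfolding power2_norm_eq_inner p(2) using p(1)
    by (simp add: inner_add inner_diff inner_commute field_simps power2_eq_square)
  moreover have "0 \<le> (q / p) * (norm (p *\<^sub>R a - q *\<^sub>R b))^2" using p(1) q by simp
  ultimately show ?thesis unfolding p_def by linarith
qed

text \<open>The noise is split off before the convexity estimate, so it is charged with \<eta>^2
  instead of \<eta>; this makes the stochastic error shrink with \<eta>.\<close>

lemma momentum_recursion:
  assumes A: "sq_integrable M A" and w: "sq_integrable M w" and d: "sq_integrable M d" and n: "sq_integrable M n"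
    and orth: "(\<integral>\<omega>. ((1 - \<eta>) *\<^sub>R (A \<omega> + w \<omega>)) \<bullet> n \<omega> \<partial>M) = 0"
    and \<eta>: "0 < \<eta>" "\<eta> \<le> 1"
  shows "(\<integral>\<omega>. (norm ((1 - \<eta>) *\<^sub>R (A \<omega> + w \<omega>) + \<eta> *\<^sub>R (d \<omega> + n \<omega>)))^2 \<partial>M)
     \<le> (1 - \<eta> / 2) * (\<integral>\<omega>. (norm (A \<omega>))^2 \<partial>M) + 2 / \<eta> * (\<integral>\<omega>. (norm (w \<omega>))^2 \<partial>M)
       + (\<eta> + 3 / 2 * \<eta>^2) * (\<integral>\<omega>. (norm (d \<omega>))^2 \<partial>M) + 5 / 3 * \<eta>^2 * (\<integral>\<omega>. (norm (n \<omega>))^2 \<partial>M)"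
proof -
  note [simp] = sq_integrableD[OF A] sq_integrableD[OF w]
    sq_integrableD[OF d] sq_integrableD[OF n]
  have "(\<integral>\<omega>. (norm ((1 - \<eta>) *\<^sub>R (A \<omega> + w \<omega>) + \<eta> *\<^sub>R (d \<omega> + n \<omega>)))^2 \<partial>M)
     \<le> (\<integral>\<omega>. (norm ((1 - \<eta>) *\<^sub>R (A \<omega> + w \<omega>) + \<eta> *\<^sub>R d \<omega>))^2 \<partial>M)
       + \<eta>^2 * (3 / 2 * (\<integral>\<omega>. (norm (d \<omega>))^2 \<partial>M) + 5 / 3 * (\<integral>\<omega>. (norm (n \<omega>))^2 \<partial>M))"
    by (rule second_moment_drift_noise[OF _ d n orth]) (intro sq_integrable_intros A w)
  also have "(\<integral>\<omega>. (norm ((1 - \<eta>) *\<^sub>R (A \<omega> + w \<omega>) + \<eta> *\<^sub>R d \<omega>))^2 \<partial>M)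
     \<le> (\<integral>\<omega>. (1 - \<eta> / 2) * (norm (A \<omega>))^2 + 2 / \<eta> * (norm (w \<omega>))^2 + \<eta> * (norm (d \<omega>))^2 \<partial>M)"
    by (intro integral_mono momentum_power2_le[OF \<eta>] sq_integrableD sq_integrable_intros A w d) auto
  also have "\<dots> = (1 - \<eta> / 2) * (\<integral>\<omega>. (norm (A \<omega>))^2 \<partial>M) + 2 / \<eta> * (\<integral>\<omega>. (norm (w \<omega>))^2 \<partial>M)
      + \<eta> * (\<integral>\<omega>. (norm (d \<omega>))^2 \<partial>M)"
    by simp
  finally show ?thesis by (simp add: algebra_simps)
qed

section \<open>Orthogonality of the noise and square integrability of the iterates\<close>

context fedcef_setting
begin

lemma noise_second_moment:
  assumes i: "i \<in> {1..N}" and k: "k < K"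
  shows "sq_integrable M (noise t i k)" "msq (noise t i k) \<le> \<sigma>^2 / real B"
proof -
  have "block t i l \<subseteq> past (Suc t)" if "l \<le> k" for l using past_subsets(5)[OF i] that k by simp
  then have m: "noise t i k \<in> borel_measurable M"
    using past_subsets(1,2) by (intro Fil_imp_measurable[OF past_subsets(1)] noise_measurable[OF _ i k])
  have "x_loc t i k \<in> borel_measurable (Fil (history t i k))"
    using k by (intro x_measurable past_subsets i block_history) auto
  then have le: "(\<integral>\<^sup>+\<omega>. ennreal ((norm (noise t i k \<omega>))^2) \<partial>M) \<le> ennreal (\<sigma>^2 / real B)"
    unfolding noise_def by (rule noise_second_moment_at[OF i k past_subsets(4,7)])
  show "sq_integrable M (noise t i k)" "msq (noise t i k) \<le> \<sigma>^2 / real B"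
    by (rule sq_integrable_nn_integral_le[OF m le]; simp)+
qed

lemma noise_orthogonal_history:
  assumes i: "i \<in> {1..N}" and k: "k < K" and Y: "Y \<in> borel_measurable (Fil (history t i k))" "sq_integrable M Y"
  shows "expectation (\<lambda>\<omega>. Y \<omega> \<bullet> noise t i k \<omega>) = 0"
  unfolding noise_def
proof (rule noise_orthogonal_at[OF i k past_subsets(4,7) _ Y(1)])
  show "x_loc t i k \<in> borel_measurable (Fil (history t i k))"
    using k by (intro x_measurable past_subsets i block_history) auto
  show "integrable M (\<lambda>\<omega>. Y \<omega> \<bullet> (grad_est t i k \<omega> (x_loc t i k \<omega>) - grad i (x_loc t i k \<omega>)))"
    using sq_integrable_inner[OF Y(2) noise_second_moment(1)[OF i k]] by (simp add: noise_def)
qed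

text \<open>The noise of the later local step is orthogonal to everything in its history, which
  contains the earlier noise; at equal steps either client may take the later part.\<close>

lemma noise_orthogonal:
  assumes i: "i \<in> {1..N}" "k < K" and j: "j \<in> {1..N}" "l < K" and ne: "(i, k) \<noteq> (j, l)"
  shows "expectation (\<lambda>\<omega>. noise t i k \<omega> \<bullet> noise t j l \<omega>) = 0"
proof -
  have *: "expectation (\<lambda>\<omega>. noise t i k \<omega> \<bullet> noise t j l \<omega>) = 0"
    if i: "i \<in> {1..N}" "k < K" and j: "j \<in> {1..N}" "l < K" and lt: "k < l \<or> k = l \<and> i \<noteq> j" for i j k l
  proof (rule noise_orthogonal_history[OF j])
    show "noise t i k \<in> borel_measurable (Fil (history t j l))"
      using lt i by (intro noise_measurable past_subsets block_history) auto
  qed (rule noise_second_moment[OF i])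
  show ?thesis
  proof (cases "k < l \<or> k = l \<and> i \<noteq> j")
    case False
    then have "l < k \<or> l = k \<and> j \<noteq> i" using ne by auto
    from *[OF j i this] show ?thesis by (simp add: inner_commute)
  qed (rule *[OF i j])
qed

lemma grad_sq_integrable: "i \<in> {1..N} \<Longrightarrow> sq_integrable M X \<Longrightarrow> sq_integrable M (\<lambda>\<omega>. grad i (X \<omega>))"
  by (rule sq_integrable_nonexpansive_shift[OF _ grad_lipschitz_measurable, of _ _ L])
    (use f_lip[of _ _ 0] in auto)

lemma prox_sq_integrable: "0 < \<gamma> \<Longrightarrow> sq_integrable M X \<Longrightarrow> sq_integrable M (\<lambda>\<omega>. prox \<gamma> h (X \<omega>))"
  by (rule sq_integrable_nonexpansive_shift[OF _ prox_h_measurable, of _ _ 1])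
    (use prox_nonexpansive[OF h_proper h_closed h_convex, of _ _ 0] in auto)

lemma grad_est_sq_integrable:
  assumes i: "i \<in> {1..N}" and k: "k < K" and x: "sq_integrable M (x_loc t i k)"
  shows "sq_integrable M (\<lambda>\<omega>. grad_est t i k \<omega> (x_loc t i k \<omega>))"
  using sq_integrable_add[OF noise_second_moment(1)[OF i k, of t] grad_sq_integrable[OF i x]] by (simp add: noise_def)

lemma c_srv_sq_integrable:
  "(\<And>i. i \<in> {1..N} \<Longrightarrow> sq_integrable M (c_cl t i)) \<Longrightarrow> sq_integrable M (c_srv t)"
  unfolding c_eq[abs_def] by (intro sq_integrable_intros)

lemma loc_sq_integrable:
  assumes i: "i \<in> {1..N}" and st: "sq_integrable M (z_srv t)" "\<And>j. j \<in> {1..N} \<Longrightarrow> sq_integrable M (c_cl t j)"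
    and "k \<le> K"
  shows "sq_integrable M (\<lambda>\<omega>. fst (loc t i k \<omega>)) \<and> sq_integrable M (x_loc t i k)"
  using \<open>k \<le> K\<close>
proof (induction k)
  case 0
  then show ?case using st(1) by (simp add: loc_0 x_0[abs_def])
next
  case (Suc k)
  then have IH: "sq_integrable M (\<lambda>\<omega>. fst (loc t i k \<omega>))" "sq_integrable M (x_loc t i k)" by auto
  have 1: "sq_integrable M (\<lambda>\<omega>. fst (loc t i (Suc k) \<omega>))"
    unfolding fst_loc_Suc using Suc.prems
    by (intro sq_integrable_intros IH grad_est_sq_integrable i c_srv_sq_integrable st) auto
  moreover have "sq_integrable M (x_loc t i (Suc k))"
    unfolding x_Suc[abs_def] using \<alpha>_pos by (intro prox_sq_integrable 1) auto
  ultimately show ?case by blast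
qed

lemma compression_sq_integrable:
  assumes i: "i \<in> {1..N}" and sq: "sq_integrable M (v_cl (Suc t) i)" "sq_integrable M (c_cl t i)"
  shows "sq_integrable M (\<lambda>\<omega>. v_cl (Suc t) i \<omega> - c_cl (Suc t) i \<omega>)"
    "msq (\<lambda>\<omega>. v_cl (Suc t) i \<omega> - c_cl (Suc t) i \<omega>)
       \<le> q^2 * msq (\<lambda>\<omega>. v_cl (Suc t) i \<omega> - c_cl t i \<omega>)"
proof -
  let ?Y = "\<lambda>\<omega>. v_cl (Suc t) i \<omega> - c_cl t i \<omega>"
  let ?E = "\<lambda>\<omega>. v_cl (Suc t) i \<omega> - c_cl (Suc t) i \<omega>"
  \<comment> \<open>Only this call's own randomness is removed, so the compressor input stays
    measurable and is independent of the call.\<close>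
  let ?J = "past (Suc t) - {Compression t i}"
  have J: "?J \<subseteq> draws N K B" "Compression t i \<notin> ?J" using past_subsets(1)[of "Suc t"] by auto
  have pJ: "past t \<subseteq> ?J" by (auto simp: past_def)
  have bJ: "block t i l \<subseteq> ?J" if "l < K" for l
    using past_subsets(5)[OF i that, of t] by (auto simp: block_def)
  have Y: "?Y \<in> borel_measurable (Fil ?J)"
    by (intro borel_measurable_diff v_Suc_measurable state_measurable' i pJ bJ)
  have sqY: "sq_integrable M ?Y" by (intro sq_integrable_intros sq)
  have "v_cl (Suc t) i \<in> borel_measurable M" "c_cl (Suc t) i \<in> borel_measurable M"
    by (rule Fil_imp_measurable[OF past_subsets(1)[of "Suc t"]], rule state_measurable'(3,2)[OF order_refl i])+
  then have E: "?E \<in> borel_measurable M" by measurable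
  have eq: "(norm (?E \<omega>))^2 = (norm (C (\<zeta> t i \<omega>) (?Y \<omega>) - ?Y \<omega>))^2" for \<omega>
    by (simp add: cl_Suc norm_minus_commute algebra_simps)
  have int: "integrable M (\<lambda>\<omega>. q^2 * (norm (?Y \<omega>))^2)" using sq_integrableD[OF sqY] by simp
  have le: "(\<integral>\<^sup>+\<omega>. ennreal ((norm (?E \<omega>))^2) \<partial>M) \<le> ennreal (q^2 * msq ?Y)"
    unfolding eq using compression_second_moment_at[OF i J Y] nn_integral_eq_integral[OF int] by simp
  show "sq_integrable M ?E" "msq ?E \<le> q^2 * msq ?Y"
    by (rule sq_integrable_nn_integral_le[OF E le]; simp)+
qed

lemma v_Suc_sq_integrable:
  assumes i: "i \<in> {1..N}" and st: "sq_integrable M (z_srv t)" "\<And>j. j \<in> {1..N} \<Longrightarrow> sq_integrable M (c_cl t j)"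
    "sq_integrable M (v_cl t i)"
  shows "sq_integrable M (v_cl (Suc t) i)"
proof -
  have "sq_integrable M (\<lambda>\<omega>. grad_est t i k \<omega> (x_loc t i k \<omega>))" if "k < K" for k
    using loc_sq_integrable[OF i st(1,2), of k] that by (intro grad_est_sq_integrable i) auto
  then show ?thesis unfolding v_Suc[abs_def] by (intro sq_integrable_intros st(3)) auto
qed

text \<open>The order matters: first v_i, then c_i as v_i minus the compression residual, then z.
  The compressor is controlled in mean square only, so the second moment of c_i comes from that
  residual.\<close>

lemma state_sq_integrable_aux:
  "sq_integrable M (z_srv t) \<and> (\<forall>i\<in>{1..N}. sq_integrable M (c_cl t i) \<and> sq_integrable M (v_cl t i))"
proof (induction t)
  case 0
  then show ?case by (simp add: state_0[abs_def] sq_integrable_const)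
next
  case (Suc t)
  have v: "sq_integrable M (v_cl (Suc t) i)" if "i \<in> {1..N}" for i
    using Suc that by (intro v_Suc_sq_integrable) auto
  have c: "sq_integrable M (c_cl (Suc t) i)" if i: "i \<in> {1..N}" for i
    using sq_integrable_diff[OF v[OF i] compression_sq_integrable(1)[OF i v[OF i]]] Suc i by simp
  have "sq_integrable M (z_srv (Suc t))"
    unfolding z_Suc[abs_def] using Suc by (intro prox_sq_integrable \<beta>_pos sq_integrable_intros c_srv_sq_integrable c) auto
  with v c show ?case by blast
qed

lemma state_sq_integrable:
  "sq_integrable M (z_srv t)" "i \<in> {1..N} \<Longrightarrow> sq_integrable M (c_cl t i)"
  "i \<in> {1..N} \<Longrightarrow> sq_integrable M (v_cl t i)" "sq_integrable M (c_srv t)"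
  using state_sq_integrable_aux[of t] c_srv_sq_integrable[of t] by auto

lemma x_sq_integrable: "i \<in> {1..N} \<Longrightarrow> k \<le> K \<Longrightarrow> sq_integrable M (x_loc t i k)"
  using loc_sq_integrable[OF _ state_sq_integrable(1,2)] by blast


section \<open>Error quantities and their one-round recursions\<close>

definition "drift t i \<omega> = (1 / real K) *\<^sub>R (\<Sum>k<K. grad i (x_loc t i k \<omega>) - grad i (z_srv t \<omega>))"
definition "mean_noise t i \<omega> = (1 / real K) *\<^sub>R (\<Sum>k<K. noise t i k \<omega>)"
definition "dev t i = (1 / real K) * (\<Sum>k<K. msq (\<lambda>\<omega>. x_loc t i k \<omega> - z_srv t \<omega>))"
definition "mean_dev t = (1 / real N) * (\<Sum>i=1..N. dev t i)"
text \<open>Truncated subtraction makes this vanish at t = 0, which the telescoping relies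
  on.\<close>

definition "step_gap t = msq (\<lambda>\<omega>. z_srv t \<omega> - z_srv (t - 1) \<omega>)"
definition "track_err t i = msq (\<lambda>\<omega>. v_cl t i \<omega> - grad i (z_srv (t - 1) \<omega>))"
definition "mean_track_err t = (1 / real N) * (\<Sum>i=1..N. track_err t i)"
definition "comp_err t i = msq (\<lambda>\<omega>. v_cl t i \<omega> - c_cl t i \<omega>)"
definition "mean_comp_err t = (1 / real N) * (\<Sum>i=1..N. comp_err t i)"
definition "avg_err t = msq (\<lambda>\<omega>. (1 / real N) *\<^sub>R (\<Sum>i=1..N. v_cl t i \<omega>) - grad_avg (z_srv (t - 1) \<omega>))"
definition "map_sq t = msq (\<lambda>\<omega>. prox_grad_map (avg_loss N f) h \<beta> (z_srv t \<omega>))"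
text \<open>Bounds the variance of the mean of the K mutually orthogonal noise vectors of one client
  in a round.\<close>

definition "noise_level = \<sigma>^2 / (real K * real B)"

lemma v_Suc_eq:
  "v_cl (Suc t) i \<omega> = (1 - \<eta>) *\<^sub>R v_cl t i \<omega> + \<eta> *\<^sub>R (grad i (z_srv t \<omega>) + drift t i \<omega> + mean_noise t i \<omega>)"
proof -
  have "(\<Sum>k<K. grad_est t i k \<omega> (x_loc t i k \<omega>))
      = (\<Sum>k<K. grad i (x_loc t i k \<omega>) - grad i (z_srv t \<omega>)) + (\<Sum>k<K. noise t i k \<omega>) + real K *\<^sub>R grad i (z_srv t \<omega>)"
    by (simp add: noise_def sum.distrib sum_subtractf sum_constant_scaleR)
  then have "(1 / real K) *\<^sub>R (\<Sum>k<K. grad_est t i k \<omega> (x_loc t i k \<omega>))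
      = grad i (z_srv t \<omega>) + drift t i \<omega> + mean_noise t i \<omega>"
    using K1 by (simp add: drift_def mean_noise_def scaleR_add_right)
  then show ?thesis by (simp add: v_Suc)
qed

lemma grad_avg_eq: "grad_avg y = (1 / real N) *\<^sub>R (\<Sum>i=1..N. grad i y)"
  by (rule gradient_avg_loss[OF f_diff])

lemma norm_client_mean_power2_le:
  "(norm ((1 / real N) *\<^sub>R (\<Sum>i=1..N. a i :: 'a)))^2 \<le> (1 / real N) * (\<Sum>i=1..N. (norm (a i))^2)"
  using norm_mean_power2_le[of "{1..N}" a] N1 by simp

lemma grad_avg_lipschitz: "norm (grad_avg y - grad_avg y') \<le> L * norm (y - y')"
proof -
  have "norm (grad_avg y - grad_avg y') = (1 / real N) * norm (\<Sum>i=1..N. grad i y - grad i y')"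
    by (simp add: grad_avg_eq scaleR_diff_right[symmetric] sum_subtractf[symmetric])
  also have "\<dots> \<le> (1 / real N) * (\<Sum>i=1..N. L * norm (y - y'))"
    by (intro mult_left_mono sum_norm_le f_lip) auto
  finally show ?thesis using N1 by simp
qed

lemma avg_loss_quad:
  "avg_loss N f y - avg_loss N f y' - grad_avg y' \<bullet> (y - y') \<le> L / 2 * (norm (y - y'))^2"
proof -
  have "avg_loss N f y - avg_loss N f y' - grad_avg y' \<bullet> (y - y')
      = (1 / real N) * (\<Sum>i=1..N. f i y - f i y' - grad i y' \<bullet> (y - y'))"
    by (simp add: avg_loss_def grad_avg_eq sum_subtractf inner_sum_left right_diff_distrib diff_divide_distrib)
  also have "\<dots> \<le> (1 / real N) * (\<Sum>i=1..N. L / 2 * (norm (y - y'))^2)"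
    by (intro mult_left_mono sum_mono f_quad) auto
  finally show ?thesis using N1 by simp
qed

lemma grad_avg_sq_integrable: "sq_integrable M X \<Longrightarrow> sq_integrable M (\<lambda>\<omega>. grad_avg (X \<omega>))"
  unfolding grad_avg_eq by (intro sq_integrable_intros grad_sq_integrable)

lemma drift_sq_integrable: "i \<in> {1..N} \<Longrightarrow> sq_integrable M (drift t i)"
  unfolding drift_def[abs_def]
  by (intro sq_integrable_intros grad_sq_integrable x_sq_integrable state_sq_integrable) auto

lemma mean_noise_sq_integrable: "i \<in> {1..N} \<Longrightarrow> sq_integrable M (mean_noise t i)"
  unfolding mean_noise_def[abs_def] by (intro sq_integrable_intros noise_second_moment) auto

lemma dev_integrable:
  "i \<in> {1..N} \<Longrightarrow> k \<le> K \<Longrightarrow> integrable M (\<lambda>\<omega>. (norm (x_loc t i k \<omega> - z_srv t \<omega>))^2)"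
  by (intro sq_integrableD sq_integrable_intros x_sq_integrable state_sq_integrable)

lemma drift_second_moment:
  assumes i: "i \<in> {1..N}"
  shows "msq (drift t i) \<le> L^2 * dev t i"
proof -
  have "(norm (drift t i \<omega>))^2 \<le> L^2 * ((1 / real K) * (\<Sum>k<K. (norm (x_loc t i k \<omega> - z_srv t \<omega>))^2))" for \<omega>
  proof -
    have "(norm (drift t i \<omega>))^2 \<le> (1 / real K) * (\<Sum>k<K. (norm (grad i (x_loc t i k \<omega>) - grad i (z_srv t \<omega>)))^2)"
      using norm_mean_power2_le[of "{..<K}"] K1 by (simp add: drift_def lessThan_empty_iff)
    also have "\<dots> \<le> (1 / real K) * (\<Sum>k<K. (L * norm (x_loc t i k \<omega> - z_srv t \<omega>))^2)"
      by (intro mult_left_mono sum_mono power_mono f_lip i) auto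
    finally show ?thesis by (simp add: power_mult_distrib sum_distrib_left mult_ac)
  qed
  then have "msq (drift t i)
      \<le> expectation (\<lambda>\<omega>. L^2 * ((1 / real K) * (\<Sum>k<K. (norm (x_loc t i k \<omega> - z_srv t \<omega>))^2)))"
    by (intro integral_mono sq_integrableD drift_sq_integrable i integrable_mult_right
        Bochner_Integration.integrable_sum dev_integrable) auto
  also have "\<dots> = L^2 * dev t i"
    using dev_integrable[OF i] by (simp add: dev_def Bochner_Integration.integral_sum)
  finally show ?thesis .
qed

text \<open>One estimate for three index rectangles: a prefix of local steps of one client for the
  deviation, all its steps for its momentum, and all steps of all clients for the averaged
  momentum.\<close>

lemma noise_sum_second_moment:
  assumes A: "A \<subseteq> {1..N}" and T: "T \<subseteq> {..<K}"
  shows "msq (\<lambda>\<omega>. \<Sum>i\<in>A. \<Sum>k\<in>T. noise t i k \<omega>) \<le> real (card A * card T) * (\<sigma>^2 / real B)"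
proof -
  have "finite A" "finite T" using A T finite_subset by blast+
  have "msq (\<lambda>\<omega>. \<Sum>p\<in>A \<times> T. noise t (fst p) (snd p) \<omega>) \<le> real (card (A \<times> T)) * (\<sigma>^2 / real B)"
  proof (rule orthogonal_sum_second_moment_le)
    show "finite (A \<times> T)" using \<open>finite A\<close> \<open>finite T\<close> by simp
    show "expectation (\<lambda>\<omega>. noise t (fst p) (snd p) \<omega> \<bullet> noise t (fst p') (snd p') \<omega>) = 0"
      if "p \<in> A \<times> T" "p' \<in> A \<times> T" "p \<noteq> p'" for p p'
      using that A T by (intro noise_orthogonal) (auto simp: prod_eq_iff)
  qed (use A T in \<open>auto intro!: noise_second_moment\<close>)
  then show ?thesis
    by (simp add: sum.cartesian_product card_cartesian_product split_def)
qed

lemma mean_noise_second_moment: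
  assumes i: "i \<in> {1..N}"
  shows "msq (mean_noise t i) \<le> noise_level"
proof -
  have "msq (mean_noise t i)
      = (1 / real K)^2 * msq (\<lambda>\<omega>. \<Sum>k<K. noise t i k \<omega>)"
    by (simp add: mean_noise_def power_mult_distrib power_divide)
  also have "\<dots> \<le> (1 / real K)^2 * (real K * (\<sigma>^2 / real B))"
    using noise_sum_second_moment[of "{i}" "{..<K}" t] i by (intro mult_left_mono) auto
  also have "\<dots> = noise_level" using K1 by (simp add: noise_level_def power2_eq_square)
  finally show ?thesis .
qed

text \<open>Orthogonality across clients gains the factor 1/N, the source of the term 17
  \<eta>/N.\<close>

lemma avg_noise_second_moment:
  "msq (\<lambda>\<omega>. (1 / real N) *\<^sub>R (\<Sum>i=1..N. mean_noise t i \<omega>)) \<le> noise_level / real N"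
proof -
  have "(1 / real N) *\<^sub>R (\<Sum>i=1..N. mean_noise t i \<omega>)
      = (1 / (real N * real K)) *\<^sub>R (\<Sum>i=1..N. \<Sum>k<K. noise t i k \<omega>)" for \<omega>
    by (simp add: mean_noise_def scaleR_sum_right)
  then have "msq (\<lambda>\<omega>. (1 / real N) *\<^sub>R (\<Sum>i=1..N. mean_noise t i \<omega>))
      = (1 / (real N * real K))^2 * msq (\<lambda>\<omega>. \<Sum>i=1..N. \<Sum>k<K. noise t i k \<omega>)"
    by (simp add: power_mult_distrib power_divide)
  also have "\<dots> \<le> (1 / (real N * real K))^2 * (real (N * K) * (\<sigma>^2 / real B))"
    using noise_sum_second_moment[of "{1..N}" "{..<K}" t] by (intro mult_left_mono) auto
  also have "\<dots> = noise_level / real N" using K1 N1 by (simp add: noise_level_def power2_eq_square)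
  finally show ?thesis .
qed

text \<open>Y has to be measurable for every J containing the past because it meets the noise at
  each local step through a different history.\<close>

lemma mean_noise_orthogonal:
  assumes i: "i \<in> {1..N}" and Y: "\<And>J. past t \<subseteq> J \<Longrightarrow> Y \<in> borel_measurable (Fil J)" "sq_integrable M Y"
  shows "expectation (\<lambda>\<omega>. Y \<omega> \<bullet> mean_noise t i \<omega>) = 0"
proof -
  have "expectation (\<lambda>\<omega>. Y \<omega> \<bullet> mean_noise t i \<omega>)
      = (1 / real K) * (\<Sum>k<K. expectation (\<lambda>\<omega>. Y \<omega> \<bullet> noise t i k \<omega>))"
    using sq_integrable_inner[OF Y(2) noise_second_moment(1)[OF i]]
    by (simp add: mean_noise_def inner_sum_right Bochner_Integration.integral_sum)
  also have "\<dots> = 0"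
    using noise_orthogonal_history[OF i _ Y(1)[OF past_subsets(3)] Y(2)] by simp
  finally show ?thesis .
qed

lemma avg_noise_orthogonal:
  assumes Y: "\<And>J. past t \<subseteq> J \<Longrightarrow> Y \<in> borel_measurable (Fil J)" "sq_integrable M Y"
  shows "expectation (\<lambda>\<omega>. Y \<omega> \<bullet> ((1 / real N) *\<^sub>R (\<Sum>i=1..N. mean_noise t i \<omega>))) = 0"
proof -
  have "expectation (\<lambda>\<omega>. Y \<omega> \<bullet> ((1 / real N) *\<^sub>R (\<Sum>i=1..N. mean_noise t i \<omega>)))
      = (1 / real N) * (\<Sum>i=1..N. expectation (\<lambda>\<omega>. Y \<omega> \<bullet> mean_noise t i \<omega>))"
    using sq_integrable_inner[OF Y(2) mean_noise_sq_integrable]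
    by (simp add: inner_sum_right Bochner_Integration.integral_sum)
  also have "\<dots> = 0" using mean_noise_orthogonal[OF _ Y] by simp
  finally show ?thesis .
qed

lemma past_pred: "past (t - 1) \<subseteq> past t"
  by (auto simp: past_def)

lemma grad_state_measurable:
  "past t \<subseteq> J \<Longrightarrow> i \<in> {1..N} \<Longrightarrow> (\<lambda>\<omega>. grad i (z_srv t \<omega>)) \<in> borel_measurable (Fil J)"
  by (rule measurable_compose[OF state_measurable'(1) grad_lipschitz_measurable])

lemma grad_step_second_moment:
  assumes "\<And>y y'. norm (g y - g y' :: 'a) \<le> L * norm (y - y')"
    and "sq_integrable M (\<lambda>\<omega>. g (z_srv (t - 1) \<omega>) - g (z_srv t \<omega>))"
  shows "msq (\<lambda>\<omega>. g (z_srv (t - 1) \<omega>) - g (z_srv t \<omega>)) \<le> L^2 * step_gap t"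
proof -
  have sq: "integrable M (\<lambda>\<omega>. (norm (z_srv t \<omega> - z_srv (t - 1) \<omega>))^2)"
    by (intro sq_integrableD sq_integrable_intros state_sq_integrable)
  have "(norm (g (z_srv (t - 1) \<omega>) - g (z_srv t \<omega>)))^2 \<le> L^2 * (norm (z_srv t \<omega> - z_srv (t - 1) \<omega>))^2" for \<omega>
    using power_mono[OF assms(1)[of "z_srv (t - 1) \<omega>" "z_srv t \<omega>"], of 2]
    by (simp add: power_mult_distrib norm_minus_commute)
  then have "msq (\<lambda>\<omega>. g (z_srv (t - 1) \<omega>) - g (z_srv t \<omega>))
      \<le> expectation (\<lambda>\<omega>. L^2 * (norm (z_srv t \<omega> - z_srv (t - 1) \<omega>))^2)"
    by (intro integral_mono sq_integrableD assms(2) integrable_mult_right sq)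
  also have "\<dots> = L^2 * step_gap t" by (simp add: step_gap_def)
  finally show ?thesis .
qed

text \<open>The new error is (1 - \<eta>)(old error + gradient change) + \<eta> (drift + noise), and
  the first bracket is determined at the start of the round, hence orthogonal to the noise.\<close>

lemma track_err_Suc:
  assumes i: "i \<in> {1..N}"
  shows "track_err (Suc t) i \<le> (1 - \<eta> / 2) * track_err t i + 2 / \<eta> * (L^2 * step_gap t)
    + (\<eta> + 3 / 2 * \<eta>^2) * (L^2 * dev t i) + 5 / 3 * \<eta>^2 * noise_level"
proof -
  let ?A = "\<lambda>\<omega>. v_cl t i \<omega> - grad i (z_srv (t - 1) \<omega>)"
  let ?w = "\<lambda>\<omega>. grad i (z_srv (t - 1) \<omega>) - grad i (z_srv t \<omega>)"
  have A: "sq_integrable M ?A" and w: "sq_integrable M ?w"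
    by (intro sq_integrable_intros state_sq_integrable grad_sq_integrable i)+
  have orth: "expectation (\<lambda>\<omega>. ((1 - \<eta>) *\<^sub>R (?A \<omega> + ?w \<omega>)) \<bullet> mean_noise t i \<omega>) = 0"
  proof (rule mean_noise_orthogonal[OF i])
    show "(\<lambda>\<omega>. (1 - \<eta>) *\<^sub>R (?A \<omega> + ?w \<omega>)) \<in> borel_measurable (Fil J)" if "past t \<subseteq> J" for J
      using that subset_trans[OF past_pred that]
      by (intro borel_measurable_scaleR borel_measurable_add borel_measurable_diff borel_measurable_const
          state_measurable' grad_state_measurable i)
    show "sq_integrable M (\<lambda>\<omega>. (1 - \<eta>) *\<^sub>R (?A \<omega> + ?w \<omega>))" by (intro sq_integrable_intros A w)
  qed
  have "track_err (Suc t) i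
      = msq (\<lambda>\<omega>. (1 - \<eta>) *\<^sub>R (?A \<omega> + ?w \<omega>) + \<eta> *\<^sub>R (drift t i \<omega> + mean_noise t i \<omega>))"
    unfolding track_err_def v_Suc_eq
    by (intro arg_cong[where f=expectation] ext arg_cong[where f="\<lambda>y. (norm y)^2"]) (simp add: algebra_simps)
  also have "\<dots> \<le> (1 - \<eta> / 2) * track_err t i + 2 / \<eta> * msq ?w
     + (\<eta> + 3 / 2 * \<eta>^2) * msq (drift t i)
     + 5 / 3 * \<eta>^2 * msq (mean_noise t i)"
    unfolding track_err_def
    by (rule momentum_recursion[OF A w drift_sq_integrable[OF i] mean_noise_sq_integrable[OF i] orth \<eta>_pos \<eta>_le])
  also have "\<dots> \<le> (1 - \<eta> / 2) * track_err t i + 2 / \<eta> * (L^2 * step_gap t)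
     + (\<eta> + 3 / 2 * \<eta>^2) * (L^2 * dev t i) + 5 / 3 * \<eta>^2 * noise_level"
    using \<eta>_pos by (intro add_mono mult_left_mono order_refl grad_step_second_moment f_lip i w
      drift_second_moment mean_noise_second_moment) auto
  finally show ?thesis .
qed

lemma client_mean_affine:
  fixes u r e :: "nat \<Rightarrow> real"
  shows "(1 / real N) * (\<Sum>i=1..N. a * u i + b * r i + c * e i + k)
    = a * ((1 / real N) * (\<Sum>i=1..N. u i)) + b * ((1 / real N) * (\<Sum>i=1..N. r i))
      + c * ((1 / real N) * (\<Sum>i=1..N. e i)) + k"
proof -
  have "(\<Sum>i=1..N. a * u i + b * r i + c * e i + k)
      = a * (\<Sum>i=1..N. u i) + b * (\<Sum>i=1..N. r i) + c * (\<Sum>i=1..N. e i) + real N * k"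
    by (simp add: sum.distrib sum_distrib_left)
  then show ?thesis using N1 by (simp only: distrib_left) simp
qed

lemma mean_track_err_Suc:
  "mean_track_err (Suc t) \<le> (1 - \<eta> / 2) * mean_track_err t + 2 / \<eta> * (L^2 * step_gap t)
    + (\<eta> + 3 / 2 * \<eta>^2) * (L^2 * mean_dev t) + 5 / 3 * \<eta>^2 * noise_level"
proof -
  have "mean_track_err (Suc t) \<le> (1 / real N) * (\<Sum>i=1..N. (1 - \<eta> / 2) * track_err t i + 2 / \<eta> * (L^2 * step_gap t)
    + (\<eta> + 3 / 2 * \<eta>^2) * (L^2 * dev t i) + 5 / 3 * \<eta>^2 * noise_level)"
    unfolding mean_track_err_def by (intro mult_left_mono sum_mono track_err_Suc) auto
  \<comment> \<open>Brought into the four-summand shape of \<open>client_mean_affine\<close>, with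
    \<open>0 * 0\<close> filling the empty slot.\<close>
  also have "(\<lambda>i. (1 - \<eta> / 2) * track_err t i + 2 / \<eta> * (L^2 * step_gap t)
      + (\<eta> + 3 / 2 * \<eta>^2) * (L^2 * dev t i) + 5 / 3 * \<eta>^2 * noise_level)
    = (\<lambda>i. (1 - \<eta> / 2) * track_err t i + 0 * 0 + ((\<eta> + 3 / 2 * \<eta>^2) * L^2) * dev t i
      + (2 / \<eta> * (L^2 * step_gap t) + 5 / 3 * \<eta>^2 * noise_level))"
    by (simp add: fun_eq_iff mult.assoc)
  finally show ?thesis unfolding client_mean_affine mean_track_err_def[symmetric] mean_dev_def[symmetric]
    by (simp add: mult.assoc)
qed

text \<open>Averaging over clients before taking norms keeps the orthogonality of their noise;
  averaging the individual recursions would lose the factor 1/N.\<close>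

lemma avg_err_Suc:
  "avg_err (Suc t) \<le> (1 - \<eta> / 2) * avg_err t + 2 / \<eta> * (L^2 * step_gap t)
    + (\<eta> + 3 / 2 * \<eta>^2) * (L^2 * mean_dev t) + 5 / 3 * \<eta>^2 * (noise_level / real N)"
proof -
  let ?v = "\<lambda>t \<omega>. (1 / real N) *\<^sub>R (\<Sum>i=1..N. v_cl t i \<omega>)"
  let ?A = "\<lambda>\<omega>. ?v t \<omega> - grad_avg (z_srv (t - 1) \<omega>)"
  let ?w = "\<lambda>\<omega>. grad_avg (z_srv (t - 1) \<omega>) - grad_avg (z_srv t \<omega>)"
  let ?d = "\<lambda>\<omega>. (1 / real N) *\<^sub>R (\<Sum>i=1..N. drift t i \<omega>)"
  let ?n = "\<lambda>\<omega>. (1 / real N) *\<^sub>R (\<Sum>i=1..N. mean_noise t i \<omega>)"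
  have A: "sq_integrable M ?A" and w: "sq_integrable M ?w" and d: "sq_integrable M ?d" and n: "sq_integrable M ?n"
    by (intro sq_integrable_intros state_sq_integrable grad_avg_sq_integrable drift_sq_integrable mean_noise_sq_integrable; assumption)+
  have orth: "expectation (\<lambda>\<omega>. ((1 - \<eta>) *\<^sub>R (?A \<omega> + ?w \<omega>)) \<bullet> ?n \<omega>) = 0"
  proof (rule avg_noise_orthogonal)
    show "(\<lambda>\<omega>. (1 - \<eta>) *\<^sub>R (?A \<omega> + ?w \<omega>)) \<in> borel_measurable (Fil J)" if "past t \<subseteq> J" for J
      using that subset_trans[OF past_pred that] unfolding grad_avg_eq
      by (intro borel_measurable_scaleR borel_measurable_add borel_measurable_diff borel_measurable_const
          borel_measurable_sum state_measurable' grad_state_measurable)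
    show "sq_integrable M (\<lambda>\<omega>. (1 - \<eta>) *\<^sub>R (?A \<omega> + ?w \<omega>))" by (intro sq_integrable_intros A w)
  qed
  have v: "?v (Suc t) \<omega> = (1 - \<eta>) *\<^sub>R ?v t \<omega> + \<eta> *\<^sub>R (grad_avg (z_srv t \<omega>) + ?d \<omega> + ?n \<omega>)" for \<omega>
    unfolding v_Suc_eq grad_avg_eq sum.distrib scaleR_sum_right[symmetric]
    by (simp add: sum.distrib scaleR_add_right mult_ac)
  have db: "msq ?d \<le> L^2 * mean_dev t"
  proof -
    have "msq ?d \<le> expectation (\<lambda>\<omega>. (1 / real N) * (\<Sum>i=1..N. (norm (drift t i \<omega>))^2))"
      by (intro integral_mono norm_client_mean_power2_le sq_integrableD d integrable_mult_right
          Bochner_Integration.integrable_sum drift_sq_integrable)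
    also have "\<dots> = (1 / real N) * (\<Sum>i=1..N. msq (drift t i))"
      using sq_integrableD[OF drift_sq_integrable] by (simp add: Bochner_Integration.integral_sum)
    also have "\<dots> \<le> (1 / real N) * (\<Sum>i=1..N. L^2 * dev t i)"
      by (intro mult_left_mono sum_mono drift_second_moment) auto
    finally show ?thesis by (simp add: mean_dev_def sum_distrib_left mult_ac)
  qed
  have "avg_err (Suc t) = msq (\<lambda>\<omega>. (1 - \<eta>) *\<^sub>R (?A \<omega> + ?w \<omega>) + \<eta> *\<^sub>R (?d \<omega> + ?n \<omega>))"
    unfolding avg_err_def v
    by (intro arg_cong[where f=expectation] ext arg_cong[where f="\<lambda>y. (norm y)^2"]) (simp add: algebra_simps)
  also have "\<dots> \<le> (1 - \<eta> / 2) * avg_err t + 2 / \<eta> * msq ?w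
     + (\<eta> + 3 / 2 * \<eta>^2) * msq ?d
     + 5 / 3 * \<eta>^2 * msq ?n"
    unfolding avg_err_def by (rule momentum_recursion[OF A w d n orth \<eta>_pos \<eta>_le])
  also have "\<dots> \<le> (1 - \<eta> / 2) * avg_err t + 2 / \<eta> * (L^2 * step_gap t)
     + (\<eta> + 3 / 2 * \<eta>^2) * (L^2 * mean_dev t) + 5 / 3 * \<eta>^2 * (noise_level / real N)"
    using \<eta>_pos by (intro add_mono mult_left_mono order_refl grad_step_second_moment grad_avg_lipschitz w
      db avg_noise_second_moment) auto
  finally show ?thesis .
qed

text \<open>The noise is split off before the Young step that produces 1/(1 - q), so it is charged
  with q^2 \<eta>^2 only; this keeps 14 \<eta>^2/(1 - q) at the first power of 1/(1 - q).\<close>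

lemma comp_err_Suc:
  assumes i: "i \<in> {1..N}"
  shows "comp_err (Suc t) i \<le> q * comp_err t i
     + q^2 / (1 - q) * \<eta>^2 * (3 * (track_err t i + L^2 * step_gap t + L^2 * dev t i))
     + q^2 * \<eta>^2 * (3 / 2 * (L^2 * dev t i) + 5 / 3 * noise_level)"
proof -
  let ?a = "\<lambda>\<omega>. v_cl t i \<omega> - c_cl t i \<omega>"
  let ?X = "\<lambda>\<omega>. ?a \<omega> + \<eta> *\<^sub>R (grad i (z_srv t \<omega>) - v_cl t i \<omega>)"
  let ?g = "\<lambda>\<omega>. v_cl t i \<omega> - grad i (z_srv (t - 1) \<omega>)"
  let ?w = "\<lambda>\<omega>. grad i (z_srv (t - 1) \<omega>) - grad i (z_srv t \<omega>)"
  let ?d = "drift t i"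
  have a: "sq_integrable M ?a" and g: "sq_integrable M ?g" and w: "sq_integrable M ?w" and X: "sq_integrable M ?X"
    by (intro sq_integrable_intros state_sq_integrable grad_sq_integrable i)+
  note d = drift_sq_integrable[OF i, of t] and n = mean_noise_sq_integrable[OF i, of t]
  note [simp] = a[THEN sq_integrableD] g[THEN sq_integrableD]
    w[THEN sq_integrableD] d[THEN sq_integrableD]
  have orth: "expectation (\<lambda>\<omega>. ?X \<omega> \<bullet> mean_noise t i \<omega>) = 0"
  proof (rule mean_noise_orthogonal[OF i _ X])
    show "?X \<in> borel_measurable (Fil J)" if "past t \<subseteq> J" for J
      using that by (intro borel_measurable_scaleR borel_measurable_add borel_measurable_diff borel_measurable_const
          state_measurable' grad_state_measurable i)
  qed
  have pt: "q^2 * (norm (?X \<omega> + \<eta> *\<^sub>R ?d \<omega>))^2 \<le> q * (norm (?a \<omega>))^2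
     + q^2 / (1 - q) * \<eta>^2 * (3 * ((norm (?g \<omega>))^2 + (norm (?w \<omega>))^2 + (norm (?d \<omega>))^2))" for \<omega>
  proof -
    \<comment> \<open>The gradient at z^t minus v_i is routed through the gradient at z^(t-1), so
      that the tracking error of the same time appears.\<close>
    let ?b = "- ?g \<omega> + - ?w \<omega> + ?d \<omega>"
    have eq: "?X \<omega> + \<eta> *\<^sub>R ?d \<omega> = ?a \<omega> + \<eta> *\<^sub>R ?b" by (simp add: algebra_simps)
    have "q^2 * (norm (?X \<omega> + \<eta> *\<^sub>R ?d \<omega>))^2 \<le> q * (norm (?a \<omega>))^2 + q^2 / (1 - q) * (norm (\<eta> *\<^sub>R ?b))^2"
      unfolding eq by (rule contraction_power2_le[OF q_nonneg q_less])
    also have "(norm (\<eta> *\<^sub>R ?b))^2 = \<eta>^2 * (norm ?b)^2" by (simp add: power_mult_distrib)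
    also have "q * (norm (?a \<omega>))^2 + q^2 / (1 - q) * (\<eta>^2 * (norm ?b)^2)
       \<le> q * (norm (?a \<omega>))^2 + q^2 / (1 - q) * (\<eta>^2 * (3 * ((norm (?g \<omega>))^2 + (norm (?w \<omega>))^2 + (norm (?d \<omega>))^2)))"
      using q_less norm_add3_power2_le[of "- ?g \<omega>" "- ?w \<omega>" "?d \<omega>"]
      by (intro add_left_mono mult_left_mono) (auto simp: norm_minus_commute)
    finally show ?thesis by (simp only: mult.assoc)
  qed
  have "comp_err (Suc t) i \<le> q^2 * msq (\<lambda>\<omega>. v_cl (Suc t) i \<omega> - c_cl t i \<omega>)"
    unfolding comp_err_def by (rule compression_sq_integrable(2)[OF i]) (intro state_sq_integrable i)+
  also have "msq (\<lambda>\<omega>. v_cl (Suc t) i \<omega> - c_cl t i \<omega>)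
     = msq (\<lambda>\<omega>. ?X \<omega> + \<eta> *\<^sub>R (?d \<omega> + mean_noise t i \<omega>))"
    unfolding v_Suc_eq
    by (intro arg_cong[where f=expectation] ext arg_cong[where f="\<lambda>y. (norm y)^2"]) (simp add: algebra_simps)
  also have "q^2 * \<dots> \<le> q^2 * (msq (\<lambda>\<omega>. ?X \<omega> + \<eta> *\<^sub>R ?d \<omega>)
      + \<eta>^2 * (3 / 2 * msq ?d + 5 / 3 * msq (mean_noise t i)))"
    by (intro mult_left_mono second_moment_drift_noise X d n orth) auto
  also have "\<dots> \<le> expectation (\<lambda>\<omega>. q^2 * (norm (?X \<omega> + \<eta> *\<^sub>R ?d \<omega>))^2)
      + q^2 * \<eta>^2 * (3 / 2 * (L^2 * dev t i) + 5 / 3 * noise_level)"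
  proof -
    have "q^2 * \<eta>^2 * (3 / 2 * msq ?d + 5 / 3 * msq (mean_noise t i))
       \<le> q^2 * \<eta>^2 * (3 / 2 * (L^2 * dev t i) + 5 / 3 * noise_level)"
      by (intro mult_left_mono add_mono drift_second_moment mean_noise_second_moment i) auto
    then show ?thesis by (simp add: distrib_left mult.assoc)
  qed
  also have "expectation (\<lambda>\<omega>. q^2 * (norm (?X \<omega> + \<eta> *\<^sub>R ?d \<omega>))^2)
     \<le> expectation (\<lambda>\<omega>. q * (norm (?a \<omega>))^2
     + q^2 / (1 - q) * \<eta>^2 * (3 * ((norm (?g \<omega>))^2 + (norm (?w \<omega>))^2 + (norm (?d \<omega>))^2)))"
  proof (rule integral_mono[OF _ _ pt])
    show "integrable M (\<lambda>\<omega>. q^2 * (norm (?X \<omega> + \<eta> *\<^sub>R ?d \<omega>))^2)"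
      by (intro integrable_mult_right sq_integrableD sq_integrable_add[OF X sq_integrable_scaleR[OF d]])
    show "integrable M (\<lambda>\<omega>. q * (norm (?a \<omega>))^2
     + q^2 / (1 - q) * \<eta>^2 * (3 * ((norm (?g \<omega>))^2 + (norm (?w \<omega>))^2 + (norm (?d \<omega>))^2)))"
      by (intro Bochner_Integration.integrable_add integrable_mult_right sq_integrableD a g w d)
  qed
  also have "\<dots> = q * comp_err t i + q^2 / (1 - q) * \<eta>^2 *
     (3 * (track_err t i + msq ?w + msq ?d))"
    by (simp add: comp_err_def track_err_def del: One_nat_def)
  also have "\<dots> \<le> q * comp_err t i + q^2 / (1 - q) * \<eta>^2 * (3 * (track_err t i + L^2 * step_gap t + L^2 * dev t i))"
    using q_less by (intro add_mono mult_left_mono order_refl grad_step_second_moment f_lip drift_second_moment i w) auto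
  finally show ?thesis by simp
qed

lemma mean_comp_err_Suc:
  "mean_comp_err (Suc t) \<le> q * mean_comp_err t
     + q^2 / (1 - q) * \<eta>^2 * (3 * (mean_track_err t + L^2 * step_gap t + L^2 * mean_dev t))
     + q^2 * \<eta>^2 * (3 / 2 * (L^2 * mean_dev t) + 5 / 3 * noise_level)"
proof -
  have "mean_comp_err (Suc t) \<le> (1 / real N) * (\<Sum>i=1..N. q * comp_err t i
     + q^2 / (1 - q) * \<eta>^2 * (3 * (track_err t i + L^2 * step_gap t + L^2 * dev t i))
     + q^2 * \<eta>^2 * (3 / 2 * (L^2 * dev t i) + 5 / 3 * noise_level))"
    unfolding mean_comp_err_def by (intro mult_left_mono sum_mono comp_err_Suc) auto
  also have "(\<lambda>i. q * comp_err t i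
      + q^2 / (1 - q) * \<eta>^2 * (3 * (track_err t i + L^2 * step_gap t + L^2 * dev t i))
      + q^2 * \<eta>^2 * (3 / 2 * (L^2 * dev t i) + 5 / 3 * noise_level))
    = (\<lambda>i. q * comp_err t i + (q^2 / (1 - q) * \<eta>^2 * 3) * track_err t i
      + (q^2 / (1 - q) * \<eta>^2 * 3 * L^2 + q^2 * \<eta>^2 * (3 / 2) * L^2) * dev t i
      + (q^2 / (1 - q) * \<eta>^2 * 3 * (L^2 * step_gap t) + q^2 * \<eta>^2 * (5 / 3) * noise_level))"
    by (rule ext) (simp only: distrib_left distrib_right mult_ac add_ac)
  finally show ?thesis unfolding client_mean_affine mean_comp_err_def[symmetric] mean_track_err_def[symmetric] mean_dev_def[symmetric]
    by (simp only: distrib_left distrib_right mult_ac add_ac)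
qed


section \<open>Deviation of the local iterates and heterogeneity of the clients\<close>

definition "hetero t i = msq (\<lambda>\<omega>. grad i (z_srv t \<omega>) + (c_srv t \<omega> - c_cl t i \<omega>))"

abbreviation "G \<equiv> prox_grad_map (avg_loss N f) h \<beta>"

lemma norm_prox_h_diff_le: "0 < \<gamma> \<Longrightarrow> norm (prox \<gamma> h y - y) \<le> \<gamma> * b\<^sub>h"
  by (rule norm_prox_diff_le[OF h_proper h_closed h_convex _ h_subgrad])

text \<open>Four contributions: the latest proximal displacement, the noise sum, the gradient
  changes along the path, and k times the noiseless starting direction. The sum over j < k is
  extended to j < K so that averaging over k reproduces \<open>dev\<close>.\<close>

lemma x_dev_power2_le:
  assumes i: "i \<in> {1..N}" and k: "k < K"
  shows "(norm (x_loc t i k \<omega> - z_srv t \<omega>))^2 \<le> 4 * \<alpha>^2 * ((real k)^2 * b\<^sub>h^2 + (norm (\<Sum>j<k. noise t i j \<omega>))^2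
     + real k * L^2 * (\<Sum>j<K. (norm (x_loc t i j \<omega> - z_srv t \<omega>))^2)
     + (real k)^2 * (norm (grad i (z_srv t \<omega>) + (c_srv t \<omega> - c_cl t i \<omega>)))^2)"
proof (cases k)
  case 0
  then show ?thesis by (simp add: x_0)
next
  case (Suc k')
  define P where "P = x_loc t i k \<omega> - fst (loc t i k \<omega>)"
  define Q where "Q = (\<Sum>j<k. noise t i j \<omega>)"
  define W where "W = (\<Sum>j<k. grad i (x_loc t i j \<omega>) - grad i (z_srv t \<omega>))"
  define H where "H = grad i (z_srv t \<omega>) + (c_srv t \<omega> - c_cl t i \<omega>)"
  have "(\<Sum>j<k. grad_est t i j \<omega> (x_loc t i j \<omega>)) = Q + W + real k *\<^sub>R grad i (z_srv t \<omega>)"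
    by (simp add: Q_def W_def noise_def sum.distrib[symmetric] sum_subtractf sum_constant_scaleR)
  then have "x_loc t i k \<omega> - z_srv t \<omega> = P + (- \<alpha>) *\<^sub>R Q + (- \<alpha>) *\<^sub>R W + (- (\<alpha> * real k)) *\<^sub>R H"
    by (simp add: P_def fst_loc H_def algebra_simps)
  then have "(norm (x_loc t i k \<omega> - z_srv t \<omega>))^2
     \<le> 4 * ((norm P)^2 + (norm ((- \<alpha>) *\<^sub>R Q))^2 + (norm ((- \<alpha>) *\<^sub>R W))^2 + (norm ((- (\<alpha> * real k)) *\<^sub>R H))^2)"
    using norm_add4_power2_le by metis
  also have "\<dots> = 4 * ((norm P)^2 + \<alpha>^2 * (norm Q)^2 + \<alpha>^2 * (norm W)^2 + \<alpha>^2 * (real k)^2 * (norm H)^2)"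
    by (simp add: power_mult_distrib)
  also have "\<dots> \<le> 4 * (\<alpha>^2 * ((real k)^2 * b\<^sub>h^2) + \<alpha>^2 * (norm Q)^2
      + \<alpha>^2 * (real k * L^2 * (\<Sum>j<K. (norm (x_loc t i j \<omega> - z_srv t \<omega>))^2)) + \<alpha>^2 * (real k)^2 * (norm H)^2)"
  proof (intro mult_left_mono add_mono order_refl)
    have "norm P \<le> (real k * \<alpha>) * b\<^sub>h"
      using norm_prox_h_diff_le[of "real k * \<alpha>"] \<alpha>_pos unfolding P_def Suc x_Suc by simp
    then have "(norm P)^2 \<le> ((real k * \<alpha>) * b\<^sub>h)^2" by (intro power_mono) auto
    then show "(norm P)^2 \<le> \<alpha>^2 * ((real k)^2 * b\<^sub>h^2)" by (simp add: power_mult_distrib mult_ac)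
    have "(norm W)^2 \<le> (\<Sum>j<k. norm (grad i (x_loc t i j \<omega>) - grad i (z_srv t \<omega>)))^2"
      unfolding W_def by (intro power_mono norm_sum) auto
    also have "\<dots> \<le> (\<Sum>j<k. (norm (grad i (x_loc t i j \<omega>) - grad i (z_srv t \<omega>)))^2) * real k"
      using sum_squared_le_sum_of_squares[of _ "{..<k}"] by simp
    also have "\<dots> \<le> (\<Sum>j<k. (L * norm (x_loc t i j \<omega> - z_srv t \<omega>))^2) * real k"
      by (intro mult_right_mono sum_mono power_mono f_lip i) auto
    also have "\<dots> \<le> (\<Sum>j<K. (L * norm (x_loc t i j \<omega> - z_srv t \<omega>))^2) * real k"
      using k by (intro mult_right_mono sum_mono2) auto
    finally show "(norm W)^2 \<le> real k * L^2 * (\<Sum>j<K. (norm (x_loc t i j \<omega> - z_srv t \<omega>))^2)"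
      by (simp add: power_mult_distrib sum_distrib_left[symmetric] mult_ac)
  qed auto
  finally show ?thesis by (simp add: Q_def H_def distrib_left mult.assoc)
qed

lemma hetero_sq_integrable:
  "i \<in> {1..N} \<Longrightarrow> sq_integrable M (\<lambda>\<omega>. grad i (z_srv t \<omega>) + (c_srv t \<omega> - c_cl t i \<omega>))"
  by (intro sq_integrable_intros grad_sq_integrable state_sq_integrable)

text \<open>Each contribution is at most k K times a quantity independent of k; summing k over k < K
  gives K^2/2, which turns the factor 4 into 2. \<open>dev\<close> remains on the right and is
  absorbed once L \<alpha> K is known to be small.\<close>

lemma dev_le:
  assumes i: "i \<in> {1..N}"
  shows "dev t i \<le> 2 * (\<alpha> * real K)^2 * (b\<^sub>h^2 + noise_level + hetero t i + L^2 * dev t i)"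
proof -
  define Y where "Y = b\<^sub>h^2 + noise_level + hetero t i + L^2 * dev t i"
  have nl: "0 \<le> noise_level" by (simp add: noise_level_def)
  have dev: "(\<Sum>j<K. msq (\<lambda>\<omega>. x_loc t i j \<omega> - z_srv t \<omega>)) = real K * dev t i"
    using K1 by (simp add: dev_def)
  have dev0: "0 \<le> dev t i" by (simp add: dev_def sum_nonneg)
  have het0: "0 \<le> hetero t i" by (simp add: hetero_def)
  have le: "msq (\<lambda>\<omega>. x_loc t i k \<omega> - z_srv t \<omega>) \<le> 4 * \<alpha>^2 * real K * Y * real k" if k: "k < K" for k
  proof -
    have nq: "sq_integrable M (\<lambda>\<omega>. \<Sum>j<k. noise t i j \<omega>)"
      using k by (intro sq_integrable_intros noise_second_moment i) auto
    note [simp] = nq[THEN sq_integrableD] dev_integrable[OF i] hetero_sq_integrable[OF i, THEN sq_integrableD]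
    have "msq (\<lambda>\<omega>. x_loc t i k \<omega> - z_srv t \<omega>)
      \<le> expectation (\<lambda>\<omega>. 4 * \<alpha>^2 * ((real k)^2 * b\<^sub>h^2 + (norm (\<Sum>j<k. noise t i j \<omega>))^2
        + real k * L^2 * (\<Sum>j<K. (norm (x_loc t i j \<omega> - z_srv t \<omega>))^2)
        + (real k)^2 * (norm (grad i (z_srv t \<omega>) + (c_srv t \<omega> - c_cl t i \<omega>)))^2))"
      using k by (intro integral_mono x_dev_power2_le i integrable_mult_right Bochner_Integration.integrable_add
          Bochner_Integration.integrable_sum integrable_const) auto
    also have "\<dots> = 4 * \<alpha>^2 * ((real k)^2 * b\<^sub>h^2 + msq (\<lambda>\<omega>. \<Sum>j<k. noise t i j \<omega>)
        + real k * L^2 * (real K * dev t i) + (real k)^2 * hetero t i)"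
    proof -
      have ints: "integrable M (\<lambda>\<omega>. (norm (\<Sum>j<k. noise t i j \<omega>))^2)"
        "integrable M (\<lambda>\<omega>. \<Sum>j<K. (norm (x_loc t i j \<omega> - z_srv t \<omega>))^2)"
        "integrable M (\<lambda>\<omega>. (norm (grad i (z_srv t \<omega>) + (c_srv t \<omega> - c_cl t i \<omega>)))^2)"
        by (auto intro: Bochner_Integration.integrable_sum)
      have "expectation (\<lambda>\<omega>. \<Sum>j<K. (norm (x_loc t i j \<omega> - z_srv t \<omega>))^2) = real K * dev t i"
        unfolding dev[symmetric] by (rule Bochner_Integration.integral_sum) simp
      then show ?thesis unfolding integral_mult_right_zero expectation_affine[OF ints] hetero_def by (simp only:)
    qed
    also have "\<dots> \<le> 4 * \<alpha>^2 * (real k * real K * b\<^sub>h^2 + real k * real K * noise_level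
        + real k * L^2 * (real K * dev t i) + real k * real K * hetero t i)"
    proof (intro mult_left_mono[of _ _ "4 * \<alpha>^2"] add_mono order_refl)
      have kk: "(real k)^2 \<le> real k * real K" using k by (simp add: power2_eq_square mult_left_mono)
      show "(real k)^2 * b\<^sub>h^2 \<le> real k * real K * b\<^sub>h^2" using kk by (intro mult_right_mono) auto
      show "(real k)^2 * hetero t i \<le> real k * real K * hetero t i" using kk het0 by (intro mult_right_mono) auto
      have "msq (\<lambda>\<omega>. \<Sum>j<k. noise t i j \<omega>) \<le> real k * (\<sigma>^2 / real B)"
        using noise_sum_second_moment[of "{i}" "{..<k}" t] i k by auto
      then show "msq (\<lambda>\<omega>. \<Sum>j<k. noise t i j \<omega>) \<le> real k * real K * noise_level"
        using K1 by (simp add: noise_level_def)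
    qed auto
    also have "\<dots> = 4 * \<alpha>^2 * real K * Y * real k" by (simp add: Y_def algebra_simps)
    finally show ?thesis .
  qed
  have "dev t i \<le> (1 / real K) * (\<Sum>k<K. 4 * \<alpha>^2 * real K * Y * real k)"
    unfolding dev_def by (intro mult_left_mono sum_mono le) auto
  also have "\<dots> = 4 * \<alpha>^2 * Y * (\<Sum>k<K. real k)" using K1 by (simp add: sum_distrib_left[symmetric])
  also have "\<dots> \<le> 4 * \<alpha>^2 * Y * ((real K)^2 / 2)"
    using nl dev0 het0 by (intro mult_left_mono sum_real_lessThan_le) (simp add: Y_def)
  finally show ?thesis by (simp add: Y_def power_mult_distrib algebra_simps)
qed

text \<open>G y minus the gradient at y is a subgradient of h at the proximal point.\<close>

lemma norm_grad_avg_le: "norm (grad_avg y) \<le> norm (G y) + b\<^sub>h"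
proof -
  let ?p = "prox \<beta> h (y - \<beta> *\<^sub>R grad_avg y)"
  have "norm ((1 / \<beta>) *\<^sub>R ((y - \<beta> *\<^sub>R grad_avg y) - ?p)) \<le> b\<^sub>h"
    by (rule h_subgrad[OF prox_subgradient[OF h_proper h_closed h_convex \<beta>_pos]])
  moreover have "(1 / \<beta>) *\<^sub>R ((y - \<beta> *\<^sub>R grad_avg y) - ?p) = G y - grad_avg y"
    using \<beta>_pos by (simp add: prox_grad_map_def algebra_simps)
  ultimately have "norm (G y - grad_avg y) \<le> b\<^sub>h" by simp
  then show ?thesis using norm_triangle_ineq4[of "G y" "G y - grad_avg y"] by simp
qed

lemma map_sq_integrable: "sq_integrable M (\<lambda>\<omega>. G (z_srv t \<omega>))"
  unfolding prox_grad_map_def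
  by (intro sq_integrable_intros prox_sq_integrable \<beta>_pos grad_avg_sq_integrable state_sq_integrable)

text \<open>With a_i the client gradient minus c_i and m the average gradient, the mean of the a_i
  is m - c. The right side therefore exceeds the left by exactly the squared norm of m - c, and c
  disappears without a factor 2.\<close>

lemma hetero_mean_power2_le:
  "(1 / real N) * (\<Sum>i=1..N. (norm (grad i (z_srv t \<omega>) + (c_srv t \<omega> - c_cl t i \<omega>)))^2)
   \<le> (1 / real N) * (\<Sum>i=1..N. (norm (grad i (z_srv t \<omega>) - c_cl t i \<omega>))^2) + (norm (grad_avg (z_srv t \<omega>)))^2"
proof -
  define a where "a i = grad i (z_srv t \<omega>) - c_cl t i \<omega>" for i
  define c where "c = c_srv t \<omega>"
  define m where "m = grad_avg (z_srv t \<omega>)"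
  have N: "real N > 0" using N1 by simp
  have "(1 / real N) *\<^sub>R (\<Sum>i=1..N. a i) = m - c"
    by (simp add: a_def c_def m_def grad_avg_eq c_eq sum_subtractf scaleR_diff_right)
  then have "real N *\<^sub>R ((1 / real N) *\<^sub>R (\<Sum>i=1..N. a i)) = real N *\<^sub>R (m - c)" by (rule arg_cong)
  then have sum_a: "(\<Sum>i=1..N. a i) = real N *\<^sub>R (m - c)" using N by simp
  have "(\<Sum>i=1..N. (norm (a i + c))^2) = (\<Sum>i=1..N. (norm (a i))^2 + 2 * (a i \<bullet> c) + (norm c)^2)"
    unfolding power2_norm_eq_inner by (intro sum.cong refl) (simp add: inner_add inner_commute)
  also have "\<dots> = (\<Sum>i=1..N. (norm (a i))^2) + 2 * ((\<Sum>i=1..N. a i) \<bullet> c) + real N * (norm c)^2"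
    by (simp add: sum.distrib inner_sum_left sum_distrib_left)
  also have "\<dots> = (\<Sum>i=1..N. (norm (a i))^2) + real N * (2 * (m \<bullet> c) - (norm c)^2)"
    unfolding sum_a by (simp add: inner_diff_left power2_norm_eq_inner algebra_simps)
  also have "2 * (m \<bullet> c) - (norm c)^2 \<le> (norm m)^2"
  proof -
    have "0 \<le> (norm (m - c))^2" by simp
    then show ?thesis unfolding power2_norm_eq_inner by (simp add: inner_diff inner_commute)
  qed
  finally have "(1 / real N) * (\<Sum>i=1..N. (norm (a i + c))^2)
      \<le> (1 / real N) * ((\<Sum>i=1..N. (norm (a i))^2) + real N * (norm m)^2)"
    using N by (intro mult_left_mono) auto
  also have "\<dots> = (1 / real N) * (\<Sum>i=1..N. (norm (a i))^2) + (norm m)^2"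
    using N by (simp add: distrib_left)
  finally show ?thesis by (simp add: a_def c_def m_def algebra_simps)
qed

text \<open>Each client gradient minus c_i is routed through the gradient at z^(t-1) and v_i, so
  heterogeneity is expressed by errors that already have recursions.\<close>

lemma mean_hetero_le:
  "(1 / real N) * (\<Sum>i=1..N. hetero t i)
   \<le> 3 * (L^2 * step_gap t + mean_track_err t + mean_comp_err t) + 2 * map_sq t + 2 * b\<^sub>h^2"
proof -
  let ?w = "\<lambda>i \<omega>. grad i (z_srv (t - 1) \<omega>) - grad i (z_srv t \<omega>)"
  let ?r = "\<lambda>i \<omega>. v_cl t i \<omega> - grad i (z_srv (t - 1) \<omega>)"
  let ?u = "\<lambda>i \<omega>. v_cl t i \<omega> - c_cl t i \<omega>"
  have w: "sq_integrable M (?w i)" and r: "sq_integrable M (?r i)" and u: "sq_integrable M (?u i)" if "i \<in> {1..N}" for i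
    using that by (intro sq_integrable_intros state_sq_integrable grad_sq_integrable; assumption)+
  have pt: "(1 / real N) * (\<Sum>i=1..N. (norm (grad i (z_srv t \<omega>) + (c_srv t \<omega> - c_cl t i \<omega>)))^2)
     \<le> (1 / real N) * (\<Sum>i=1..N. 3 * ((norm (?w i \<omega>))^2 + (norm (?r i \<omega>))^2 + (norm (?u i \<omega>))^2))
       + (2 * (norm (G (z_srv t \<omega>)))^2 + 2 * b\<^sub>h^2)" for \<omega>
  proof -
    have "(norm (grad i (z_srv t \<omega>) - c_cl t i \<omega>))^2 \<le> 3 * ((norm (?w i \<omega>))^2 + (norm (?r i \<omega>))^2 + (norm (?u i \<omega>))^2)" for i
    proof -
      have "grad i (z_srv t \<omega>) - c_cl t i \<omega> = - ?w i \<omega> + - ?r i \<omega> + ?u i \<omega>" by simp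
      then show ?thesis using norm_add3_power2_le[of "- ?w i \<omega>" "- ?r i \<omega>" "?u i \<omega>"]
        by (simp only: norm_minus_cancel)
    qed
    moreover have "(norm (grad_avg (z_srv t \<omega>)))^2 \<le> 2 * (norm (G (z_srv t \<omega>)))^2 + 2 * b\<^sub>h^2"
    proof -
      have "(norm (grad_avg (z_srv t \<omega>)))^2 \<le> (norm (G (z_srv t \<omega>)) + b\<^sub>h)^2"
        by (intro power_mono norm_grad_avg_le) auto
      also have "\<dots> \<le> 2 * (norm (G (z_srv t \<omega>)))^2 + 2 * b\<^sub>h^2"
        using norm_add_power2_le[of "norm (G (z_srv t \<omega>))" "b\<^sub>h"] by simp
      finally show ?thesis .
    qed
    ultimately show ?thesis
      by (intro order_trans[OF hetero_mean_power2_le] add_mono mult_left_mono sum_mono) auto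
  qed
  have ints: "integrable M (\<lambda>\<omega>. (norm (G (z_srv t \<omega>)))^2)"
    "\<And>i. i \<in> {1..N} \<Longrightarrow> integrable M (\<lambda>\<omega>. (norm (?w i \<omega>))^2)"
    "\<And>i. i \<in> {1..N} \<Longrightarrow> integrable M (\<lambda>\<omega>. (norm (?r i \<omega>))^2)"
    "\<And>i. i \<in> {1..N} \<Longrightarrow> integrable M (\<lambda>\<omega>. (norm (?u i \<omega>))^2)"
    using map_sq_integrable w r u by (auto intro: sq_integrableD)
  have ints3: "integrable M (\<lambda>\<omega>. 3 * ((norm (?w i \<omega>))^2 + (norm (?r i \<omega>))^2 + (norm (?u i \<omega>))^2))"
    and E3: "expectation (\<lambda>\<omega>. 3 * ((norm (?w i \<omega>))^2 + (norm (?r i \<omega>))^2 + (norm (?u i \<omega>))^2))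
      = 3 * (msq (?w i) + track_err t i + comp_err t i)"
    if "i \<in> {1..N}" for i
    using ints(2-4)[OF that] unfolding track_err_def comp_err_def by (simp_all del: One_nat_def)
  have "(1 / real N) * (\<Sum>i=1..N. hetero t i)
      = expectation (\<lambda>\<omega>. (1 / real N) * (\<Sum>i=1..N. (norm (grad i (z_srv t \<omega>) + (c_srv t \<omega> - c_cl t i \<omega>)))^2))"
    using hetero_sq_integrable[THEN sq_integrableD]
    by (simp add: hetero_def Bochner_Integration.integral_sum)
  also have "\<dots> \<le> expectation (\<lambda>\<omega>. (1 / real N) * (\<Sum>i=1..N. 3 * ((norm (?w i \<omega>))^2 + (norm (?r i \<omega>))^2 + (norm (?u i \<omega>))^2))
       + (2 * (norm (G (z_srv t \<omega>)))^2 + 2 * b\<^sub>h^2))"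
    by (intro integral_mono pt integrable_mult_right Bochner_Integration.integrable_sum Bochner_Integration.integrable_add
        ints ints3 integrable_const hetero_sq_integrable[THEN sq_integrableD])
  also have "\<dots> = expectation (\<lambda>\<omega>. (1 / real N) * (\<Sum>i=1..N. 3 * ((norm (?w i \<omega>))^2 + (norm (?r i \<omega>))^2 + (norm (?u i \<omega>))^2)))
       + expectation (\<lambda>\<omega>. 2 * (norm (G (z_srv t \<omega>)))^2 + 2 * b\<^sub>h^2)"
    by (intro Bochner_Integration.integral_add integrable_mult_right Bochner_Integration.integrable_sum
        Bochner_Integration.integrable_add ints ints3 integrable_const)
  also have "expectation (\<lambda>\<omega>. 2 * (norm (G (z_srv t \<omega>)))^2 + 2 * b\<^sub>h^2) = 2 * map_sq t + 2 * b\<^sub>h^2"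
    using ints(1) by (simp add: map_sq_def prob_space)
  also have "expectation (\<lambda>\<omega>. (1 / real N) * (\<Sum>i=1..N. 3 * ((norm (?w i \<omega>))^2 + (norm (?r i \<omega>))^2 + (norm (?u i \<omega>))^2)))
      = (1 / real N) * (\<Sum>i=1..N. 3 * (msq (?w i) + track_err t i + comp_err t i))"
  proof -
    have "expectation (\<lambda>\<omega>. \<Sum>i=1..N. 3 * ((norm (?w i \<omega>))^2 + (norm (?r i \<omega>))^2 + (norm (?u i \<omega>))^2))
      = (\<Sum>i=1..N. expectation (\<lambda>\<omega>. 3 * ((norm (?w i \<omega>))^2 + (norm (?r i \<omega>))^2 + (norm (?u i \<omega>))^2)))"
      by (rule Bochner_Integration.integral_sum) (rule ints3)
    also have "\<dots> = (\<Sum>i=1..N. 3 * (msq (?w i) + track_err t i + comp_err t i))"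
      by (intro sum.cong refl E3)
    finally show ?thesis by (simp only: integral_mult_right_zero)
  qed
  also have "\<dots> \<le> (1 / real N) * (\<Sum>i=1..N. 3 * track_err t i + 3 * comp_err t i + 0 * 0 + 3 * (L^2 * step_gap t))"
  proof (intro mult_left_mono sum_mono)
    fix i assume i: "i \<in> {1..N}"
    have "msq (?w i) \<le> L^2 * step_gap t"
      by (rule grad_step_second_moment[OF f_lip[OF i] w[OF i]])
    then show "3 * (msq (?w i) + track_err t i + comp_err t i)
       \<le> 3 * track_err t i + 3 * comp_err t i + 0 * 0 + 3 * (L^2 * step_gap t)" by (simp del: One_nat_def)
  qed auto
  finally show ?thesis
    unfolding client_mean_affine mean_comp_err_def[symmetric] mean_track_err_def[symmetric] by simp
qed

lemma mean_dev_le: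
  "mean_dev t \<le> 2 * (\<alpha> * real K)^2 * (3 * b\<^sub>h^2 + noise_level
     + 3 * (L^2 * step_gap t + mean_track_err t + mean_comp_err t) + 2 * map_sq t + L^2 * mean_dev t)"
proof -
  define A where "A = 2 * (\<alpha> * real K)^2"
  have "mean_dev t \<le> (1 / real N) * (\<Sum>i=1..N. A * (b\<^sub>h^2 + noise_level + hetero t i + L^2 * dev t i))"
    unfolding mean_dev_def A_def by (intro mult_left_mono sum_mono dev_le) auto
  also have "(\<lambda>i. A * (b\<^sub>h^2 + noise_level + hetero t i + L^2 * dev t i))
     = (\<lambda>i. A * hetero t i + (A * L^2) * dev t i + 0 * 0 + A * (b\<^sub>h^2 + noise_level))"
    by (simp add: fun_eq_iff algebra_simps)
  also have "(1 / real N) * (\<Sum>i=1..N. A * hetero t i + (A * L^2) * dev t i + 0 * 0 + A * (b\<^sub>h^2 + noise_level))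
     = A * (b\<^sub>h^2 + noise_level + (1 / real N) * (\<Sum>i=1..N. hetero t i) + L^2 * mean_dev t)"
    unfolding client_mean_affine mean_dev_def[symmetric] by (simp add: algebra_simps)
  also have "\<dots> \<le> A * (b\<^sub>h^2 + noise_level
     + (3 * (L^2 * step_gap t + mean_track_err t + mean_comp_err t) + 2 * map_sq t + 2 * b\<^sub>h^2) + L^2 * mean_dev t)"
    by (intro mult_left_mono add_mono mean_hetero_le order_refl) (simp add: A_def)
  finally show ?thesis by (simp add: A_def algebra_simps)
qed

section \<open>Proximal descent along a path and in expectation\<close>

definition "obj y = avg_loss N f y + real_of_ereal (h y)"

text \<open>Two proximal inequalities are chained through the exact step p': p is tested at p', and
  p' at z. The error c - g then pairs with w - u only, and Young's inequality with weight \<beta>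
  leaves both squared norms over 2 \<beta>: that of w is the \<open>G\<close> term, and that of u is
  reduced by smoothness.\<close>

lemma prox_descent:
  fixes c z :: 'a
  assumes "\<bar>h z\<bar> \<noteq> \<infinity>"
  defines "p \<equiv> prox \<beta> h (z - \<beta> *\<^sub>R c)"
  shows "obj p + \<beta> / 2 * (norm (G z))^2 + (1 - \<beta> * L) / (2 * \<beta>) * (norm (p - z))^2
     \<le> obj z + \<beta> / 2 * (norm (c - grad_avg z))^2"
proof -
  define g where "g = grad_avg z"
  define p' where "p' = prox \<beta> h (z - \<beta> *\<^sub>R g)"
  define u where "u = p - z"
  define w where "w = p' - z"
  define k where "k = 1 / \<beta>"
  have k: "k > 0" "k * \<beta> = 1" using \<beta>_pos by (auto simp: k_def)
  note three = prox_three_point[OF h_proper h_closed h_convex \<beta>_pos]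
  have expand: "k * ((- u' - \<beta> *\<^sub>R d) \<bullet> y) = - k * (u' \<bullet> y) - (k * \<beta>) * (d \<bullet> y)" for u' d y :: 'a
    by (simp add: inner_diff_left right_diff_distrib)
  have e: "z - \<beta> *\<^sub>R c - p = - u - \<beta> *\<^sub>R c" "p' - p = w - u" "z - \<beta> *\<^sub>R g - p' = - w - \<beta> *\<^sub>R g" "z - p' = - w"
    by (simp_all add: u_def w_def)
  have "real_of_ereal (h p) + k * ((z - \<beta> *\<^sub>R c - p) \<bullet> (p' - p)) \<le> real_of_ereal (h p')"
    unfolding p_def p'_def k_def by (rule three) (rule prox_finite[OF h_proper h_closed h_convex \<beta>_pos])
  then have 1: "real_of_ereal (h p) + (k * (u \<bullet> u) - k * (u \<bullet> w) - c \<bullet> w + c \<bullet> u) \<le> real_of_ereal (h p')"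
    unfolding e expand k(2) by (simp add: inner_diff_right right_diff_distrib)
  have "real_of_ereal (h p') + k * ((z - \<beta> *\<^sub>R g - p') \<bullet> (z - p')) \<le> real_of_ereal (h z)"
    unfolding p'_def k_def by (rule three[OF assms(1)])
  then have 2: "real_of_ereal (h p') + (k * (w \<bullet> w) + g \<bullet> w) \<le> real_of_ereal (h z)"
    unfolding e expand k(2) by simp
  have 3: "avg_loss N f p - avg_loss N f z - g \<bullet> u \<le> L / 2 * (u \<bullet> u)"
    using avg_loss_quad[of p z] by (simp add: g_def u_def power2_norm_eq_inner)
  have "0 \<le> (k / 2) * (norm (\<beta> *\<^sub>R (c - g) - (w - u)))^2" using k by simp
  also have "\<dots> = \<beta> * (k * \<beta>) / 2 * (norm (c - g))^2 - (k * \<beta>) * ((c - g) \<bullet> (w - u)) + k / 2 * (norm (w - u))^2"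
    unfolding power2_norm_eq_inner by (simp add: inner_diff inner_commute algebra_simps)
  finally have 4: "(c \<bullet> w - c \<bullet> u - g \<bullet> w + g \<bullet> u)
      \<le> \<beta> / 2 * (norm (c - g))^2 + (k / 2 * (w \<bullet> w) - k * (u \<bullet> w) + k / 2 * (u \<bullet> u))"
    unfolding k(2) power2_norm_eq_inner[of "w - u"] by (simp add: inner_diff inner_commute algebra_simps)
  have G: "\<beta> / 2 * (norm (G z))^2 = k / 2 * (w \<bullet> w)"
  proof -
    have "G z = - (k *\<^sub>R w)" by (simp add: prox_grad_map_def w_def p'_def g_def k_def scaleR_diff_right)
    then have "\<beta> / 2 * (norm (G z))^2 = \<beta> / 2 * (k^2 * (norm w)^2)" by (simp add: power_mult_distrib)
    also have "\<dots> = (k * \<beta>) * k / 2 * (norm w)^2" by (simp add: power2_eq_square)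
    finally show ?thesis unfolding k(2) power2_norm_eq_inner[of w] by simp
  qed
  have u: "(1 - \<beta> * L) / (2 * \<beta>) * (norm (p - z))^2 = k / 2 * (u \<bullet> u) - L / 2 * (u \<bullet> u)"
    using \<beta>_pos by (simp add: k_def u_def power2_norm_eq_inner field_simps)
  show ?thesis unfolding G u obj_def g_def[symmetric] using 1 2 3 4 by linarith
qed

lemma srv_finite:
  assumes "\<bar>h z0\<bar> \<noteq> \<infinity>" shows "\<bar>h (z_srv t \<omega>)\<bar> \<noteq> \<infinity>"
  using assms by (cases t) (simp_all add: state_0 z_Suc prox_finite[OF h_proper h_closed h_convex \<beta>_pos])

lemma descent_sum:
  assumes h0: "\<bar>h z0\<bar> \<noteq> \<infinity>" and Fs: "\<And>y. \<bar>h y\<bar> \<noteq> \<infinity> \<Longrightarrow> Fs \<le> obj y" and \<beta>L: "\<beta> * L \<le> 1 / 25"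
  shows "(\<Sum>t<T. \<beta> / 2 * map_sq t + 12 / 25 / \<beta> * step_gap (Suc t))
     \<le> (obj z0 - Fs) + \<beta> * (\<Sum>t<T. avg_err (Suc t) + mean_comp_err (Suc t))"
proof -
  let ?u = "\<lambda>t i \<omega>. v_cl t i \<omega> - c_cl t i \<omega>"
  let ?e = "\<lambda>t \<omega>. (1 / real N) *\<^sub>R (\<Sum>i=1..N. v_cl t i \<omega>) - grad_avg (z_srv (t - 1) \<omega>)"
  have step: "obj (z_srv (Suc t) \<omega>) + (\<beta> / 2 * (norm (G (z_srv t \<omega>)))^2
       + 12 / 25 / \<beta> * (norm (z_srv (Suc t) \<omega> - z_srv t \<omega>))^2)
     \<le> obj (z_srv t \<omega>) + \<beta> * ((norm (?e (Suc t) \<omega>))^2 + (1 / real N) * (\<Sum>i=1..N. (norm (?u (Suc t) i \<omega>))^2))" for t \<omega>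
  proof -
    \<comment> \<open>\<beta> L <= 1/25 gives (1 - \<beta> L)/2 >= 12/25.\<close>
    have "12 / 25 / \<beta> \<le> (1 - \<beta> * L) / (2 * \<beta>)" using \<beta>_pos \<beta>L by (simp add: field_simps)
    then have 1: "12 / 25 / \<beta> * (norm (z_srv (Suc t) \<omega> - z_srv t \<omega>))^2
       \<le> (1 - \<beta> * L) / (2 * \<beta>) * (norm (z_srv (Suc t) \<omega> - z_srv t \<omega>))^2"
      by (rule mult_right_mono) simp
    \<comment> \<open>By \<open>c_eq\<close> this is the averaged momentum error minus the mean
      compression error; the factor 2 from splitting the square cancels the half in
      \<beta>/2.\<close>
    have "c_srv (Suc t) \<omega> - grad_avg (z_srv t \<omega>)
        = ?e (Suc t) \<omega> + - ((1 / real N) *\<^sub>R (\<Sum>i=1..N. ?u (Suc t) i \<omega>))"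
      by (simp add: c_eq sum_subtractf scaleR_diff_right)
    then have "(norm (c_srv (Suc t) \<omega> - grad_avg (z_srv t \<omega>)))^2
        \<le> 2 * (norm (?e (Suc t) \<omega>))^2 + 2 * (norm ((1 / real N) *\<^sub>R (\<Sum>i=1..N. ?u (Suc t) i \<omega>)))^2"
      using norm_add_power2_le[of "?e (Suc t) \<omega>" "- ((1 / real N) *\<^sub>R (\<Sum>i=1..N. ?u (Suc t) i \<omega>))"]
      by (simp only: norm_minus_cancel)
    also have "\<dots> \<le> 2 * (norm (?e (Suc t) \<omega>))^2 + 2 * ((1 / real N) * (\<Sum>i=1..N. (norm (?u (Suc t) i \<omega>))^2))"
      by (intro add_mono mult_left_mono norm_client_mean_power2_le order_refl) auto
    finally have "\<beta> / 2 * (norm (c_srv (Suc t) \<omega> - grad_avg (z_srv t \<omega>)))^2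
       \<le> \<beta> / 2 * (2 * (norm (?e (Suc t) \<omega>))^2 + 2 * ((1 / real N) * (\<Sum>i=1..N. (norm (?u (Suc t) i \<omega>))^2)))"
      using \<beta>_pos by (intro mult_left_mono) auto
    also have "\<dots> = \<beta> * ((norm (?e (Suc t) \<omega>))^2 + (1 / real N) * (\<Sum>i=1..N. (norm (?u (Suc t) i \<omega>))^2))"
      by (simp add: distrib_left)
    finally show ?thesis
      using prox_descent[OF srv_finite[OF h0], of t \<omega> "c_srv (Suc t) \<omega>"] 1 unfolding z_Suc[symmetric] by linarith
  qed
  \<comment> \<open>After summation the only random objective value is the one at z^T, and the
    constant Fs replaces it, so only squared norms are integrated.\<close>
  have path: "(\<Sum>t<T. \<beta> / 2 * (norm (G (z_srv t \<omega>)))^2 + 12 / 25 / \<beta> * (norm (z_srv (Suc t) \<omega> - z_srv t \<omega>))^2)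
     \<le> (obj z0 - Fs) + (\<Sum>t<T. \<beta> * ((norm (?e (Suc t) \<omega>))^2 + (1 / real N) * (\<Sum>i=1..N. (norm (?u (Suc t) i \<omega>))^2)))" for \<omega>
  proof -
    have "obj (z_srv T \<omega>) + (\<Sum>t<T. \<beta> / 2 * (norm (G (z_srv t \<omega>)))^2 + 12 / 25 / \<beta> * (norm (z_srv (Suc t) \<omega> - z_srv t \<omega>))^2)
      \<le> obj z0 + (\<Sum>t<T. \<beta> * ((norm (?e (Suc t) \<omega>))^2 + (1 / real N) * (\<Sum>i=1..N. (norm (?u (Suc t) i \<omega>))^2)))"
    proof (induction T)
      case (Suc T)
      then show ?case using step[of T \<omega>] unfolding sum.lessThan_Suc by linarith
    qed (simp add: state_0)
    then show ?thesis using Fs[OF srv_finite[OF h0, of T \<omega>]] by linarith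
  qed
  have ints: "integrable M (\<lambda>\<omega>. (norm (G (z_srv t \<omega>)))^2)"
    "integrable M (\<lambda>\<omega>. (norm (z_srv (Suc t) \<omega> - z_srv t \<omega>))^2)"
    "integrable M (\<lambda>\<omega>. (norm (?e t \<omega>))^2)" for t
    by (intro sq_integrableD sq_integrable_intros map_sq_integrable state_sq_integrable grad_avg_sq_integrable; assumption)+
  have intu: "integrable M (\<lambda>\<omega>. (norm (?u t i \<omega>))^2)" if "i \<in> {1..N}" for t i
    using that by (intro sq_integrableD sq_integrable_intros state_sq_integrable)
  have E1: "expectation (\<lambda>\<omega>. \<beta> / 2 * (norm (G (z_srv t \<omega>)))^2 + 12 / 25 / \<beta> * (norm (z_srv (Suc t) \<omega> - z_srv t \<omega>))^2)
     = \<beta> / 2 * map_sq t + 12 / 25 / \<beta> * step_gap (Suc t)" for t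
    using ints(1,2)[of t] by (simp add: map_sq_def step_gap_def)
  have E2: "expectation (\<lambda>\<omega>. \<beta> * ((norm (?e t \<omega>))^2 + (1 / real N) * (\<Sum>i=1..N. (norm (?u t i \<omega>))^2)))
     = \<beta> * (avg_err t + mean_comp_err t)" for t
  proof -
    have "expectation (\<lambda>\<omega>. (1 / real N) * (\<Sum>i=1..N. (norm (?u t i \<omega>))^2)) = mean_comp_err t"
      using intu by (simp add: mean_comp_err_def comp_err_def Bochner_Integration.integral_sum)
    moreover have "integrable M (\<lambda>\<omega>. (1 / real N) * (\<Sum>i=1..N. (norm (?u t i \<omega>))^2))"
      by (intro integrable_mult_right Bochner_Integration.integrable_sum intu)
    ultimately show ?thesis
      by (simp only: integral_mult_right_zero Bochner_Integration.integral_add[OF ints(3)[of t]] avg_err_def)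
  qed
  have I1: "integrable M (\<lambda>\<omega>. \<beta> / 2 * (norm (G (z_srv t \<omega>)))^2 + 12 / 25 / \<beta> * (norm (z_srv (Suc t) \<omega> - z_srv t \<omega>))^2)" for t
    by (intro Bochner_Integration.integrable_add integrable_mult_right ints)
  have I2: "integrable M (\<lambda>\<omega>. \<beta> * ((norm (?e t \<omega>))^2 + (1 / real N) * (\<Sum>i=1..N. (norm (?u t i \<omega>))^2)))" for t
    by (intro Bochner_Integration.integrable_add integrable_mult_right Bochner_Integration.integrable_sum ints intu)
  have "(\<Sum>t<T. \<beta> / 2 * map_sq t + 12 / 25 / \<beta> * step_gap (Suc t))
    = expectation (\<lambda>\<omega>. \<Sum>t<T. \<beta> / 2 * (norm (G (z_srv t \<omega>)))^2 + 12 / 25 / \<beta> * (norm (z_srv (Suc t) \<omega> - z_srv t \<omega>))^2)"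
    unfolding E1[symmetric] by (rule Bochner_Integration.integral_sum[symmetric]) (rule I1)
  also have "\<dots> \<le> expectation (\<lambda>\<omega>. (obj z0 - Fs) + (\<Sum>t<T. \<beta> * ((norm (?e (Suc t) \<omega>))^2
       + (1 / real N) * (\<Sum>i=1..N. (norm (?u (Suc t) i \<omega>))^2))))"
    by (intro integral_mono path Bochner_Integration.integrable_add Bochner_Integration.integrable_sum I1 I2 integrable_const)
  also have "\<dots> = (obj z0 - Fs) + expectation (\<lambda>\<omega>. \<Sum>t<T. \<beta> * ((norm (?e (Suc t) \<omega>))^2
       + (1 / real N) * (\<Sum>i=1..N. (norm (?u (Suc t) i \<omega>))^2)))"
    by (rule expectation_const_add) (intro Bochner_Integration.integrable_sum I2)
  also have "expectation (\<lambda>\<omega>. \<Sum>t<T. \<beta> * ((norm (?e (Suc t) \<omega>))^2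
       + (1 / real N) * (\<Sum>i=1..N. (norm (?u (Suc t) i \<omega>))^2))) = (\<Sum>t<T. \<beta> * (avg_err (Suc t) + mean_comp_err (Suc t)))"
    unfolding E2[symmetric] by (rule Bochner_Integration.integral_sum) (rule I2)
  finally show ?thesis by (simp add: sum_distrib_left)
qed

lemma mean_map_sq_bound:
  assumes h0: "\<bar>h z0\<bar> \<noteq> \<infinity>" and Fs: "\<And>y. \<bar>h y\<bar> \<noteq> \<infinity> \<Longrightarrow> Fs \<le> obj y"
    and \<beta>L: "\<beta> * L \<le> \<eta>^2 / 25" "\<beta> * L \<le> (1 - q)^2 / 25"
    and w: "(\<alpha> * real K)^2 * (16 + 161 * (\<eta>^2 * (1 / (1 - q))^2)) \<le> 25 * \<eta>^2 * \<beta>^2"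
  shows "3 / 20 * \<beta> * (\<Sum>t<T. map_sq t) \<le> (obj z0 - Fs)
     + \<beta> * (8 / \<eta> * avg_err 0 + 7 * (1 / (1 - q)) * mean_comp_err 0 + 70 * \<eta> * (1 / (1 - q))^2 * mean_track_err 0)
     + real T * (\<beta> * ((17 * \<eta> / real N + 14 * \<eta>^2 * (1 / (1 - q)) + 140 * \<eta> ^ 3 * (1 / (1 - q))^2) * noise_level
        + 92 / 5 * (16 + 161 * (\<eta>^2 * (1 / (1 - q))^2)) * (L^2 * (\<alpha> * real K)^2) * b\<^sub>h^2))"
proof (rule lyapunov_telescope[where Dl = step_gap])
  show "0 < \<beta>" by (rule \<beta>_pos)
  show nn: "0 \<le> step_gap t" "0 \<le> avg_err t" "0 \<le> mean_track_err t" "0 \<le> mean_comp_err t" for t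
    by (simp_all add: step_gap_def avg_err_def mean_track_err_def track_err_def mean_comp_err_def comp_err_def sum_nonneg)
  have nn': "0 \<le> mean_dev t" "0 \<le> noise_level" "0 \<le> map_sq t" for t
    by (simp_all add: mean_dev_def dev_def noise_level_def map_sq_def sum_nonneg)
  show "step_gap 0 = 0" by (simp add: step_gap_def)
  have "\<eta>^2 \<le> 1" using \<eta>_pos \<eta>_le by (simp add: power_le_one)
  then have \<beta>L': "\<beta> * L \<le> 1 / 25" using \<beta>L(1) by simp
  show "(\<Sum>t<T. \<beta> / 2 * map_sq t + 12 / 25 / \<beta> * step_gap (Suc t))
     \<le> (obj z0 - Fs) + \<beta> * (\<Sum>t<T. avg_err (Suc t) + mean_comp_err (Suc t))"
    by (rule descent_sum[OF h0 _ \<beta>L']) (rule Fs)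
  have N: "0 < real N" using N1 by simp
  show "(8 / \<eta> + 1) * avg_err (Suc t) + (7 * (1 / (1 - q)) + 1) * mean_comp_err (Suc t)
      + 70 * \<eta> * (1 / (1 - q))^2 * mean_track_err (Suc t)
    \<le> 8 / \<eta> * avg_err t + 7 * (1 / (1 - q)) * mean_comp_err t + 70 * \<eta> * (1 / (1 - q))^2 * mean_track_err t
      + 12 / 25 / \<beta>^2 * step_gap t + 7 / 20 * map_sq t
      + ((17 * \<eta> / real N + 14 * \<eta>^2 * (1 / (1 - q)) + 140 * \<eta> ^ 3 * (1 / (1 - q))^2) * noise_level
        + 92 / 5 * (16 + 161 * (\<eta>^2 * (1 / (1 - q))^2)) * (L^2 * (\<alpha> * real K)^2) * b\<^sub>h^2)" for t
    unfolding add.assoc[symmetric]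
    by (rule lyapunov_step[OF \<eta>_pos \<eta>_le q_nonneg q_less N L_pos \<beta>_pos nn(1)[of t] nn'(1)[of t]
        nn(2)[of t] nn(3)[of t] nn(4)[of t] nn'(2) nn'(3)[of t]
        avg_err_Suc mean_track_err_Suc mean_comp_err_Suc mean_dev_le \<beta>L w])
qed (use \<eta>_pos q_less in auto)


text \<open>The gap is infinite if z0 lies outside the domain of h or the objective is unbounded
  below; otherwise Fs is the real infimum and the remaining estimates are real.\<close>

lemma initial_gap_cases:
  obtains (infinite) "e2ennreal (objective N f h z0 - (INF x. objective N f h x)) = \<infinity>"
  | (finite) Fs where "\<bar>h z0\<bar> \<noteq> \<infinity>" "\<And>y. \<bar>h y\<bar> \<noteq> \<infinity> \<Longrightarrow> Fs \<le> obj y"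
      "e2ennreal (objective N f h z0 - (INF x. objective N f h x)) = ennreal (obj z0 - Fs)"
proof -
  let ?I = "INF x. objective N f h x"
  have ge: "?I \<le> objective N f h y" for y by (rule INF_lower) simp
  have "h z0 \<noteq> -\<infinity>" using h_proper by (simp add: proper_fun_def)
  then consider "h z0 = \<infinity>" | a where "h z0 = ereal a" by (cases "h z0") auto
  then show thesis
  proof cases
    case 1
    then have "objective N f h z0 - ?I = \<infinity>" by (simp add: objective_def)
    then show thesis using infinite by simp
  next
    case (2 a)
    then have O: "objective N f h z0 = ereal (obj z0)" by (simp add: objective_def obj_def)
    then have "?I \<noteq> \<infinity>" using ge[of z0] by auto
    then consider "?I = -\<infinity>" | Fs where "?I = ereal Fs" by (cases ?I) auto
    then show thesis
    proof cases
      case 1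
      then have "objective N f h z0 - ?I = \<infinity>" using O by simp
      then show thesis using infinite by simp
    next
      case I: (2 Fs)
      have "Fs \<le> obj y" if "\<bar>h y\<bar> \<noteq> \<infinity>" for y
        using ge[of y, unfolded I] that unfolding objective_def obj_def by (cases "h y") auto
      moreover have "e2ennreal (objective N f h z0 - ?I) = ennreal (obj z0 - Fs)"
        unfolding I O by (simp add: e2ennreal_ereal)
      ultimately show thesis using 2 by (intro finite[of Fs]) simp_all
    qed
  qed
qed

lemma nn_integral_norm_power2:
  "sq_integrable M X \<Longrightarrow> (\<integral>\<^sup>+\<omega>. ennreal ((norm (X \<omega>))^2) \<partial>M) = ennreal (msq X)"
  by (rule nn_integral_eq_integral) (auto intro: sq_integrableD)

text \<open>At index 0 the iterate is deterministic, so the objective gap is a constant integrand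
  and the other terms match the real error quantities.\<close>

lemma lyapunov_0:
  assumes "e2ennreal (objective N f h z0 - (INF x. objective N f h x)) = ennreal F0" "0 \<le> F0"
  shows "lyapunov M N f h \<beta> \<eta> q state 0 = ennreal (F0
     + \<beta> * (8 / \<eta> * avg_err 0 + 7 * (1 / (1 - q)) * mean_comp_err 0 + 70 * \<eta> * (1 / (1 - q))^2 * mean_track_err 0))"
proof -
  have sq: "sq_integrable M (\<lambda>\<omega>. (1 / real N) *\<^sub>R (\<Sum>i=1..N. v_cl 0 i \<omega>) - grad_avg (z_srv (0 - 1) \<omega>))"
    "\<And>i. i \<in> {1..N} \<Longrightarrow> sq_integrable M (\<lambda>\<omega>. v_cl 0 i \<omega> - c_cl 0 i \<omega>)"
    "\<And>i. i \<in> {1..N} \<Longrightarrow> sq_integrable M (\<lambda>\<omega>. v_cl 0 i \<omega> - grad i (z_srv (0 - 1) \<omega>))"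
    by (intro sq_integrable_intros state_sq_integrable grad_avg_sq_integrable grad_sq_integrable; assumption)+
  have nn: "0 \<le> avg_err 0" "0 \<le> comp_err 0 i" "0 \<le> track_err 0 i" for i
    by (simp_all add: avg_err_def comp_err_def track_err_def)
  have 1: "(\<integral>\<^sup>+\<omega>. e2ennreal (objective N f h (srv_z (state 0 \<omega>)) - (INF x. objective N f h x)) \<partial>M) = ennreal F0"
    using assms state_0(1) by (simp add: z_srv_def emeasure_space_1)
  have 2: "(\<integral>\<^sup>+\<omega>. ennreal ((norm ((1 / real N) *\<^sub>R (\<Sum>i=1..N. cl_v (state 0 \<omega>) i)
                - gradient (avg_loss N f) (srv_z (state (0 - 1) \<omega>))))^2) \<partial>M) = ennreal (avg_err 0)"
    using nn_integral_norm_power2[OF sq(1)] unfolding avg_err_def v_cl_def z_srv_def .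
  have 3: "(\<Sum>i=1..N. \<integral>\<^sup>+\<omega>. ennreal ((norm (cl_v (state 0 \<omega>) i - cl_c (state 0 \<omega>) i))^2) \<partial>M)
      = ennreal (real N * mean_comp_err 0)"
  proof -
    have "(\<Sum>i=1..N. \<integral>\<^sup>+\<omega>. ennreal ((norm (cl_v (state 0 \<omega>) i - cl_c (state 0 \<omega>) i))^2) \<partial>M) = (\<Sum>i=1..N. ennreal (comp_err 0 i))"
      using nn_integral_norm_power2[OF sq(2)] unfolding comp_err_def v_cl_def c_cl_def by (intro sum.cong) auto
    then show ?thesis using N1 nn by (simp add: sum_ennreal mean_comp_err_def)
  qed
  have 4: "(\<Sum>i=1..N. \<integral>\<^sup>+\<omega>. ennreal ((norm (cl_v (state 0 \<omega>) i - gradient (f i) (srv_z (state (0 - 1) \<omega>))))^2) \<partial>M)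
      = ennreal (real N * mean_track_err 0)"
  proof -
    have "(\<Sum>i=1..N. \<integral>\<^sup>+\<omega>. ennreal ((norm (cl_v (state 0 \<omega>) i - gradient (f i) (srv_z (state (0 - 1) \<omega>))))^2) \<partial>M)
       = (\<Sum>i=1..N. ennreal (track_err 0 i))"
      using nn_integral_norm_power2[OF sq(3)] unfolding track_err_def v_cl_def z_srv_def by (intro sum.cong) auto
    then show ?thesis using N1 nn by (simp add: sum_ennreal mean_track_err_def)
  qed
  have nn': "0 \<le> mean_comp_err 0" "0 \<le> mean_track_err 0"
    using nn by (simp_all add: mean_comp_err_def mean_track_err_def sum_nonneg)
  have coeff: "0 \<le> 8 * \<beta> / \<eta>" "0 \<le> 7 * \<beta> / (1 - q) * (1 / real N)" "0 \<le> 70 * \<eta> * \<beta> / (1 - q)^2 * (1 / real N)"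
    using \<beta>_pos \<eta>_pos q_less by simp_all
  have cancel: "k * (1 / real N) * (real N * m) = k * m" for k m using N1 by simp
  have terms: "0 \<le> 8 * \<beta> / \<eta> * avg_err 0" "0 \<le> 7 * \<beta> / (1 - q) * (1 / real N) * (real N * mean_comp_err 0)"
    "0 \<le> 70 * \<eta> * \<beta> / (1 - q)^2 * (1 / real N) * (real N * mean_track_err 0)"
    by (intro mult_nonneg_nonneg[OF coeff(1)] mult_nonneg_nonneg[OF coeff(2)] mult_nonneg_nonneg[OF coeff(3)]
        mult_nonneg_nonneg[OF of_nat_0_le_iff] nn nn')+
  have "lyapunov M N f h \<beta> \<eta> q state 0 = ennreal (F0 + 8 * \<beta> / \<eta> * avg_err 0
     + 7 * \<beta> / (1 - q) * (1 / real N) * (real N * mean_comp_err 0)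
     + 70 * \<eta> * \<beta> / (1 - q)^2 * (1 / real N) * (real N * mean_track_err 0))"
    unfolding lyapunov_def 1 2 3 4 ennreal_mult'[OF coeff(1), symmetric] ennreal_mult'[OF coeff(2), symmetric]
      ennreal_mult'[OF coeff(3), symmetric]
    by (simp only: ennreal_plus add_nonneg_nonneg assms(2) terms)
  also have "F0 + 8 * \<beta> / \<eta> * avg_err 0
     + 7 * \<beta> / (1 - q) * (1 / real N) * (real N * mean_comp_err 0)
     + 70 * \<eta> * \<beta> / (1 - q)^2 * (1 / real N) * (real N * mean_track_err 0) = F0
     + \<beta> * (8 / \<eta> * avg_err 0 + 7 * (1 / (1 - q)) * mean_comp_err 0 + 70 * \<eta> * (1 / (1 - q))^2 * mean_track_err 0)"
    unfolding cancel by (simp add: algebra_simps power_divide)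
  finally show ?thesis .
qed

end

theorem theorem1:
  fixes N K B :: nat
    and \<alpha> \<beta> \<eta> \<eta>\<^sub>g q L \<sigma> B\<^sub>h \<gamma> C_stoc C_approx :: real
    and z0 :: "real ^ 'p::finite"
    and f :: "nat \<Rightarrow> real ^ 'p \<Rightarrow> real"
    and h :: "real ^ 'p \<Rightarrow> ereal"
    and D :: "nat \<Rightarrow> 's measure"
    and loss :: "nat \<Rightarrow> real ^ 'p \<Rightarrow> 's \<Rightarrow> real"
    and R :: "'r measure"
    and C :: "'r \<Rightarrow> real ^ 'p \<Rightarrow> real ^ 'p"
    and M :: "'w measure"
    and \<xi> :: "nat \<Rightarrow> nat \<Rightarrow> nat \<Rightarrow> nat \<Rightarrow> 'w \<Rightarrow> 's"
    and \<zeta> :: "nat \<Rightarrow> nat \<Rightarrow> 'w \<Rightarrow> 'r"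
    and S :: "nat \<Rightarrow> 'w \<Rightarrow> (real ^ 'p) fed_state"
  assumes "N \<ge> 1" and "K \<ge> 1" and "B \<ge> 1"
    and "\<alpha> > 0" and "\<eta>\<^sub>g > 0" and "0 < \<eta>" and "\<eta> \<le> 1" and "0 \<le> q" and "q < 1"
    and "L > 0" and "\<sigma> > 0" and "B\<^sub>h > 0"

    (* smoothness *)
    and "\<And>i x. i \<in> {1..N} \<Longrightarrow> f i differentiable (at x)"
    and "\<And>i x y. i \<in> {1..N} \<Longrightarrow>
           f i x - f i y - gradient (f i) y \<bullet> (x - y) \<le> L / 2 * (norm (x - y))\<^sup>2"
    and "\<And>i x y. i \<in> {1..N} \<Longrightarrow>
           norm (gradient (f i) x - gradient (f i) y) \<le> L * norm (x - y)"

    (* regularizer *)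
    and "proper_fun h" and "closed_fun h" and "convex_fun h"
    and "\<And>z g. g \<in> subdifferential h z \<Longrightarrow> norm g \<le> B\<^sub>h"

    (* stochastic gradients *)
    and "\<And>i. i \<in> {1..N} \<Longrightarrow> prob_space (D i)"
    and "\<And>i x s. i \<in> {1..N} \<Longrightarrow> s \<in> space (D i) \<Longrightarrow> (\<lambda>y. loss i y s) differentiable (at x)"
    and "\<And>i x. i \<in> {1..N} \<Longrightarrow> has_bochner_integral (D i) (loss i x) (f i x)"
    and "\<And>i x. i \<in> {1..N} \<Longrightarrow>
           has_bochner_integral (Pi\<^sub>M {1..B} (\<lambda>b. D i))
             (\<lambda>s. minibatch_grad (loss i) B s x) (gradient (f i) x)"
    and "\<And>i x. i \<in> {1..N} \<Longrightarrow>
           (\<integral>\<^sup>+s. ennreal ((norm (minibatch_grad (loss i) B s x - gradient (f i) x))\<^sup>2)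
              \<partial>Pi\<^sub>M {1..B} (\<lambda>b. D i)) \<le> ennreal (\<sigma>\<^sup>2 / real B)"

    (* contractive randomized compressor *)
    and "prob_space R"
    and "(\<lambda>(r, x). C r x) \<in> borel_measurable (R \<Otimes>\<^sub>M borel)"
    and "\<And>x. (\<integral>\<^sup>+r. ennreal ((norm (C r x - x))\<^sup>2) \<partial>R) \<le> ennreal (q\<^sup>2 * (norm x)\<^sup>2)"

    (* all samples and all compressor calls are fresh, i.e. mutually independent *)
    and "prob_space M"
    and "\<And>t i k b. i \<in> {1..N} \<Longrightarrow> k < K \<Longrightarrow> b \<in> {1..B} \<Longrightarrow>
           \<xi> t i k b \<in> measurable M (D i) \<and> distr M (D i) (\<xi> t i k b) = D i"
    and "\<And>t i. i \<in> {1..N} \<Longrightarrow> \<zeta> t i \<in> measurable M R \<and> distr M R (\<zeta> t i) = R"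
    and "prob_space.indep_sets M (draw_events M D R \<xi> \<zeta>) (draws N K B)"

    (* iterates and step sizes *)
    and "\<beta> = \<alpha> * \<eta>\<^sub>g * real K"
    and "\<And>t \<omega>. S t \<omega> = fedcef N K \<alpha> \<beta> \<eta> h z0
           (\<lambda>t i k. minibatch_grad (loss i) B (\<lambda>b. \<xi> t i k b \<omega>)) (\<lambda>t i. C (\<zeta> t i \<omega>)) t"
    and "\<beta> \<le> min (\<eta>\<^sup>2) ((1 - q)\<^sup>2) / (25 * L)"
    and "\<eta>\<^sub>g \<ge> sqrt (16 * (1 - q)\<^sup>2 + 161 * \<eta>\<^sup>2) / (5 * \<eta> * (1 - q))"

    (* constants of the bound *)
    and "\<gamma> = 0.15"
    and "C_stoc = 6.7 * (17 * \<eta> / real N + 14 * \<eta>\<^sup>2 / (1 - q) + 140 * \<eta> ^ 3 / (1 - q)\<^sup>2)"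
    and "C_approx = 18.4 / \<gamma> * (16 + 161 * \<eta>\<^sup>2 / (1 - q)\<^sup>2)"
  shows "\<And>T. T \<ge> (1::nat) \<Longrightarrow>
    ennreal (1 / real T) *
      (\<Sum>t<T. \<integral>\<^sup>+\<omega>. ennreal ((norm (prox_grad_map (avg_loss N f) h \<beta> (srv_z (S t \<omega>))))\<^sup>2) \<partial>M)
    \<le> lyapunov M N f h \<beta> \<eta> q S 0 / ennreal (\<gamma> * \<beta> * real T)
       + ennreal (C_stoc * (\<sigma>\<^sup>2 / (real K * real B)))
       + ennreal (C_approx * (L\<^sup>2 * \<beta>\<^sup>2 / \<eta>\<^sub>g\<^sup>2) * B\<^sub>h\<^sup>2)"
proof -
  fix T :: nat assume T: "T \<ge> 1"
  have \<beta>_pos: "\<beta> > 0" using assms(2,4,5,32) by simp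
  interpret fedcef_setting M N K B \<alpha> \<beta> \<eta> q L \<sigma> B\<^sub>h z0 f h D loss R C \<xi> \<zeta>
    by (intro fedcef_setting.intro fedcef_setting_axioms.intro) (fact assms \<beta>_pos)+
  have S: "S = state" using assms(33) by (simp add: fun_eq_iff state_def)
  have \<gamma>\<beta>T: "0 < \<gamma> * \<beta> * real T" using \<beta>_pos T assms(36) by simp
  have \<beta>L: "\<beta> * L \<le> \<eta>^2 / 25" "\<beta> * L \<le> (1 - q)^2 / 25"
    using assms(34) \<open>L > 0\<close> by (simp_all add: pos_le_divide_eq)
  have "\<beta> = (\<alpha> * real K) * \<eta>\<^sub>g" using assms(32) by simp
  then have w: "(\<alpha> * real K)^2 * (16 + 161 * (\<eta>^2 * (1 / (1 - q))^2)) \<le> 25 * \<eta>^2 * \<beta>^2"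
    using local_step_weight_le[OF assms(6,9,35), of "\<alpha> * real K"] by simp
  show "ennreal (1 / real T) *
      (\<Sum>t<T. \<integral>\<^sup>+\<omega>. ennreal ((norm (prox_grad_map (avg_loss N f) h \<beta> (srv_z (S t \<omega>))))^2) \<partial>M)
    \<le> lyapunov M N f h \<beta> \<eta> q S 0 / ennreal (\<gamma> * \<beta> * real T)
       + ennreal (C_stoc * (\<sigma>^2 / (real K * real B)))
       + ennreal (C_approx * (L^2 * \<beta>^2 / \<eta>\<^sub>g^2) * B\<^sub>h^2)"
  proof (cases rule: initial_gap_cases)
    case infinite
    then have "(\<integral>\<^sup>+\<omega>. e2ennreal (objective N f h (srv_z (S 0 \<omega>)) - (INF x. objective N f h x)) \<partial>M) = \<infinity>"
      unfolding S using state_0(1) by (simp add: z_srv_def emeasure_space_1)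
    then have "lyapunov M N f h \<beta> \<eta> q S 0 = \<infinity>" by (simp add: lyapunov_def)
    then show ?thesis using \<gamma>\<beta>T by (simp add: ennreal_top_divide)
  next
    case (finite Fs)
    have F0: "0 \<le> obj z0 - Fs" using finite(1,2) by simp
    define \<Psi> where "\<Psi> = obj z0 - Fs + \<beta> * (8 / \<eta> * avg_err 0 + 7 * (1 / (1 - q)) * mean_comp_err 0
      + 70 * \<eta> * (1 / (1 - q))^2 * mean_track_err 0)"
    have \<Psi>: "lyapunov M N f h \<beta> \<eta> q S 0 = ennreal \<Psi>"
      unfolding S \<Psi>_def by (rule lyapunov_0[OF finite(3) F0])
    have \<Psi>0: "0 \<le> \<Psi>" unfolding \<Psi>_def using F0 \<beta>_pos \<open>0 < \<eta>\<close> \<open>q < 1\<close>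
      by (simp add: avg_err_def mean_comp_err_def comp_err_def mean_track_err_def track_err_def sum_nonneg)
    define p where "p = 1 / (1 - q)"
    define c where "c = 17 * \<eta> / real N + 14 * \<eta>^2 * p + 140 * \<eta> ^ 3 * p^2"
    define w where "w = 16 + 161 * (\<eta>^2 * p^2)"
    define A where "A = 92 / 5 * w * (L^2 * (\<alpha> * real K)^2) * B\<^sub>h^2"
    have p: "p > 0" using \<open>q < 1\<close> by (simp add: p_def)
    have c0: "0 \<le> c * noise_level" using p \<open>0 < \<eta>\<close> by (simp add: c_def noise_level_def)
    have A0: "0 \<le> A" by (simp add: A_def w_def)
    have C_stoc: "C_stoc * (\<sigma>^2 / (real K * real B)) = 67 / 10 * (c * noise_level)"
      unfolding assms(37) by (simp add: c_def p_def noise_level_def power_divide)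
    \<comment> \<open>\<beta> divided by the server rate is \<alpha> K, and 18.4/\<gamma> =
      (92/5)(20/3).\<close>
    have C_approx: "C_approx * (L^2 * \<beta>^2 / \<eta>\<^sub>g^2) * B\<^sub>h^2 = 20 / 3 * A"
      unfolding assms(38,36,32) using \<open>\<eta>\<^sub>g > 0\<close>
      by (simp add: A_def w_def p_def power_divide power_mult_distrib)
    have "3 / 20 * \<beta> * (\<Sum>t<T. map_sq t) \<le> \<Psi> + real T * (\<beta> * (c * noise_level + A))"
      unfolding \<Psi>_def c_def A_def w_def p_def
      by (rule mean_map_sq_bound[OF finite(1) _ \<beta>L w]) (rule finite(2))
    then have "3 / 20 * \<beta> * (\<Sum>t<T. map_sq t) / (3 / 20 * \<beta> * real T)
        \<le> (\<Psi> + real T * (\<beta> * (c * noise_level + A))) / (3 / 20 * \<beta> * real T)"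
      using \<beta>_pos T by (intro divide_right_mono) auto
    then have "1 / real T * (\<Sum>t<T. map_sq t) \<le> \<Psi> / (3 / 20 * \<beta> * real T) + 20 / 3 * (c * noise_level) + 20 / 3 * A"
      using \<beta>_pos T by (simp add: add_divide_distrib distrib_left)
    \<comment> \<open>6.7 rounds up 1/\<gamma> = 20/3.\<close>
    also have "\<dots> \<le> \<Psi> / (\<gamma> * \<beta> * real T) + 67 / 10 * (c * noise_level) + 20 / 3 * A"
      unfolding assms(36) using c0 by simp
    finally have main: "1 / real T * (\<Sum>t<T. map_sq t) \<le> \<Psi> / (\<gamma> * \<beta> * real T) + 67 / 10 * (c * noise_level) + 20 / 3 * A" .
    have "ennreal (1 / real T) * (\<Sum>t<T. \<integral>\<^sup>+\<omega>. ennreal ((norm (G (srv_z (S t \<omega>))))^2) \<partial>M)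
        = ennreal (1 / real T * (\<Sum>t<T. map_sq t))"
    proof -
      have "(\<integral>\<^sup>+\<omega>. ennreal ((norm (G (srv_z (S t \<omega>))))^2) \<partial>M) = ennreal (map_sq t)" for t
        using nn_integral_norm_power2[OF map_sq_integrable[of t]] unfolding S map_sq_def z_srv_def .
      moreover have "0 \<le> map_sq t" for t by (simp add: map_sq_def)
      ultimately have sum: "(\<Sum>t<T. \<integral>\<^sup>+\<omega>. ennreal ((norm (G (srv_z (S t \<omega>))))^2) \<partial>M) = ennreal (\<Sum>t<T. map_sq t)"
        by (simp add: sum_ennreal)
      show ?thesis unfolding sum by (rule ennreal_mult'[symmetric]) simp
    qed
    also have "\<dots> \<le> ennreal (\<Psi> / (\<gamma> * \<beta> * real T) + 67 / 10 * (c * noise_level) + 20 / 3 * A)"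
      by (rule ennreal_leI[OF main])
    also have "\<dots> = ennreal \<Psi> / ennreal (\<gamma> * \<beta> * real T) + ennreal (67 / 10 * (c * noise_level)) + ennreal (20 / 3 * A)"
      using \<Psi>0 \<gamma>\<beta>T c0 A0 by (simp add: divide_ennreal)
    finally show ?thesis unfolding \<Psi> C_stoc C_approx .
  qed
qed

end
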